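(* Neither $\alpha_1$ nor $\alpha_a$ is a $\pi$-adically completely continuous operator, but for every real $c>0$ both $\alpha_1$ and $\alpha_a$ are $(\pi^{1/c},p)$-adically completely continuous operators.
   Context: Let $p$ be a prime, $q=p^a$ with $a\ge1$, $\mathbb{Q}_q$ the unramified extension of $\mathbb{Q}_p$ of degree $a$ with ring of integers $\mathbb{Z}_q$, and $\tau$ the Frobenius generator of $\mathrm{Gal}(\mathbb{Q}_q/\mathbb{Q}_p)$. Let $\ell\ge2$ and let $P_1=\infty$, $P_2=0$, $P_3,\dots,P_\ell$ be distinct elements of $\mathbb{F}_q\cup\{\infty\}$. $\widehat{x}$ denotes the Teichmüller lift, and $\frac{1}{x-\widehat{P}_1}:=x$. Let $f(x)=\sum_{j=1}^{\ell}\sum_{i=1}^{d_j}\frac{a_{ij}}{(x-\widehat{P}_j)^i}$, $a_{ij}\in\mathbb{Z}_q$, $d_j\ge1$, $a_{d_j,j}\ne0$. $E(x)=\exp(\sum_{i\ge0}x^{p^i}/p^i)$ is the Artin–Hasse exponential and $\pi$ is a formal variable. On $\mathbb{Z}_q[[\pi]]$ put $|\sum b_i\pi^i|_{\pi,p}=\max_i|b_i|_pp^{-i}$. Let $\mathcal{O}_a=\mathbb{Z}_q[[\pi]]\hat\otimes_{\mathbb{Z}_q}\mathbb{Z}_q\cong\mathbb{Z}_q[[\pi]]$. Let $B_{ij}=(x-\widehat{P}_j)^{-i}$, $i\ge0$, $1\le j\le\ell$ ($B_{0j}=1$ counted once). $\mathcal{Z}^\pi$ is the ring of sums $\sum c_{ij}(1\otimes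 B_{ij})$, $c_{ij}\in\mathcal{O}_a$, $|c_{ij}|_{\pi,p}\to0$, inside $\mathbb{Z}_q[[\pi]]\hat\otimes_{\mathbb{Z}_q}\mathcal{H}_{1,1}$, where $\mathcal{H}_{1,1}$ is the algebra of rigid analytic functions over $\mathbb{C}_p$ on $\{x\in\mathbb{C}_p:|x|_p\le1,\ |x-\widehat{P}_j|_p\ge1\ (2\le j\le\ell)\}$; representations are unique. $\tau$ acts on coefficients in $\mathcal{O}_a$ (trivially on $\pi$), fixes $x$, and sends $\widehat{P}_j$ to $\widehat{P}_j^{\,p}$. $U$ is the linear extension of $(U_p\xi)(x)=\frac1p\sum_{z^p=x}\xi(z)$. Put $F(x)=\prod_{j=1}^\ell\prod_{i=1}^{d_j}E(\pi a_{ij}\otimes B_{ij})$, $F_{[a]}(x)=\prod_{m=0}^{a-1}(\tau^mF)(x^{p^m})$, $\alpha_1=\tau^{-1}\circ U\circ F$ and $\alpha_a=U^a\circ F_{[a]}$ (where $F$, $F_{[a]}$ act by multiplication); both are endomorphisms of $\mathcal{Z}^\pi$. Complete continuity is taken with respect to the weighted basis $W_{ij}=\pi^{i/d_j}\otimes B_{ij}$: for $\alpha\in\{\alpha_1,\alpha_a\}$ write $\alpha(1\otimes B_{ij})=\sum_{(n,k)}C_{(ij),(nk)}(1\otimes B_{nk})$ with $C_{(ij),(nk)}\in\mathbb{Z}_q[[\pi]]$, and $D_{(ij),(nk)}=\pi^{i/d_j-n/d_k}C_{(ij),(nk)}$ (a series in fractional powers of $\pi$), so formally $\alpha W_{ij}=\sum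 D_{(ij),(nk)}W_{nk}$. For a valuation $v$, $\alpha$ is completely continuous if $\inf_{(i,j)}v(D_{(ij),(nk)})\to\infty$ as $(n,k)\to\infty$. "$\pi$-adically" means $v=\mathrm{ord}_\pi$ (lowest exponent of $\pi$ with nonzero coefficient); "$(\pi^{1/c},p)$-adically" means $v(\sum_t b_t\pi^t)=\min_t(\mathrm{ord}_pb_t+c\,t)$.
   Formalization: The claim that neither operator is π-adically completely continuous is proved only for ℓ≥3; for ℓ=2 (poles only at ∞ and 0) it is false, since there both operators are π-adically completely continuous. The (π^{1/c},p)-adic claim is proved for all ℓ≥2. *)

theory Defs
  imports "HOL-Analysis.Analysis" "HOL-Computational_Algebra.Computational_Algebra"
begin

section \<open>The field of p-adic complex numbers\<close>

text \<open>
  The type \<open>'k\<close> plays the role of \<open>C\<^sub>p\<close>. Its absolute value is the distance to \<open>0\<close>, so that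
  limits, closures and infinite sums in \<open>'k\<close> are the ones of the library.
\<close>

definition pabs :: "'k::{zero,metric_space} \<Rightarrow> real" where
  "pabs x = dist x 0"

definition padic_numbers :: "'k::{field_char_0,metric_space} set" where
  "padic_numbers = closure \<rat>"

definition algebraic_over :: "'k::field set \<Rightarrow> 'k \<Rightarrow> bool" where
  "algebraic_over S x \<longleftrightarrow> (\<exists>f. f \<noteq> 0 \<and> (\<forall>n. coeff f n \<in> S) \<and> poly f x = 0)"

section \<open>The unramified extension and its Frobenius\<close>

definition is_subfield :: "'k::field set \<Rightarrow> bool" where
  "is_subfield L \<longleftrightarrow> 0 \<in> L \<and> 1 \<in> L \<and>
     (\<forall>x\<in>L. \<forall>y\<in>L. x + y \<in> L \<and> x * y \<in> L) \<and> (\<forall>x\<in>L. - x \<in> L \<and> inverse x \<in> L)"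

definition has_degree :: "'k::field set \<Rightarrow> 'k set \<Rightarrow> nat \<Rightarrow> bool" where
  "has_degree L K n \<longleftrightarrow> (\<exists>b. (\<forall>i<n. b i \<in> L) \<and>
     (\<forall>x\<in>L. \<exists>!c. c \<in> {..<n} \<rightarrow>\<^sub>E K \<and> x = (\<Sum>i<n. c i * b i)))"

definition valuation_ring :: "'k::{zero,metric_space} set \<Rightarrow> 'k set" where
  "valuation_ring L = {x \<in> L. pabs x \<le> 1}"

text \<open>
  The residue field \<open>F\<^sub>q\<close> consists of cosets, i.e. of subsets of \<open>valuation_ring L\<close>.
\<close>

definition residue_rel :: "'k::{ab_group_add,metric_space} set \<Rightarrow> ('k \<times> 'k) set" where
  "residue_rel L =
     {(x, y). x \<in> valuation_ring L \<and> y \<in> valuation_ring L \<and> pabs (x - y) < 1}"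

definition residue_field :: "'k::{ab_group_add,metric_space} set \<Rightarrow> 'k set set" where
  "residue_field L = valuation_ring L // residue_rel L"

text \<open>
  \<open>C\<^sub>p\<close> is the completion of an algebraic closure of \<open>Q\<^sub>p\<close>; that it is complete and algebraically
  closed is part of the sort of \<open>'k\<close>.

  Unramified means that \<open>L\<close> has the value group of \<open>Q\<^sub>p\<close>; separability of the residue extension
  is automatic because the residue fields are finite.
\<close>

locale unramified_extension =
  fixes p a :: nat
    and Qq :: "'k::{alg_closed_field,field_char_0,complete_space} set"
    and \<tau> :: "'k \<Rightarrow> 'k"
  assumes prime_p: "prime p"
    and dist_eq_pabs: "\<And>x y :: 'k. dist x y = pabs (x - y)"
    and pabs_mult: "\<And>x y :: 'k. pabs (x * y) = pabs x * pabs y"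
    and pabs_ultrametric: "\<And>x y :: 'k. pabs (x + y) \<le> max (pabs x) (pabs y)"
    and pabs_p: "pabs (of_nat p :: 'k) = 1 / real p"
    and algebraic_dense: "closure {x :: 'k. algebraic_over padic_numbers x} = UNIV"
    and a_ge_1: "1 \<le> a"
    and subfield_Qq: "is_subfield Qq"
    and Qp_subset_Qq: "padic_numbers \<subseteq> Qq"
    and degree_Qq: "has_degree Qq padic_numbers a"
    and unramified_Qq: "\<And>x. x \<in> Qq \<Longrightarrow> x \<noteq> 0 \<Longrightarrow> \<exists>n::int. pabs x = real p powi n"
    and frob_bij: "bij_betw \<tau> Qq Qq"
    and frob_add: "\<And>x y. x \<in> Qq \<Longrightarrow> y \<in> Qq \<Longrightarrow> \<tau> (x + y) = \<tau> x + \<tau> y"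
    and frob_mult: "\<And>x y. x \<in> Qq \<Longrightarrow> y \<in> Qq \<Longrightarrow> \<tau> (x * y) = \<tau> x * \<tau> y"
    and frob_Qp: "\<And>x. x \<in> padic_numbers \<Longrightarrow> \<tau> x = x"
    and frob_residue: "\<And>x. x \<in> valuation_ring Qq \<Longrightarrow> pabs (\<tau> x - x ^ p) < 1"

definition teichmueller :: "nat \<Rightarrow> 'k::{monoid_mult} set \<Rightarrow> 'k" where
  "teichmueller q r = (THE z. z \<in> r \<and> z ^ q = z)"

section \<open>Valuations on series with real exponents\<close>

text \<open>
  A series in fractional powers of \<open>\<pi>\<close> is the function sending an exponent to its coefficient.
\<close>

definition pi_shift :: "real \<Rightarrow> 'k::zero fps \<Rightarrow> real \<Rightarrow> 'k" where
  "pi_shift s b = (\<lambda>r. if r - s \<in> \<nat> then fps_nth b (nat \<lfloor>r - s\<rfloor>) else 0)"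

definition ord_p :: "nat \<Rightarrow> 'k::{zero,metric_space} \<Rightarrow> ereal" where
  "ord_p p x = (if x = 0 then \<infinity> else ereal (- log (real p) (pabs x)))"

definition ord_pi :: "(real \<Rightarrow> 'k::zero) \<Rightarrow> ereal" where
  "ord_pi g = (INF r\<in>{r. g r \<noteq> 0}. ereal r)"

definition ord_pi_p :: "nat \<Rightarrow> real \<Rightarrow> (real \<Rightarrow> 'k::{zero,metric_space}) \<Rightarrow> ereal" where
  "ord_pi_p p c g = (INF r. ord_p p (g r) + ereal (c * r))"

definition pinorm :: "nat \<Rightarrow> 'k::{zero,metric_space} fps \<Rightarrow> real" where
  "pinorm p b = (SUP t. pabs (fps_nth b t) * (1 / real p) ^ t)"

definition artin_hasse :: "nat \<Rightarrow> 'k::field_char_0 fps" where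
  "artin_hasse p =
     fps_compose (fps_exp 1) (Abs_fps (\<lambda>n. if \<exists>i. n = p ^ i then 1 / of_nat n else 0))"

section \<open>The operators\<close>

text \<open>
  A point \<open>P j\<close> of \<open>F\<^sub>q \<union> {\<infinity>}\<close> is a residue class or \<open>None\<close>, the latter standing for \<open>\<infinity>\<close>.
  \<open>A i j\<close> is the coefficient of \<open>(x - P\<^sub>j)\<^sup>-\<^sup>i\<close> in the rational function \<open>f\<close>.
\<close>

locale exponential_sum = unramified_extension p a Qq \<tau>
  for p a :: nat
    and Qq :: "'k::{alg_closed_field,field_char_0,complete_space} set"
    and \<tau> :: "'k \<Rightarrow> 'k" +
  fixes l :: nat
    and P :: "nat \<Rightarrow> 'k set option"
    and d :: "nat \<Rightarrow> nat"
    and A :: "nat \<Rightarrow> nat \<Rightarrow> 'k"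
  assumes l_ge_2: "2 \<le> l"
    and P_1: "P 1 = None"
    and P_2: "P 2 = Some {x \<in> valuation_ring Qq. pabs x < 1}"
    and P_mem: "\<And>j. j \<in> {1..l} \<Longrightarrow> P j \<in> insert None (Some ` residue_field Qq)"
    and P_inj: "inj_on P {1..l}"
    and d_ge_1: "\<And>j. j \<in> {1..l} \<Longrightarrow> 1 \<le> d j"
    and A_integral: "\<And>i j. j \<in> {1..l} \<Longrightarrow> i \<in> {1..d j} \<Longrightarrow> A i j \<in> valuation_ring Qq"
    and A_lead: "\<And>j. j \<in> {1..l} \<Longrightarrow> A (d j) j \<noteq> 0"
begin

definition pole :: "nat \<Rightarrow> 'k" where
  "pole j = teichmueller (p ^ a) (the (P j))"

text \<open>
  \<open>\<tau>\<close> moves the poles, and \<open>U\<close> followed by \<open>\<tau>\<^sup>-\<^sup>1\<close> moves them back. So the space \<open>Z\<^sup>\<pi>\<close> comes with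
  its Frobenius twists: in the \<open>m\<close>-th one the poles are the \<open>p\<^sup>m\<close>-th powers of the given ones. The
  twist \<open>m = 0\<close> is \<open>Z\<^sup>\<pi>\<close> itself, and so is \<open>m = a\<close>.
\<close>

definition domain :: "nat \<Rightarrow> 'k set" where
  "domain m = {x. pabs x \<le> 1 \<and> (\<forall>j\<in>{2..l}. pabs (x - pole j ^ p ^ m) \<ge> 1)}"

definition B :: "nat \<Rightarrow> nat \<times> nat \<Rightarrow> 'k \<Rightarrow> 'k" where
  "B m = (\<lambda>(i, j) x. (if P j = None then x else 1 / (x - pole j ^ p ^ m)) ^ i)"

text \<open>The pair \<open>(0, 1)\<close> stands for all \<open>(0, j)\<close>, as \<open>B\<^sub>0\<^sub>j = 1\<close> is counted once.\<close>

definition idx :: "(nat \<times> nat) set" where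
  "idx = insert (0, 1) ({1..} \<times> {1..l})"

abbreviation idx_at_infinity :: "(nat \<times> nat) filter" where
  "idx_at_infinity \<equiv> inf cofinite (principal idx)"

definition coeff_families :: "(nat \<times> nat \<Rightarrow> 'k fps) set" where
  "coeff_families = {c. (\<forall>u\<in>idx. \<forall>t. fps_nth (c u) t \<in> valuation_ring Qq) \<and>
     (\<forall>u. u \<notin> idx \<longrightarrow> c u = 0) \<and> ((\<lambda>u. pinorm p (c u)) \<longlongrightarrow> 0) idx_at_infinity}"

text \<open>
  An element of \<open>Z\<^sub>q[[\<pi>]] \<otimes> H\<close> is a power series in \<open>\<pi>\<close> whose coefficients are functions of \<open>x\<close>; it
  is represented by its evaluation, a function \<open>'k \<Rightarrow> 'k fps\<close> considered on \<open>domain m\<close> only. Sums are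
  taken for each power of \<open>\<pi>\<close> separately, as the library's topology on \<^typ>\<open>'k fps\<close> ignores the one
  on \<open>'k\<close>.
\<close>

definition expansion :: "nat \<Rightarrow> (nat \<times> nat \<Rightarrow> 'k fps) \<Rightarrow> 'k \<Rightarrow> 'k fps" where
  "expansion m c x = Abs_fps (\<lambda>t. \<Sum>\<^sub>\<infinity>u\<in>idx. fps_nth (c u) t * B m u x)"

definition coeffs_of :: "nat \<Rightarrow> ('k \<Rightarrow> 'k fps) \<Rightarrow> nat \<times> nat \<Rightarrow> 'k fps" where
  "coeffs_of m \<xi> = (THE c. c \<in> coeff_families \<and> (\<forall>x\<in>domain m. \<xi> x = expansion m c x))"

definition frob :: "nat \<Rightarrow> ('k \<Rightarrow> 'k fps) \<Rightarrow> 'k \<Rightarrow> 'k fps" where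
  "frob m \<xi> = expansion (Suc m) (\<lambda>u. Abs_fps (\<lambda>t. \<tau> (fps_nth (coeffs_of m \<xi> u) t)))"

definition inv_frob :: "nat \<Rightarrow> ('k \<Rightarrow> 'k fps) \<Rightarrow> 'k \<Rightarrow> 'k fps" where
  "inv_frob m \<xi> = expansion m
     (\<lambda>u. Abs_fps (\<lambda>t. inv_into Qq \<tau> (fps_nth (coeffs_of (Suc m) \<xi> u) t)))"

primrec frob_pow :: "nat \<Rightarrow> ('k \<Rightarrow> 'k fps) \<Rightarrow> 'k \<Rightarrow> 'k fps" where
  "frob_pow 0 \<xi> = \<xi>"
| "frob_pow (Suc m) \<xi> = frob m (frob_pow m \<xi>)"

definition U :: "('k \<Rightarrow> 'k fps) \<Rightarrow> 'k \<Rightarrow> 'k fps" where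
  "U \<xi> x = fps_const (1 / of_nat p) * (\<Sum>z | z ^ p = x. \<xi> z)"

definition F :: "'k \<Rightarrow> 'k fps" where
  "F x = (\<Prod>j=1..l. \<Prod>i=1..d j.
            fps_compose (artin_hasse p) (fps_const (A i j * B 0 (i, j) x) * fps_X))"

definition F_a :: "'k \<Rightarrow> 'k fps" where
  "F_a x = (\<Prod>m<a. frob_pow m F (x ^ p ^ m))"

definition alpha_1 :: "('k \<Rightarrow> 'k fps) \<Rightarrow> 'k \<Rightarrow> 'k fps" where
  "alpha_1 \<xi> = inv_frob 0 (U (\<lambda>x. F x * \<xi> x))"

definition alpha_a :: "('k \<Rightarrow> 'k fps) \<Rightarrow> 'k \<Rightarrow> 'k fps" where
  "alpha_a \<xi> = (U ^^ a) (\<lambda>x. F_a x * \<xi> x)"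

definition C :: "(('k \<Rightarrow> 'k fps) \<Rightarrow> 'k \<Rightarrow> 'k fps) \<Rightarrow> nat \<times> nat \<Rightarrow> nat \<times> nat \<Rightarrow> 'k fps" where
  "C \<alpha> u w = coeffs_of 0 (\<alpha> (\<lambda>x. fps_const (B 0 u x))) w"

definition weight :: "nat \<times> nat \<Rightarrow> real" where
  "weight = (\<lambda>(i, j). real i / real (d j))"

definition D :: "(('k \<Rightarrow> 'k fps) \<Rightarrow> 'k \<Rightarrow> 'k fps) \<Rightarrow> nat \<times> nat \<Rightarrow> nat \<times> nat \<Rightarrow> real \<Rightarrow> 'k" where
  "D \<alpha> u w = pi_shift (weight u - weight w) (C \<alpha> u w)"

text \<open>
  For \<open>l = 2\<close> (poles only at \<open>\<infinity>\<close> and \<open>0\<close>) \<open>U\<close> maps \<open>x\<^sup>m\<close> to \<open>x\<^bsup>m/p\<^esup>\<close> or \<open>0\<close>, and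
  \<open>alpha_1\<close> and \<open>alpha_a\<close> are even \<open>\<pi>\<close>-adically completely continuous. A failure needs a third pole.
\<close>

definition completely_continuous ::
  "((real \<Rightarrow> 'k) \<Rightarrow> ereal) \<Rightarrow> (('k \<Rightarrow> 'k fps) \<Rightarrow> 'k \<Rightarrow> 'k fps) \<Rightarrow> bool" where
  "completely_continuous v \<alpha> \<longleftrightarrow> ((\<lambda>w. INF u\<in>idx. v (D \<alpha> u w)) \<longlongrightarrow> \<infinity>) idx_at_infinity"

end

end

theory Submission
  imports Defs
begin

text \<open>
  Each basis function of order \<open>n\<close> at a finite pole \<open>c\<close> satisfies
  \<open>(z - c)\<^sup>-\<^sup>n = h(z)\<^sup>n / (z\<^sup>p - c\<^sup>p)\<^sup>n\<close> with the polynomial \<open>h = (z\<^sup>p - c\<^sup>p) / (z - c)\<close>, so \<open>U\<close> sends it to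
  \<open>U(h\<^sup>n) / (x - c\<^sup>p)\<^sup>n\<close>. The numerator is a polynomial of degree less than \<open>n\<close>, whose value at
  \<open>c\<^sup>p\<close> is \<open>p\<^sup>n\<^sup>-\<^sup>1 c\<^bsup>(p-1)n\<^esup>\<close>: if \<open>c \<noteq> 0\<close>, then \<open>U\<close> keeps the pole order, at the price of a power of \<open>p\<close>
  and not of \<open>\<pi>\<close>. As \<open>F\<close> is \<open>1\<close> modulo \<open>\<pi>\<close>, this gives \<open>\<pi>\<close>-adically non-small diagonal entries
  in all orders.

  Conversely, \<open>h\<close> is small near \<open>c\<close>, and the maximum principle on \<open>|x - c\<^sup>p| = 1/p\<close> bounds the
  coefficient of order \<open>i\<close> by \<open>p\<^bsup>1 + n/p - i\<^esup>\<close>. Multiplication by \<open>F\<close> respects the weight filtration,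
  because the Artin-Hasse exponential is integral and partial fractions do not raise weights.
  Hence a single \<open>U\<close> either lowers the weight or gains \<open>p\<close>-divisibility, in an amount
  that grows linearly in the order of the target.

  All functions involved are finite combinations of the basis in each power of \<open>\<pi>\<close>, so infinite
  sums enter only through the uniqueness of expansions.
\<close>

section \<open>Power series and linear algebra\<close>

text \<open>Both gains of a single \<open>U\<close> are measured on one scale: \<pi> is credited
  with p-order \<open>\<kappa>\<close>, and a coefficient of \<open>\<pi>^t\<close> at
  \<open>u\<close> is required to have p-order at least N + \<open>\<kappa>\<close>
  (\<open>weight u\<close> - t). Multiplication by \<open>F\<close> preserves such a condition, and
  the change to the weighted basis turns it into a bound for the order of \<open>D\<close>, with
  \<open>\<kappa>\<close> = c. Any c > 0 works, because the p-divisibility gained by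
  \<open>U\<close> does not involve c, while a drop in weight is worth c times its amount. For
  \<open>alpha_a\<close> one \<open>U\<close> with a gain is enough; the other factors only have to
  keep the condition.

  The negative half concerns the constant term in \<pi>, where \<open>U\<close> is triangular for
  the order at each finite pole. Its diagonal vanishes at the pole 0, so a pole in another residue
  class is required; this is the condition \<open>3 \<le> l\<close>.

  The obstacle is that \<open>C\<close> is read off by a definite description, and
  \<open>frob\<close> and \<open>inv_frob\<close> are defined through it: every function has to be
  tied to an explicit expansion before its coefficients can be estimated.\<close>

lemma prime_power_add:
  fixes x y :: "'a::comm_semiring_1"
  assumes "prime p"
  obtains c :: "nat \<Rightarrow> nat" where
    "(x + y) ^ p = x ^ p + y ^ p + of_nat p * (\<Sum>k\<in>{1..<p}. of_nat (c k) * x ^ k * y ^ (p - k))"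
proof
  let ?c = "\<lambda>k. (p choose k) div p"
  have p: "0 < p"
    using assms prime_gt_0_nat by blast
  have *: "of_nat (p choose k) = of_nat p * (of_nat (?c k) :: 'a)" if "k \<in> {1..<p}" for k
  proof -
    have "p dvd p choose k"
      using that assms by (intro dvd_choose_prime) auto
    then have "p choose k = p * ?c k"
      by simp
    then show ?thesis
      by (metis of_nat_mult)
  qed
  have "{..p} = insert 0 (insert p {1..<p})"
    using p by auto
  then have "(x + y) ^ p = y ^ p + (x ^ p + (\<Sum>k\<in>{1..<p}. of_nat (p choose k) * x ^ k * y ^ (p - k)))"
    using p by (simp add: binomial_ring)
  also have "(\<Sum>k\<in>{1..<p}. of_nat (p choose k) * x ^ k * y ^ (p - k)) =
      of_nat p * (\<Sum>k\<in>{1..<p}. of_nat (?c k) * x ^ k * y ^ (p - k))"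
    unfolding sum_distrib_left by (intro sum.cong) (auto simp: * algebra_simps)
  finally show "(x + y) ^ p = x ^ p + y ^ p +
      of_nat p * (\<Sum>k\<in>{1..<p}. of_nat (?c k) * x ^ k * y ^ (p - k))"
    by (simp add: add.assoc add.left_commute)
qed

text \<open>The equation determines each coefficient from the earlier ones, positive integers being
  invertible in characteristic zero. Identities between exponentials can thus be proved by comparing
  logarithmic derivatives.\<close>

lemma fps_linear_ode_unique:
  fixes f g u :: "'a::field_char_0 fps"
  assumes "fps_deriv f = f * u" "fps_deriv g = g * u" "fps_nth f 0 = fps_nth g 0"
  shows "f = g"
proof -
  have "fps_nth f n = fps_nth g n" for n
  proof (induction n rule: less_induct)
    case (less n)
    show ?case
    proof (cases n)
      case (Suc m)
      have "of_nat (Suc m) * fps_nth f (Suc m) = (\<Sum>i=0..m. fps_nth f i * fps_nth u (m - i))"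
        using arg_cong[OF assms(1), of "\<lambda>h. fps_nth h m"] by (simp add: fps_mult_nth)
      moreover have "of_nat (Suc m) * fps_nth g (Suc m) = (\<Sum>i=0..m. fps_nth g i * fps_nth u (m - i))"
        using arg_cong[OF assms(2), of "\<lambda>h. fps_nth h m"] by (simp add: fps_mult_nth)
      moreover have "(\<Sum>i=0..m. fps_nth f i * fps_nth u (m - i)) = (\<Sum>i=0..m. fps_nth g i * fps_nth u (m - i))"
        using less Suc by (intro sum.cong) auto
      ultimately show ?thesis
        using Suc by (metis mult_left_cancel of_nat_eq_0_iff nat.distinct(1))
    qed (use assms(3) in simp)
  qed
  then show ?thesis
    by (simp add: fps_eq_iff)
qed

text \<open>Modulo X^(n+1) only k f^(k-1) X^n g survives besides f^k, and f has constant term 1. In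
  Dwork's argument this isolates the unknown coefficient.\<close>

lemma fps_power_add_X_power:
  fixes f g :: "'a::comm_ring_1 fps"
  assumes "fps_nth f 0 = 1" "0 < n"
  shows "fps_nth ((f + fps_X ^ n * g) ^ k) n = fps_nth (f ^ k) n + of_nat k * fps_nth g 0"
proof -
  have "\<exists>w. (f + fps_X ^ n * g) ^ k = f ^ k + fps_X ^ n * w \<and> fps_nth w 0 = of_nat k * fps_nth g 0"
  proof (induction k)
    case (Suc k)
    then obtain w where w: "(f + fps_X ^ n * g) ^ k = f ^ k + fps_X ^ n * w"
      "fps_nth w 0 = of_nat k * fps_nth g 0"
      by blast
    have "(f + fps_X ^ n * g) ^ Suc k =
        f ^ Suc k + fps_X ^ n * (f * w + g * f ^ k + fps_X ^ n * g * w)"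
      by (simp add: w(1) distrib_left distrib_right mult.assoc mult.left_commute)
    moreover have "fps_nth (f * w + g * f ^ k + fps_X ^ n * g * w) 0 = of_nat (Suc k) * fps_nth g 0"
      using assms w(2) by (simp add: fps_power_zeroth zero_power algebra_simps)
    ultimately show ?case
      by blast
  next
    case 0
    show ?case
      by (rule exI[of _ 0]) simp
  qed
  then show ?thesis
    by (auto simp: fps_X_power_mult_nth)
qed

section \<open>The Artin-Hasse exponential as a formal series\<close>

definition artin_hasse_log :: "nat \<Rightarrow> 'a::field_char_0 fps" where
  "artin_hasse_log p = Abs_fps (\<lambda>n. if \<exists>i. n = p ^ i then 1 / of_nat n else 0)"

lemma artin_hasse_deriv:
  assumes "0 < p"
  shows "fps_deriv (artin_hasse p) = artin_hasse p * fps_deriv (artin_hasse_log p)"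
  using assms
  by (simp add: artin_hasse_def artin_hasse_log_def fps_compose_deriv fps_exp_deriv)

lemma artin_hasse_0:
  assumes "0 < p"
  shows "fps_nth (artin_hasse p) 0 = 1"
  using assms by (simp add: artin_hasse_def)

text \<open>In the series of X^(p^i)/p^i, substituting X^p turns each term into p times its
  successor; only the initial X is lost.\<close>

lemma artin_hasse_log_functional:
  assumes "1 < p"
  shows "artin_hasse_log p oo fps_X ^ p = fps_const (of_nat p) * (artin_hasse_log p - fps_X)"
proof (rule fps_ext)
  fix n
  show "fps_nth (artin_hasse_log p oo fps_X ^ p) n =
      fps_nth (fps_const (of_nat p) * (artin_hasse_log p - fps_X)) n"
  proof (cases "p dvd n")
    case True
    then obtain m where m: "n = p * m"
      by auto
    have "(\<exists>i. p * m = p ^ i) \<longleftrightarrow> (\<exists>i. m = p ^ i)"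
    proof
      assume "\<exists>i. p * m = p ^ i"
      then obtain i where i: "p * m = p ^ i" by blast
      with assms have "i \<noteq> 0"
        by (metis power_0 nat_mult_eq_1_iff less_numeral_extra(4))
      then show "\<exists>i. m = p ^ i"
        using i assms by (cases i) auto
    qed (metis power_Suc)
    then show ?thesis
      using m assms by (auto simp: artin_hasse_log_def fps_nth_compose_X_power fps_X_nth)
  next
    case False
    have "\<not> p dvd n \<Longrightarrow> n = p ^ i \<Longrightarrow> i = 0" for i
      by (cases i) auto
    then have "(\<exists>i. n = p ^ i) \<longleftrightarrow> n = 1"
      using False by (metis power_0)
    then show ?thesis
      using False assms by (auto simp: artin_hasse_log_def fps_nth_compose_X_power fps_X_nth)
  qed
qed

text \<open>Formally this is exp(p L) = exp(L(X^p)) exp(p X), from the functional equation of L =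
  \<open>artin_hasse_log p\<close>. Both sides solve y' = p L' y with y(0) = 1.\<close>

lemma artin_hasse_power:
  fixes p :: nat
  assumes "1 < p"
  shows "artin_hasse p ^ p = (artin_hasse p oo fps_X ^ p) * fps_exp (of_nat p :: 'a::field_char_0)"
proof (rule fps_linear_ode_unique)
  let ?E = "artin_hasse p :: 'a fps" and ?L = "artin_hasse_log p :: 'a fps" and ?p = "of_nat p :: 'a"
  have p0: "0 < p"
    using assms by simp
  note dE = artin_hasse_deriv[OF p0, where 'a='a]
  have X: "fps_nth (fps_X ^ p :: 'a fps) 0 = 0"
    using p0 by (simp add: fps_X_power_nth)
  show "fps_deriv (?E ^ p) = ?E ^ p * (fps_const ?p * fps_deriv ?L)"
  proof -
    have "?E ^ p = ?E * ?E ^ (p - 1)"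
      using p0 by (metis power_eq_if neq0_conv)
    moreover have "fps_deriv (?E ^ p) = fps_const ?p * fps_deriv ?L * (?E * ?E ^ (p - 1))"
      by (simp only: fps_deriv_power dE mult_ac)
    ultimately show ?thesis
      by (simp only: mult_ac)
  qed
  have "fps_deriv (?L oo fps_X ^ p) = fps_const ?p * (fps_deriv ?L - 1)"
    using artin_hasse_log_functional[OF assms, where 'a='a] by simp
  then have L: "(fps_deriv ?L oo fps_X ^ p) * fps_deriv (fps_X ^ p) = fps_const ?p * (fps_deriv ?L - 1)"
    using fps_compose_deriv[OF X, of ?L] by simp
  have "fps_deriv (?E oo fps_X ^ p) = (?E oo fps_X ^ p) * ((fps_deriv ?L oo fps_X ^ p) * fps_deriv (fps_X ^ p))"
    by (simp add: fps_compose_deriv[OF X] dE fps_compose_mult_distrib[OF X] mult.assoc)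
  then have "fps_deriv (?E oo fps_X ^ p) = (?E oo fps_X ^ p) * (fps_const ?p * (fps_deriv ?L - 1))"
    by (simp only: L)
  then show "fps_deriv ((?E oo fps_X ^ p) * fps_exp ?p) =
      ((?E oo fps_X ^ p) * fps_exp ?p) * (fps_const ?p * fps_deriv ?L)"
    by (simp only: fps_deriv_mult fps_exp_deriv) (simp add: algebra_simps)
  show "fps_nth (?E ^ p) 0 = fps_nth ((?E oo fps_X ^ p) * fps_exp ?p) 0"
    by (simp add: fps_power_zeroth artin_hasse_0[OF p0])
qed

text \<open>The equation E' = E L' is a recursion over the rationals. Rationality makes Fermat's
  congruence modulo p available for the coefficients, and later puts them into Q_p.\<close>

lemma artin_hasse_rational:
  assumes "0 < p"
  shows "fps_nth (artin_hasse p :: 'a::field_char_0 fps) n \<in> \<rat>"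
proof (induction n rule: less_induct)
  case (less n)
  show ?case
  proof (cases n)
    case (Suc m)
    let ?E = "artin_hasse p :: 'a fps" and ?L = "artin_hasse_log p :: 'a fps"
    have "of_nat (Suc m) * fps_nth ?E (Suc m) = (\<Sum>i=0..m. fps_nth ?E i * fps_nth (fps_deriv ?L) (m - i))"
      using arg_cong[OF artin_hasse_deriv[OF assms], of "\<lambda>h. fps_nth h m :: 'a"]
      by (simp add: fps_mult_nth)
    also have "\<dots> \<in> \<rat>"
    proof (intro Rats_sum Rats_mult)
      show "fps_nth ?E i \<in> \<rat>" if "i \<in> {0..m}" for i
        using less Suc that by simp
    qed (auto simp: artin_hasse_log_def intro!: Rats_mult Rats_divide)
    finally have "of_nat (Suc m) * fps_nth ?E (Suc m) / of_nat (Suc m) \<in> \<rat>"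
      by (intro Rats_divide) auto
    then show ?thesis
      using Suc by (simp del: of_nat_Suc)
  qed (simp add: artin_hasse_0[OF assms])
qed

section \<open>Linear dependence over a subfield\<close>

text \<open>Gaussian elimination by induction on the spanning family. The scalars form only a subset
  \<open>K\<close> of the type, so their membership is tracked along with the relation.\<close>

lemma subfield_dependent:
  assumes K: "is_subfield K" and "finite I" "finite J" "card I < card J"
    and "\<And>j. j \<in> J \<Longrightarrow> \<exists>c. (\<forall>i\<in>I. c i \<in> K) \<and> e j = (\<Sum>i\<in>I. c i * b i)"
  shows "\<exists>v. (\<forall>j\<in>J. v j \<in> K) \<and> (\<exists>j\<in>J. v j \<noteq> 0) \<and> (\<Sum>j\<in>J. v j * e j) = (0::'a::field)"
  using assms(2-)
proof (induction I arbitrary: J e rule: finite_induct)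
  case empty
  then obtain j where "j \<in> J"
    by (metis card_gt_0_iff equals0I card.empty)
  then show ?case
    using K empty by (intro exI[of _ "\<lambda>_. 1"]) (auto simp: is_subfield_def)
next
  case (insert i0 I)
  have K_closed: "0 \<in> K" "\<And>x y. x \<in> K \<Longrightarrow> y \<in> K \<Longrightarrow> x + y \<in> K" "\<And>x y. x \<in> K \<Longrightarrow> y \<in> K \<Longrightarrow> x * y \<in> K"
    "\<And>x. x \<in> K \<Longrightarrow> - x \<in> K" "\<And>x. x \<in> K \<Longrightarrow> inverse x \<in> K"
    using K by (auto simp: is_subfield_def)
  have K_diff: "x - y \<in> K" if "x \<in> K" "y \<in> K" for x y
    using K_closed(2)[OF that(1) K_closed(4)[OF that(2)]] by simp
  have K_sum: "(\<Sum>s\<in>S. g s) \<in> K" if "\<And>s. s \<in> S \<Longrightarrow> g s \<in> K" for S :: "'c set" and g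
    using that by (induction S rule: infinite_finite_induct) (auto intro: K_closed)
  obtain c where c: "\<And>j i. j \<in> J \<Longrightarrow> i \<in> insert i0 I \<Longrightarrow> c j i \<in> K"
    "\<And>j. j \<in> J \<Longrightarrow> e j = (\<Sum>i\<in>insert i0 I. c j i * b i)"
    using insert.prems(3) by metis
  have e: "e j = c j i0 * b i0 + (\<Sum>i\<in>I. c j i * b i)" if "j \<in> J" for j
    using c(2)[OF that] insert.hyps by simp
  show ?case
  proof (cases "\<forall>j\<in>J. c j i0 = 0")
    case True
    have "card I < card J"
      using insert.prems insert.hyps by simp
    show ?thesis
    proof (rule insert.IH[OF _ \<open>card I < card J\<close>])
      show "\<exists>d. (\<forall>i\<in>I. d i \<in> K) \<and> e j = (\<Sum>i\<in>I. d i * b i)" if "j \<in> J" for j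
        using e[OF that] c(1)[OF that] True that by (intro exI[of _ "c j"]) auto
    qed (use insert.prems in auto)
  next
    case False
    then obtain j0 where j0: "j0 \<in> J" "c j0 i0 \<noteq> 0"
      by blast
    \<comment> \<open>The vector \<open>e j0\<close> is the pivot: subtracting \<open>t j\<close>
      times it removes \<open>b i0\<close> from all the others. The coefficient of \<open>w\<close>
      at \<open>j0\<close> later collects these multiples.\<close>
    define t where "t j = c j i0 / c j0 i0" for j
    have t: "t j \<in> K" if "j \<in> J" for j
      using c(1) that j0 by (auto simp: t_def divide_inverse intro!: K_closed)
    have "\<exists>v. (\<forall>j\<in>J - {j0}. v j \<in> K) \<and> (\<exists>j\<in>J - {j0}. v j \<noteq> 0) \<and>
        (\<Sum>j\<in>J - {j0}. v j * (e j - t j * e j0)) = 0"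
    proof (rule insert.IH)
      show "card I < card (J - {j0})"
        using insert.prems insert.hyps j0 by simp
      show "\<exists>d. (\<forall>i\<in>I. d i \<in> K) \<and> e j - t j * e j0 = (\<Sum>i\<in>I. d i * b i)"
        if j: "j \<in> J - {j0}" for j
      proof (intro exI[of _ "\<lambda>i. c j i + - (t j * c j0 i)"] conjI ballI)
        have "t j * c j0 i0 = c j i0"
          using j0 by (simp add: t_def)
        then have "e j - t j * e j0 = (\<Sum>i\<in>I. c j i * b i) - t j * (\<Sum>i\<in>I. c j0 i * b i)"
          using e[of j] e[of j0] j j0 by (simp add: distrib_left flip: mult.assoc)
        also have "\<dots> = (\<Sum>i\<in>I. (c j i + - (t j * c j0 i)) * b i)"
          by (simp add: sum_distrib_left sum_subtractf algebra_simps)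
        finally show "e j - t j * e j0 = (\<Sum>i\<in>I. (c j i + - (t j * c j0 i)) * b i)" .
      qed (use c(1) t j j0 in \<open>auto intro!: K_diff K_closed(3)\<close>)
    qed (use insert.prems in auto)
    then obtain v where v: "\<And>j. j \<in> J - {j0} \<Longrightarrow> v j \<in> K" "\<exists>j\<in>J - {j0}. v j \<noteq> 0"
      "(\<Sum>j\<in>J - {j0}. v j * (e j - t j * e j0)) = 0"
      by blast
    define w where "w = v(j0 := - (\<Sum>j\<in>J - {j0}. v j * t j))"
    have "(\<Sum>j\<in>J. w j * e j) = w j0 * e j0 + (\<Sum>j\<in>J - {j0}. v j * e j)"
      using insert.prems j0 by (subst sum.remove[of J j0]) (auto simp: w_def intro!: sum.cong)
    also have "\<dots> = (\<Sum>j\<in>J - {j0}. v j * (e j - t j * e j0))"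
      by (simp add: w_def sum_distrib_left sum_distrib_right sum_subtractf algebra_simps)
    finally have "(\<Sum>j\<in>J. w j * e j) = 0"
      using v(3) by simp
    moreover have "\<forall>j\<in>J. w j \<in> K"
      using v(1) t by (auto simp: w_def intro!: K_closed K_sum)
    moreover have "\<exists>j\<in>J. w j \<noteq> 0"
      using v(2) by (auto simp: w_def)
    ultimately show ?thesis
      by blast
  qed
qed

context unramified_extension
begin

section \<open>The absolute value\<close>

lemma pabs_0 [simp]: "pabs (0::'k) = 0"
  by (simp add: pabs_def)

lemma pabs_nonneg [simp]: "0 \<le> pabs (x::'k)"
  by (simp add: pabs_def)

lemma pabs_eq_0_iff [simp]: "pabs (x::'k) = 0 \<longleftrightarrow> x = 0"
  by (simp add: pabs_def)

lemma pabs_pos_iff [simp]: "0 < pabs (x::'k) \<longleftrightarrow> x \<noteq> 0"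
  by (simp add: pabs_def)

lemma p_ge_2: "2 \<le> p" and p_gt_0 [simp]: "0 < p" and p_gt_1 [simp]: "1 < real p"
  and p_neq_0 [simp]: "p \<noteq> 0"
  using prime_ge_2_nat[OF prime_p] by auto

lemma inverse_p_less_1: "1 / real p < 1"
  using p_gt_1 by simp

lemma inverse_power_less: "0 < \<epsilon> \<Longrightarrow> \<exists>n. (1 / real p) ^ n < \<epsilon>"
  using real_arch_pow_inv inverse_p_less_1 by blast

lemma pabs_1 [simp]: "pabs (1::'k) = 1"
  using pabs_mult[of 1 1] pabs_eq_0_iff[of 1] by simp

lemma pabs_minus [simp]: "pabs (- x :: 'k) = pabs x"
proof -
  have "pabs (-1::'k) * pabs (-1::'k) = 1"
    using pabs_mult[of "-1" "-1"] by simp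
  then have "pabs (-1::'k) = 1"
    by (metis abs_of_nonneg pabs_nonneg power2_eq_square real_sqrt_abs real_sqrt_one)
  then show ?thesis
    using pabs_mult[of "-1" x] by simp
qed

lemma pabs_diff_commute: "pabs (x - y :: 'k) = pabs (y - x)"
  by (metis minus_diff_eq pabs_minus)

lemma pabs_power: "pabs ((x::'k) ^ n) = pabs x ^ n"
  by (induction n) (auto simp: pabs_mult)

lemma pabs_inverse: "pabs (inverse x :: 'k) = inverse (pabs x)"
proof (cases "x = 0")
  case False
  then have "pabs x * pabs (inverse x) = 1"
    using pabs_mult[of x "inverse x"] by simp
  then show ?thesis
    by (simp add: inverse_unique)
qed auto

lemma pabs_divide: "pabs (x / y :: 'k) = pabs x / pabs y"
  by (simp add: divide_inverse pabs_mult pabs_inverse)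

lemma pabs_prod: "pabs (\<Prod>i\<in>I. f i :: 'k) = (\<Prod>i\<in>I. pabs (f i))"
  by (induction I rule: infinite_finite_induct) (auto simp: pabs_mult)

lemma pabs_add_le: "pabs (x::'k) \<le> b \<Longrightarrow> pabs y \<le> b \<Longrightarrow> pabs (x + y) \<le> b"
  using pabs_ultrametric[of x y] by linarith

lemma pabs_add_less: "pabs (x::'k) < b \<Longrightarrow> pabs y < b \<Longrightarrow> pabs (x + y) < b"
  using pabs_ultrametric[of x y] by linarith

lemma pabs_diff_le: "pabs (x::'k) \<le> b \<Longrightarrow> pabs y \<le> b \<Longrightarrow> pabs (x - y) \<le> b"
  using pabs_add_le[of x b "-y"] by simp

lemma pabs_diff_less: "pabs (x::'k) < b \<Longrightarrow> pabs y < b \<Longrightarrow> pabs (x - y) < b"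
  using pabs_add_less[of x b "-y"] by simp

lemma pabs_add_eq: "pabs (y::'k) < pabs x \<Longrightarrow> pabs (x + y) = pabs x"
  using pabs_add_le[of x "pabs x" y] pabs_ultrametric[of "x + y" "- y"] by auto

lemma pabs_eq_if_close: "pabs (x - y :: 'k) < pabs x \<Longrightarrow> pabs y = pabs x"
  using pabs_add_eq[of "y - x" x] by (simp add: pabs_diff_commute)

lemma pabs_sum_le:
  assumes "\<And>i. i \<in> I \<Longrightarrow> pabs (f i :: 'k) \<le> b" "0 \<le> b"
  shows "pabs (\<Sum>i\<in>I. f i) \<le> b"
  using assms by (induction I rule: infinite_finite_induct) (auto intro: pabs_add_le)

lemma pabs_sum_less:
  assumes "\<And>i. i \<in> I \<Longrightarrow> pabs (f i :: 'k) < b" "0 < b"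
  shows "pabs (\<Sum>i\<in>I. f i) < b"
  using assms by (induction I rule: infinite_finite_induct) (auto intro: pabs_add_less)

lemma pabs_mult_le: "pabs (x::'k) \<le> b \<Longrightarrow> pabs y \<le> c \<Longrightarrow> pabs (x * y) \<le> b * c"
  by (simp add: pabs_mult mult_mono' order_trans[OF pabs_nonneg])

lemma pabs_mult_le_1: "pabs (x::'k) \<le> 1 \<Longrightarrow> pabs y \<le> 1 \<Longrightarrow> pabs (x * y) \<le> 1"
  using pabs_mult_le[of x 1 y 1] by simp

lemma pabs_power_le_1: "pabs (x::'k) \<le> 1 \<Longrightarrow> pabs (x ^ n) \<le> 1"
  by (simp add: pabs_power power_le_one)

lemma pabs_of_nat_le_1: "pabs (of_nat n :: 'k) \<le> 1"
  by (induction n) (auto intro: pabs_add_le)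

lemma pabs_of_int_le_1: "pabs (of_int n :: 'k) \<le> 1"
  by (cases n rule: int_cases2) (auto simp: pabs_of_nat_le_1)

lemma pabs_p_less_1: "pabs (of_nat p :: 'k) < 1"
  using p_gt_1 by (simp add: pabs_p)

text \<open>Bezout: in u p + v n = 1 the first summand is smaller than 1, so v n is a unit, and
  neither of its factors exceeds 1.\<close>

lemma pabs_of_nat_coprime:
  assumes "\<not> p dvd n" shows "pabs (of_nat n :: 'k) = 1"
proof -
  have "coprime p n"
    using assms prime_p prime_imp_coprime by blast
  then have "coprime (int p) (int n)"
    by simp
  then obtain u v where uv: "u * int p + v * int n = 1"
    by (metis bezout_int coprime_iff_gcd_eq_1)
  have "1 = of_int u * of_nat p + of_int v * (of_nat n :: 'k)"
    using arg_cong[OF uv, of "of_int :: int \<Rightarrow> 'k"] by simp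
  moreover have "pabs (of_int u * of_nat p :: 'k) < 1"
    using pabs_mult_le[OF pabs_of_int_le_1 order_refl, of u "of_nat p"] pabs_p_less_1 by simp
  ultimately have "pabs (of_int v * (of_nat n :: 'k)) = 1"
    using pabs_eq_if_close[of "1::'k" "of_int v * of_nat n"]
    by (metis add_diff_cancel_right' pabs_1)
  then show ?thesis
    using pabs_of_nat_le_1[of n] pabs_of_int_le_1[of v]
    by (metis mult.commute mult_le_cancel_left1 mult_left_le nle_le pabs_mult pabs_nonneg linorder_not_less)
qed

lemma pabs_of_nat_dvd: "p dvd n \<Longrightarrow> pabs (of_nat n :: 'k) \<le> 1 / real p"
  using pabs_of_nat_le_1 by (elim dvdE) (auto simp: pabs_mult pabs_p divide_right_mono)

lemma pabs_of_nat_less_1_iff: "pabs (of_nat n :: 'k) < 1 \<longleftrightarrow> p dvd n"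
  using pabs_of_nat_coprime[of n] pabs_of_nat_dvd[of n] inverse_p_less_1
  by (cases "p dvd n") (linarith, simp)

section \<open>Polynomials and the Gauss norm\<close>

lemma pabs_poly_le:
  assumes "\<And>i. pabs (coeff f i :: 'k) \<le> b" "pabs x \<le> 1"
  shows "pabs (poly f x) \<le> b"
  unfolding poly_altdef
proof (rule pabs_sum_le)
  show "0 \<le> b"
    using assms(1) pabs_nonneg order_trans by blast
  show "pabs (coeff f i * x ^ i) \<le> b" for i
    using pabs_mult_le[OF assms(1) pabs_power_le_1[OF assms(2)]] by simp
qed

lemma pabs_poly_less:
  assumes "\<And>i. pabs (coeff f i :: 'k) < b" "pabs x \<le> 1"
  shows "pabs (poly f x) < b"
  unfolding poly_altdef
proof (rule pabs_sum_less)
  show "0 < b"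
    using assms(1) pabs_nonneg le_less_trans by blast
  show "pabs (coeff f i * x ^ i) < b" for i
    using mult_left_mono[OF pabs_power_le_1[OF assms(2), of i], of "pabs (coeff f i)"] assms(1)[of i]
    by (simp add: pabs_mult)
qed

text \<open>At a point larger than 1 the leading term would strictly dominate all the others, so the
  value could not vanish.\<close>

lemma integral_monic_root:
  assumes "lead_coeff f = (1::'k)" "\<And>i. pabs (coeff f i) \<le> 1" "poly f x = 0"
  shows "pabs x \<le> 1"
proof (rule ccontr)
  assume "\<not> pabs x \<le> 1"
  then have x: "1 < pabs x"
    by simp
  let ?n = "degree f"
  have "poly f x = (\<Sum>i<?n. coeff f i * x ^ i) + x ^ ?n"
    using assms(1) by (simp add: poly_altdef lessThan_Suc_atMost[symmetric])
  moreover have "pabs (\<Sum>i<?n. coeff f i * x ^ i) < pabs x ^ ?n"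
  proof (rule pabs_sum_less)
    show "pabs (coeff f i * x ^ i) < pabs x ^ ?n" if "i \<in> {..<?n}" for i
    proof -
      have "pabs (coeff f i * x ^ i) \<le> pabs x ^ i"
        using assms(2)[of i] x by (simp add: pabs_mult pabs_power mult_left_le_one_le)
      also have "\<dots> < pabs x ^ ?n"
        using x that by (simp add: power_strict_increasing)
      finally show ?thesis .
    qed
  qed (use x in \<open>auto simp del: pabs_pos_iff intro!: zero_less_power\<close>)
  ultimately show False
    using assms(3) pabs_add_eq[of "\<Sum>i<?n. coeff f i * x ^ i" "x ^ ?n"] x
    by (auto simp: add.commute pabs_power)
qed

lemma pabs_coeff_mult_le:
  assumes "\<And>i. pabs (coeff f i :: 'k) \<le> b" "\<And>i. pabs (coeff g i) \<le> c"
  shows "pabs (coeff (f * g) i) \<le> b * c"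
  unfolding coeff_mult
proof (rule pabs_sum_le)
  show "0 \<le> b * c"
    using assms by (meson mult_nonneg_nonneg order_trans pabs_nonneg)
qed (use assms pabs_mult_le in auto)

lemma pabs_coeff_linear_factors:
  assumes "finite S" "\<And>s. s \<in> S \<Longrightarrow> pabs (s::'k) \<le> 1"
  shows "pabs (coeff (\<Prod>s\<in>S. [:- s, 1:]) i) \<le> 1"
  using assms
proof (induction S arbitrary: i rule: finite_induct)
  case (insert s S)
  have "pabs (coeff [:- s, 1:] i) \<le> 1" for i
    using insert.prems by (cases i rule: nat.exhaust; cases "i - 1") (auto simp: coeff_pCons split: nat.splits)
  then show ?case
    using pabs_coeff_mult_le[of "[:- s, 1:]" 1 "\<Prod>s\<in>S. [:- s, 1:]" 1] insert by simp
qed (auto simp: coeff_pCons split: nat.splits)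

text \<open>
  A maximum principle without residue fields: after truncating \<open>f\<close> at its last coefficient of
  maximal absolute value, the equation \<open>f(y) \<Prod> (y - s) = 1\<close> has an integral root, at which every
  factor must be a unit.
\<close>

lemma poly_attains_gauss_norm:
  assumes S: "finite S" "S \<noteq> {}" "\<And>s. s \<in> S \<Longrightarrow> pabs (s::'k) \<le> 1" and "f \<noteq> 0"
  obtains y where "pabs y \<le> 1" "\<And>s. s \<in> S \<Longrightarrow> pabs (y - s) = 1"
    "\<And>i. pabs (coeff f i) \<le> pabs (poly f y)"
proof -
  define M where "M = Max ((\<lambda>i. pabs (coeff f i)) ` {..degree f})"
  have M_ge: "pabs (coeff f i) \<le> M" for i
  proof (cases "i \<le> degree f")
    case False
    have "pabs (lead_coeff f) \<le> M"
      unfolding M_def by (intro Max_ge) auto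
    moreover have "coeff f i = 0"
      using False by (simp add: coeff_eq_0)
    ultimately show ?thesis
      using pabs_nonneg[of "lead_coeff f"] by (simp del: pabs_nonneg)
  qed (auto simp: M_def)
  have "M \<in> (\<lambda>i. pabs (coeff f i)) ` {..degree f}"
    unfolding M_def by (intro Max_in) auto
  then obtain j where j: "pabs (coeff f j) = M"
    by auto
  have "0 < M"
    using M_ge[of "degree f"] \<open>f \<noteq> 0\<close> by (metis leading_coeff_0_iff order_less_le_trans pabs_pos_iff)
  \<comment> \<open>Because the index is the last of maximal size, the truncation divided by its top
    coefficient is integral and monic, and the discarded part \<open>h\<close> has Gauss norm
    strictly below \<open>M\<close>.\<close>
  define n where "n = (GREATEST i. pabs (coeff f i) = M)"
  have bound: "i \<le> degree f" if "pabs (coeff f i) = M" for i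
    using that \<open>0 < M\<close> le_degree by (metis pabs_pos_iff)
  have n: "pabs (coeff f n) = M"
    unfolding n_def using GreatestI_nat[of "\<lambda>i. pabs (coeff f i) = M", OF j] bound by blast
  have after_n: "pabs (coeff f i) < M" if "n < i" for i
  proof -
    have "pabs (coeff f i) \<noteq> M"
      using Greatest_le_nat[of "\<lambda>i. pabs (coeff f i) = M" i] bound that unfolding n_def by auto
    then show ?thesis
      using M_ge[of i] by simp
  qed
  define c where "c = coeff f n"
  have c: "c \<noteq> 0" "pabs c = M"
    using n \<open>0 < M\<close> unfolding c_def by (auto simp flip: pabs_pos_iff)
  define g where "g = smult (inverse c) (poly_cutoff (Suc n) f)"
  define h where "h = f - poly_cutoff (Suc n) f"
  have g_int: "pabs (coeff g i) \<le> 1" for i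
    using M_ge[of i] c \<open>0 < M\<close>
    by (auto simp: g_def coeff_poly_cutoff pabs_divide field_simps)
  have g_deg: "degree g = n" and g_monic: "lead_coeff g = 1"
  proof -
    have "coeff g n = 1" "\<And>i. i > n \<Longrightarrow> coeff g i = 0"
      using c by (auto simp: g_def coeff_poly_cutoff c_def)
    then show "degree g = n"
      by (metis degree_le le_degree nle_le zero_neq_one)
    then show "lead_coeff g = 1"
      using \<open>coeff g n = 1\<close> by simp
  qed
  define L where "L = (\<Prod>s\<in>S. [:- s, 1::'k:])"
  have L_deg: "degree L = card S"
    unfolding L_def by (subst degree_prod_eq_sum_degree) auto
  have L_monic: "lead_coeff L = 1"
    unfolding L_def by (simp add: lead_coeff_prod)
  define Q where "Q = g * L - 1"
  have gL: "g \<noteq> 0" "L \<noteq> 0"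
    using g_monic L_monic by auto
  have deg: "degree (g * L) = n + card S"
    using gL g_deg L_deg by (simp add: degree_mult_eq)
  \<comment> \<open>Nonemptiness of \<open>S\<close> gives \<open>Q\<close> positive degree even
    when the truncation is constant, and keeps the subtracted 1 away from the leading
    coefficient.\<close>
  have pos: "0 < card S"
    using S by (simp add: card_gt_0_iff)
  have Q_deg: "degree Q = n + card S" and Q_monic: "lead_coeff Q = 1"
  proof -
    have "degree (1::'k poly) < degree (g * L)"
      using deg pos by simp
    then have "degree (g * L + (-1)) = degree (g * L)"
      by (intro degree_add_eq_left) simp
    then show *: "degree Q = n + card S"
      using deg by (simp add: Q_def)
    have "lead_coeff (g * L) = 1"
      using g_monic L_monic by (simp add: lead_coeff_mult)
    then show "lead_coeff Q = 1"
      using deg pos unfolding * by (simp add: Q_def coeff_pCons split: nat.splits)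
  qed
  have L_int: "pabs (coeff L i) \<le> 1" for i
    unfolding L_def using pabs_coeff_linear_factors[OF S(1,3)] by auto
  have Q_int: "pabs (coeff Q i) \<le> 1" for i
    unfolding Q_def coeff_diff
    using pabs_coeff_mult_le[of g 1 L 1 i, OF g_int L_int]
    by (intro pabs_diff_le) (auto simp: coeff_pCons split: nat.splits)
  obtain y where "poly Q y = 0"
    using alg_closed_imp_poly_has_root[of Q] Q_deg pos by auto
  then have y: "poly g y * (\<Prod>s\<in>S. y - s) = 1"
    by (simp add: Q_def L_def poly_prod)
  have y1: "pabs y \<le> 1"
    using integral_monic_root[OF Q_monic Q_int \<open>poly Q y = 0\<close>] .
  have gy: "pabs (poly g y) \<le> 1"
    using pabs_poly_le[OF g_int y1] .
  have ys: "pabs (y - s) \<le> 1" if "s \<in> S" for s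
    using pabs_diff_le[OF y1 S(3)[OF that]] .
  have Ly: "pabs (\<Prod>s\<in>S. y - s) \<le> 1"
    unfolding pabs_prod using ys by (intro prod_le_1) auto
  have prod1: "pabs (poly g y) * pabs (\<Prod>s\<in>S. y - s) = 1"
    using arg_cong[OF y, of pabs] by (simp add: pabs_mult)
  have gy1: "pabs (poly g y) = 1"
    using prod1 gy Ly by (metis mult_left_le mult.commute nle_le pabs_nonneg)
  have Ly1: "(\<Prod>s\<in>S. pabs (y - s)) = 1"
    using prod1 gy1 by (simp add: pabs_prod)
  have unit: "pabs (y - s) = 1" if "s \<in> S" for s
  proof -
    have "(\<Prod>s\<in>S. pabs (y - s)) = pabs (y - s) * (\<Prod>s\<in>S - {s}. pabs (y - s))"
      using that S(1) by (simp add: prod.remove)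
    moreover have "(\<Prod>s\<in>S - {s}. pabs (y - s)) \<le> 1"
      using ys by (intro prod_le_1) auto
    ultimately show ?thesis
      using Ly1 ys[OF that] by (metis mult_left_le nle_le pabs_nonneg)
  qed
  have "pabs (poly h y) < M"
  proof (rule pabs_poly_less[OF _ y1])
    show "pabs (coeff h i) < M" for i
      using after_n[of i] \<open>0 < M\<close> by (auto simp: h_def coeff_poly_cutoff)
  qed
  moreover have "poly f y = c * poly g y + poly h y"
    using c by (simp add: g_def h_def)
  ultimately have "pabs (poly f y) = M"
    using pabs_add_eq[of "poly h y" "c * poly g y"] gy1 c by (simp add: pabs_mult)
  then show thesis
    using that[of y] y1 unit M_ge by auto
qed

lemma pabs_coeff_le_of_poly_le:
  assumes S: "finite S" "S \<noteq> {}" "\<And>s. s \<in> S \<Longrightarrow> pabs (s::'k) \<le> 1" and "0 \<le> b"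
    and le: "\<And>y. pabs y \<le> 1 \<Longrightarrow> (\<And>s. s \<in> S \<Longrightarrow> pabs (y - s) = 1) \<Longrightarrow> pabs (poly f y) \<le> b"
  shows "pabs (coeff f i) \<le> b"
proof (cases "f = 0")
  case False
  then obtain y where "pabs y \<le> 1" "\<And>s. s \<in> S \<Longrightarrow> pabs (y - s) = 1"
    "\<And>i. pabs (coeff f i) \<le> pabs (poly f y)"
    using poly_attains_gauss_norm[OF S] by metis
  then show ?thesis
    using le order_trans by blast
qed (use \<open>0 \<le> b\<close> in simp)

section \<open>Integrality of the Artin-Hasse exponential\<close>

lemma pabs_prime_power_add:
  assumes "pabs (x::'k) \<le> 1" "pabs y \<le> 1"
  shows "pabs ((x + y) ^ p - (x ^ p + y ^ p)) \<le> 1 / real p"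
proof -
  obtain c :: "nat \<Rightarrow> nat" where
    c: "(x + y) ^ p = x ^ p + y ^ p + of_nat p * (\<Sum>k\<in>{1..<p}. of_nat (c k) * x ^ k * y ^ (p - k))"
    using prime_power_add[OF prime_p] .
  have "pabs (\<Sum>k\<in>{1..<p}. of_nat (c k) * x ^ k * y ^ (p - k)) \<le> 1"
    using assms by (intro pabs_sum_le pabs_mult_le_1 pabs_power_le_1 pabs_of_nat_le_1) auto
  then show ?thesis
    by (simp add: c pabs_mult pabs_p divide_right_mono)
qed

lemma fps_integral_mult:
  assumes "\<And>n. pabs (fps_nth f n :: 'k) \<le> 1" "\<And>n. pabs (fps_nth g n) \<le> 1"
  shows "pabs (fps_nth (f * g) n) \<le> 1"
  unfolding fps_mult_nth using assms by (intro pabs_sum_le pabs_mult_le_1) auto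

lemma fps_integral_power:
  assumes "\<And>n. pabs (fps_nth f n :: 'k) \<le> 1"
  shows "pabs (fps_nth (f ^ k) n) \<le> 1"
proof (induction k arbitrary: n)
  case (Suc k)
  then show ?case
    using fps_integral_mult[of f "f ^ k"] assms by simp
qed auto

lemma fps_prime_power_add:
  assumes "\<And>n. pabs (fps_nth f n :: 'k) \<le> 1" "\<And>n. pabs (fps_nth g n) \<le> 1"
  shows "pabs (fps_nth ((f + g) ^ p - (f ^ p + g ^ p)) n) \<le> 1 / real p"
proof -
  obtain c :: "nat \<Rightarrow> nat" where
    c: "(f + g) ^ p = f ^ p + g ^ p + of_nat p * (\<Sum>k\<in>{1..<p}. of_nat (c k) * f ^ k * g ^ (p - k))"
    using prime_power_add[OF prime_p] .
  have "pabs (fps_nth (\<Sum>k\<in>{1..<p}. of_nat (c k) * f ^ k * g ^ (p - k)) n) \<le> 1"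
    unfolding fps_sum_nth using assms
    by (intro pabs_sum_le fps_integral_mult fps_integral_power)
       (auto simp: fps_of_nat[symmetric] pabs_of_nat_le_1 simp del: fps_of_nat)
  then show ?thesis
    by (simp add: c fps_of_nat[symmetric] pabs_mult pabs_p divide_right_mono del: fps_of_nat)
qed

lemma rational_residue:
  assumes "r \<in> \<rat>" "pabs (r::'k) \<le> 1"
  obtains n :: nat where "n < p" "pabs (r - of_nat n) \<le> 1 / real p"
proof -
  obtain q :: rat where q: "r = of_rat q"
    using assms(1) Rats_cases by blast
  obtain x y where xy: "quotient_of q = (x, y)"
    by fastforce
  have "0 < y" "coprime x y"
    using xy quotient_of_denom_pos quotient_of_coprime by blast+
  have r: "r = of_int x / of_int y"
    using q quotient_of_div[OF xy] by (simp add: of_rat_divide)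
  have y0: "(of_int y :: 'k) \<noteq> 0"
    using \<open>0 < y\<close> by simp
  have "\<not> int p dvd y"
  proof
    assume "int p dvd y"
    then have "p dvd nat y"
      using \<open>0 < y\<close> dvd_nat_abs_iff[of p y] by simp
    then have "pabs (of_int y :: 'k) < 1"
      using pabs_of_nat_less_1_iff[of "nat y"] \<open>0 < y\<close> by (simp add: of_nat_nat)
    moreover have "\<not> int p dvd x"
      using \<open>coprime x y\<close> \<open>int p dvd y\<close> prime_p coprime_common_divisor[of x y "int p"] p_ge_2
      by auto
    then have "\<not> p dvd nat \<bar>x\<bar>"
      by (simp add: dvd_nat_abs_iff)
    then have "pabs (of_nat (nat \<bar>x\<bar>) :: 'k) = 1"
      using pabs_of_nat_coprime by blast
    then have "pabs (of_int x :: 'k) = 1"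
      by (cases "x \<ge> 0") (simp_all add: of_nat_nat)
    ultimately show False
      using assms(2) y0 pabs_nonneg[of "of_int y"]
      by (simp add: r pabs_divide divide_le_eq_1 del: pabs_nonneg)
  qed
  then have "coprime (int p) y"
    using prime_p prime_imp_coprime[of "int p" y] by auto
  then obtain u v where uv: "u * int p + v * y = 1"
    by (metis bezout_int coprime_iff_gcd_eq_1)
  have y1: "pabs (of_int y :: 'k) = 1"
  proof -
    have "\<not> p dvd nat y"
      using \<open>\<not> int p dvd y\<close> \<open>0 < y\<close> dvd_nat_abs_iff[of p y] by simp
    then show ?thesis
      using pabs_of_nat_coprime[of "nat y"] \<open>0 < y\<close> by (simp add: of_nat_nat)
  qed
  \<comment> \<open>Here v inverts y modulo p, so x v represents r = x/y modulo p.\<close>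
  define n where "n = nat ((x * v) mod int p)"
  have n: "int n = (x * v) mod int p"
    using p_gt_0 by (simp add: n_def)
  have "r - of_nat n = of_nat p * (of_int (x * u) / of_int y + of_int (x * v div int p))"
  proof -
    have "x * v = int p * (x * v div int p) + int n"
      by (simp add: n)
    then have *: "(of_int x * of_int v :: 'k) = of_nat p * of_int (x * v div int p) + of_nat n"
      by (metis of_int_mult of_int_add of_int_of_nat_eq)
    have "(of_int u * of_nat p + of_int v * of_int y :: 'k) = 1"
      using arg_cong[OF uv, of "of_int :: int \<Rightarrow> 'k"] by simp
    then have "r = of_int x * (of_int u * of_nat p + of_int v * of_int y) / of_int y"
      by (simp add: r)
    also have "\<dots> = of_nat p * (of_int (x * u) / of_int y) + of_int x * of_int v"
      using y0 by (simp add: field_simps)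
    finally show ?thesis
      using * by (simp add: algebra_simps)
  qed
  then have "pabs (r - of_nat n) \<le> 1 / real p"
    using pabs_add_le[of "of_int (x * u) / of_int y" 1 "of_int (x * v div int p)"]
      pabs_of_int_le_1[of "x * u"] pabs_of_int_le_1[of "x * v div int p"]
    by (simp add: pabs_mult pabs_divide pabs_p y1 divide_right_mono)
  moreover have "n < p"
    using n p_gt_0 by (metis of_nat_0_less_iff of_nat_less_iff pos_mod_bound)
  ultimately show thesis
    using that by blast
qed

lemma pabs_power_diff_le:
  assumes "pabs (x::'k) \<le> 1" "pabs y \<le> 1"
  shows "pabs (x ^ n - y ^ n) \<le> pabs (x - y)"
proof -
  have "pabs (\<Sum>i<n. y ^ (n - Suc i) * x ^ i) \<le> 1"
    using assms by (intro pabs_sum_le pabs_mult_le_1 pabs_power_le_1) auto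
  then show ?thesis
    by (simp add: power_diff_sumr2 pabs_mult mult_left_le)
qed

text \<open>Replacing r by a natural number with the same residue changes neither r^p nor r modulo
  p, and for natural numbers the binomial theorem gives the induction. The congruence would fail for
  residues outside F_p.\<close>

lemma rational_fermat:
  assumes "r \<in> \<rat>" "pabs (r::'k) \<le> 1"
  shows "pabs (r ^ p - r) \<le> 1 / real p"
proof -
  have nat: "pabs ((of_nat n :: 'k) ^ p - of_nat n) \<le> 1 / real p" for n
  proof (induction n)
    case (Suc n)
    have "pabs ((of_nat n + 1 :: 'k) ^ p - (of_nat n ^ p + 1 ^ p)) \<le> 1 / real p"
      by (intro pabs_prime_power_add) (auto simp: pabs_of_nat_le_1)
    from pabs_add_le[OF this Suc] show ?case
      by (simp add: algebra_simps)
  qed (use p_gt_0 in \<open>simp add: power_0_left\<close>)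
  obtain n where n: "pabs (r - of_nat n) \<le> 1 / real p"
    using rational_residue[OF assms] .
  have "pabs (r ^ p - of_nat n ^ p) \<le> 1 / real p"
    using pabs_power_diff_le[OF assms(2) pabs_of_nat_le_1[of n], of p] n by simp
  from pabs_diff_le[OF pabs_add_le[OF this nat[of n]] n] show ?thesis
    by (simp add: algebra_simps)
qed

text \<open>Legendre's count: among 1, ..., n only the n div p multiples of p are not units, and
  removing one factor p from each leaves the factorial of n div p.\<close>

lemma pabs_fact_div: "pabs (of_nat (fact n) :: 'k) = (1 / real p) ^ (n div p) * pabs (of_nat (fact (n div p)) :: 'k)"
proof (induction n)
  case (Suc n)
  show ?case
  proof (cases "p dvd Suc n")
    case True
    then obtain m where m: "Suc n = p * m"
      by auto
    then have "0 < m"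
      by (cases m) auto
    then obtain k where k: "m = Suc k"
      using not0_implies_Suc by blast
    have "Suc n div p = m"
      using m p_gt_0 by simp
    moreover have "n div p = k"
      using m p_ge_2 unfolding k by (intro div_nat_eqI) (simp_all add: algebra_simps)
    moreover have "of_nat (fact (Suc n)) = of_nat p * (of_nat m * (of_nat (fact n) :: 'k))"
      by (metis fact_Suc m mult.assoc of_nat_mult of_nat_id)
    moreover have "of_nat (fact m) = of_nat m * (of_nat (fact k) :: 'k)"
      unfolding k by (metis fact_Suc of_nat_mult of_nat_id)
    ultimately show ?thesis
      using Suc k by (simp add: pabs_mult pabs_p del: of_nat_Suc of_nat_fact fact_Suc)
  next
    case False
    have "Suc n div p = n div p"
      using False by (metis div_Suc dvd_eq_mod_eq_0)
    moreover have "of_nat (fact (Suc n)) = of_nat (Suc n) * (of_nat (fact n) :: 'k)"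
      by (metis fact_Suc of_nat_mult of_nat_id)
    ultimately show ?thesis
      using Suc pabs_of_nat_coprime[OF False] by (simp add: pabs_mult del: of_nat_Suc of_nat_fact)
  qed
qed auto

text \<open>With m = n div p the recursion gives n! a p-order of at most m + (m - 1), and 2m <= p m
  <= n. The crude bound n - 1 is sharp for p = 2.\<close>

lemma pabs_fact_ge:
  assumes "0 < n"
  shows "(1 / real p) ^ (n - 1) \<le> pabs (of_nat (fact n) :: 'k)"
  using assms
proof (induction n rule: less_induct)
  case (less n)
  show ?case
  proof (cases "n div p = 0")
    case True
    then have "pabs (of_nat (fact n) :: 'k) = 1"
      using pabs_fact_div[of n] by simp
    then show ?thesis
      using p_gt_1 by (simp add: power_le_one)
  next
    case False
    let ?m = "n div p"
    have "?m < n"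
      using less.prems p_ge_2 by (intro div_less_dividend) auto
    have "2 * ?m \<le> p * ?m"
      using p_ge_2 by simp
    also have "\<dots> \<le> n"
      by simp
    finally have "?m + (?m - 1) \<le> n - 1"
      using False by simp
    then have "(1 / real p) ^ (n - 1) \<le> (1 / real p) ^ (?m + (?m - 1))"
      using p_gt_1 by (intro power_decreasing) auto
    also have "\<dots> \<le> (1 / real p) ^ ?m * pabs (of_nat (fact ?m) :: 'k)"
      using less.IH[OF \<open>?m < n\<close>] False
      by (subst power_add, intro mult_left_mono) (auto simp del: of_nat_fact)
    finally show ?thesis
      by (simp only: pabs_fact_div[of n])
  qed
qed

text \<open>The order of p^n / n! is at least n - (n - 1) = 1, so exp(pX) is 1 modulo p, also for p
  = 2.\<close>

lemma pabs_exp_coeff: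
  assumes "0 < n"
  shows "pabs (fps_nth (fps_exp (of_nat p :: 'k)) n) \<le> 1 / real p"
proof -
  have n: "(1 / real p) ^ n = (1 / real p) * (1 / real p) ^ (n - 1)"
    using assms by (metis power_eq_if neq0_conv)
  have pos: "0 < pabs (of_nat (fact n) :: 'k)"
    by simp
  have "pabs (fps_nth (fps_exp (of_nat p :: 'k)) n) = (1 / real p) ^ n / pabs (of_nat (fact n) :: 'k)"
    by (simp add: pabs_divide pabs_power pabs_p)
  also have "\<dots> \<le> 1 / real p"
    using mult_left_mono[OF pabs_fact_ge[OF assms], of "1 / real p"] pos
    by (simp only: n pos_divide_le_eq) simp
  finally show ?thesis .
qed

text \<open>
  Dwork's argument: compare \<open>E\<^sup>p\<close> with \<open>E(X\<^sup>p) exp(pX)\<close> modulo \<open>p\<close>, where both agree with the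
  same truncation up to the term \<open>p e\<^sub>n\<close>.
\<close>

theorem artin_hasse_integral: "pabs (fps_nth (artin_hasse p :: 'k fps) n) \<le> 1"
proof (induction n rule: less_induct)
  case (less n)
  let ?E = "artin_hasse p :: 'k fps"
  have E0: "fps_nth ?E 0 = 1"
    by (simp add: artin_hasse_0)
  show ?case
  proof (cases "n = 0")
    case False
    define T where "T = (\<lambda>m. \<Sum>i<m. fps_const (fps_nth ?E i) * fps_X ^ i)"
    have T_nth: "fps_nth (T m) i = (if i < m then fps_nth ?E i else 0)" for m i
      by (simp add: T_def fps_sum_nth fps_X_power_nth if_distrib sum.delta cong: if_cong)
    have T_int: "pabs (fps_nth (T m) i) \<le> 1" if "m \<le> n" for m i
      using less that by (auto simp: T_nth)
    \<comment> \<open>Frobenius modulo p: T(X)^p = T(X^p), one monomial at a time. Mixed terms are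
      divisible by p, and Fermat's congruence handles the new coefficient because it is
      rational.\<close>
    have T_frob: "pabs (fps_nth (T m ^ p - (T m oo fps_X ^ p)) i) \<le> 1 / real p" if "m \<le> n" for m i
      using that
    proof (induction m arbitrary: i)
      case 0
      then show ?case
        using p_gt_0 by (simp add: T_def power_0_left)
    next
      case (Suc m)
      let ?e = "fps_nth ?E m"
      let ?f = "fps_const ?e * fps_X ^ m"
      have e: "pabs ?e \<le> 1"
        using less Suc by simp
      have Ts: "T (Suc m) = T m + ?f"
        by (simp add: T_def)
      have "pabs (fps_nth (T (Suc m) ^ p - (T m ^ p + ?f ^ p)) i) \<le> 1 / real p"
        unfolding Ts using Suc.prems e
        by (intro fps_prime_power_add T_int) (auto simp: fps_X_power_nth)
      moreover have "pabs (fps_nth (T m ^ p - (T m oo fps_X ^ p)) i) \<le> 1 / real p"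
        using Suc by simp
      moreover have "pabs (fps_nth (?f ^ p - (?f oo fps_X ^ p)) i) \<le> 1 / real p"
      proof -
        have "?f oo fps_X ^ p = fps_const ?e * fps_X ^ (p * m)"
          using p_gt_0 by (auto simp: fps_eq_iff fps_nth_compose_X_power fps_X_power_nth)
        moreover have "?f ^ p = fps_const (?e ^ p) * fps_X ^ (p * m)"
          by (simp add: power_mult_distrib fps_const_power mult.commute flip: power_mult)
        ultimately have "?f ^ p - (?f oo fps_X ^ p) = fps_const (?e ^ p - ?e) * fps_X ^ (p * m)"
          by (metis fps_const_sub left_diff_distrib)
        then show ?thesis
          using rational_fermat[OF artin_hasse_rational[OF p_gt_0] e]
          by (auto simp: fps_X_power_nth)
      qed
      ultimately have "pabs (fps_nth ((T (Suc m) ^ p - (T m ^ p + ?f ^ p)) + (T m ^ p - (T m oo fps_X ^ p))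
          + (?f ^ p - (?f oo fps_X ^ p))) i) \<le> 1 / real p"
        unfolding fps_add_nth by (intro pabs_add_le)
      also have "(T (Suc m) ^ p - (T m ^ p + ?f ^ p)) + (T m ^ p - (T m oo fps_X ^ p))
          + (?f ^ p - (?f oo fps_X ^ p)) = T (Suc m) ^ p - (T (Suc m) oo fps_X ^ p)"
        by (simp add: Ts fps_compose_add_distrib)
      finally show ?case .
    qed
    let ?S = "fps_shift n ?E"
    have split: "?E = T n + fps_X ^ n * ?S"
      by (auto simp: fps_eq_iff T_nth fps_X_power_mult_nth)
    have T0: "fps_nth (T n) 0 = 1"
      using False E0 by (simp add: T_nth)
    have lhs: "fps_nth (?E ^ p) n = fps_nth (T n ^ p) n + of_nat p * fps_nth ?E n"
      using fps_power_add_X_power[OF T0, of n ?S p] False by (simp flip: split)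
    have "?E ^ p = (?E oo fps_X ^ p) * fps_exp (of_nat p)"
      using artin_hasse_power[of p, where 'a='k] p_ge_2 by simp
    then have "fps_nth (?E ^ p) n = (\<Sum>i=0..n. fps_nth (?E oo fps_X ^ p) i * fps_nth (fps_exp (of_nat p)) (n - i))"
      by (simp add: fps_mult_nth)
    also have "\<dots> = fps_nth (?E oo fps_X ^ p) n +
        (\<Sum>i=0..<n. fps_nth (?E oo fps_X ^ p) i * fps_nth (fps_exp (of_nat p)) (n - i))" (is "_ = _ + ?R")
      by (simp add: sum.last_plus)
    \<comment> \<open>A nonzero coefficient of X^n in E(X^p) has index n / p < n in E, so the
      truncation already contains it.\<close>
    also have "fps_nth (?E oo fps_X ^ p) n = fps_nth (T n oo fps_X ^ p) n"
      using False p_ge_2 by (auto simp: fps_nth_compose_X_power T_nth)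
    finally have "of_nat p * fps_nth ?E n = ?R - fps_nth (T n ^ p - (T n oo fps_X ^ p)) n"
      using lhs by (simp add: algebra_simps)
    \<comment> \<open>Every term of \<open>?R\<close> contains a nonconstant coefficient of exp(pX),
      times a coefficient already known to be integral.\<close>
    moreover have "pabs ?R \<le> 1 / real p"
    proof (rule pabs_sum_le)
      fix i assume i: "i \<in> {0..<n}"
      have "i div p \<le> i"
        by simp
      then have "pabs (fps_nth (?E oo fps_X ^ p) i) \<le> 1"
        using i less[of "i div p"] \<open>i div p \<le> i\<close> by (auto simp: fps_nth_compose_X_power)
      then show "pabs (fps_nth (?E oo fps_X ^ p) i * fps_nth (fps_exp (of_nat p)) (n - i)) \<le> 1 / real p"
        using pabs_mult_le[OF _ pabs_exp_coeff[of "n - i"], of "fps_nth (?E oo fps_X ^ p) i" 1] i by simp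
    qed simp
    ultimately have "pabs (of_nat p * fps_nth ?E n) \<le> 1 / real p"
      using pabs_diff_le[OF _ T_frob[of n n]] by simp
    then show ?thesis
      using p_gt_0 by (simp add: pabs_mult pabs_p divide_le_cancel)
  qed (simp add: E0)
qed

section \<open>The unramified extension and its Teichmueller representatives\<close>

lemma closure_iff_pabs: "x \<in> closure S \<longleftrightarrow> (\<forall>\<epsilon>>0. \<exists>y\<in>S. pabs (x - y :: 'k) < \<epsilon>)"
  by (simp add: closure_approachable dist_eq_pabs pabs_diff_commute)

text \<open>\<open>padic_numbers\<close> is only a closure, so the field operations are transported
  from the rationals by approximation. For the inverse, an approximant closer than |x| has the same
  absolute value as x.\<close>

lemma is_subfield_padic: "is_subfield (padic_numbers :: 'k set)"
  unfolding is_subfield_def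
proof (intro conjI ballI)
  fix x y :: 'k assume x: "x \<in> padic_numbers" and y: "y \<in> padic_numbers"
  have ax: "\<exists>r\<in>\<rat>. pabs (x - r) < \<epsilon>" and ay: "\<exists>r\<in>\<rat>. pabs (y - r) < \<epsilon>" if "0 < \<epsilon>" for \<epsilon>
    using x y that unfolding padic_numbers_def closure_iff_pabs by auto
  show "x + y \<in> padic_numbers"
    unfolding padic_numbers_def closure_iff_pabs
  proof (intro allI impI)
    fix \<epsilon> :: real assume "0 < \<epsilon>"
    then obtain r s where "r \<in> \<rat>" "s \<in> \<rat>" "pabs (x - r) < \<epsilon>" "pabs (y - s) < \<epsilon>"
      using ax ay by metis
    then show "\<exists>t\<in>\<rat>. pabs (x + y - t) < \<epsilon>"
      using pabs_add_less[of "x - r" \<epsilon> "y - s"] by (intro bexI[of _ "r + s"]) (auto simp: algebra_simps)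
  qed
  show "x * y \<in> padic_numbers"
    unfolding padic_numbers_def closure_iff_pabs
  proof (intro allI impI)
    fix \<epsilon> :: real assume "0 < \<epsilon>"
    define M where "M = max 1 (max (pabs x) (pabs y))"
    have M: "1 \<le> M" "pabs x \<le> M" "pabs y \<le> M"
      by (auto simp: M_def)
    obtain r where r: "r \<in> \<rat>" "pabs (x - r) < min 1 (\<epsilon> / M)"
      using ax[of "min 1 (\<epsilon> / M)"] \<open>0 < \<epsilon>\<close> M by auto
    obtain s where s: "s \<in> \<rat>" "pabs (y - s) < \<epsilon> / M"
      using ay[of "\<epsilon> / M"] \<open>0 < \<epsilon>\<close> M by auto
    have rM: "pabs r \<le> M"
      using pabs_diff_le[of x M "x - r"] r M by auto
    have "pabs (x * y - r * s) = pabs ((x - r) * y + r * (y - s))"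
      by (simp add: algebra_simps)
    also have "\<dots> < \<epsilon>"
    proof (rule pabs_add_less)
      have "pabs (x - r) * pabs y \<le> pabs (x - r) * M"
        using M by (intro mult_left_mono) auto
      also have "\<dots> < \<epsilon>"
        using r(2) M by (simp add: field_simps)
      finally show "pabs ((x - r) * y) < \<epsilon>"
        by (simp add: pabs_mult)
      have "pabs r * pabs (y - s) \<le> M * pabs (y - s)"
        using rM by (intro mult_right_mono) auto
      also have "\<dots> < \<epsilon>"
        using s(2) M by (simp add: field_simps)
      finally show "pabs (r * (y - s)) < \<epsilon>"
        by (simp add: pabs_mult)
    qed
    finally show "\<exists>t\<in>\<rat>. pabs (x * y - t) < \<epsilon>"
      using r s by (intro bexI[of _ "r * s"]) auto
  qed
next
  fix x :: 'k assume x: "x \<in> padic_numbers"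
  have ax: "\<exists>r\<in>\<rat>. pabs (x - r) < \<epsilon>" if "0 < \<epsilon>" for \<epsilon>
    using x that unfolding padic_numbers_def closure_iff_pabs by auto
  show "- x \<in> padic_numbers"
    unfolding padic_numbers_def closure_iff_pabs
  proof (intro allI impI)
    fix \<epsilon> :: real assume "0 < \<epsilon>"
    then obtain r where "r \<in> \<rat>" "pabs (x - r) < \<epsilon>"
      using ax by metis
    then show "\<exists>t\<in>\<rat>. pabs (- x - t) < \<epsilon>"
      using pabs_minus[of "x - r"] by (intro bexI[of _ "- r"]) (auto simp: algebra_simps)
  qed
  show "inverse x \<in> padic_numbers"
  proof (cases "x = 0")
    case False
    show ?thesis
      unfolding padic_numbers_def closure_iff_pabs
    proof (intro allI impI)
      fix \<epsilon> :: real assume "0 < \<epsilon>"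
      obtain r where r: "r \<in> \<rat>" "pabs (x - r) < min (pabs x) (\<epsilon> * (pabs x * pabs x))"
        using ax[of "min (pabs x) (\<epsilon> * (pabs x * pabs x))"] \<open>0 < \<epsilon>\<close> False by auto
      have rx: "pabs r = pabs x"
        using r(2) by (intro pabs_eq_if_close) auto
      then have "r \<noteq> 0"
        using False by auto
      then have "inverse x - inverse r = - ((x - r) / (x * r))"
        using False by (simp add: field_simps)
      then have "pabs (inverse x - inverse r) = pabs (x - r) / (pabs x * pabs x)"
        by (simp only: pabs_minus pabs_divide pabs_mult rx)
      also have "\<dots> < \<epsilon>"
        using r(2) False by (simp add: pos_divide_less_eq)
      finally show "\<exists>t\<in>\<rat>. pabs (inverse x - t) < \<epsilon>"
        using r by (intro bexI[of _ "inverse r"]) auto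
    qed
  qed (use x in auto)
next
  have "(\<rat> :: 'k set) \<subseteq> padic_numbers"
    by (simp add: padic_numbers_def closure_subset)
  then show "(0::'k) \<in> padic_numbers" "(1::'k) \<in> padic_numbers"
    using Rats_0 Rats_1 by blast+
qed

lemma Rats_subset_padic: "(\<rat> :: 'k set) \<subseteq> padic_numbers"
  by (simp add: padic_numbers_def closure_subset)

lemma subfield_closed:
  assumes "is_subfield L"
  shows "0 \<in> L" "1 \<in> L" "x \<in> L \<Longrightarrow> y \<in> L \<Longrightarrow> x + y \<in> L" "x \<in> L \<Longrightarrow> y \<in> L \<Longrightarrow> x * y \<in> L"
    "x \<in> L \<Longrightarrow> - x \<in> L" "x \<in> L \<Longrightarrow> inverse x \<in> L" "x \<in> L \<Longrightarrow> y \<in> L \<Longrightarrow> x - y \<in> L"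
    "x \<in> L \<Longrightarrow> y \<in> L \<Longrightarrow> x / y \<in> L"
proof -
  show "x \<in> L \<Longrightarrow> y \<in> L \<Longrightarrow> x - y \<in> L"
    using assms unfolding is_subfield_def by (metis add_uminus_conv_diff)
  show "x \<in> L \<Longrightarrow> y \<in> L \<Longrightarrow> x / y \<in> L"
    using assms unfolding is_subfield_def by (metis divide_inverse)
qed (use assms in \<open>auto simp: is_subfield_def\<close>)

lemmas padic_closed = subfield_closed[OF is_subfield_padic]
lemmas Qq_closed = subfield_closed[OF subfield_Qq]

lemma Qq_power: "x \<in> Qq \<Longrightarrow> x ^ n \<in> Qq"
  by (induction n) (auto intro: Qq_closed)

abbreviation Zq :: "'k set" where
  "Zq \<equiv> valuation_ring Qq"

abbreviation Zp :: "'k set" where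
  "Zp \<equiv> valuation_ring padic_numbers"

lemma Zq_iff: "x \<in> Zq \<longleftrightarrow> x \<in> Qq \<and> pabs x \<le> 1"
  by (simp add: valuation_ring_def)

lemma Zp_iff: "x \<in> Zp \<longleftrightarrow> x \<in> padic_numbers \<and> pabs x \<le> 1"
  by (simp add: valuation_ring_def)

lemma Zp_subset_Zq: "Zp \<subseteq> Zq"
  using Qp_subset_Qq by (auto simp: valuation_ring_def)

lemma Zq_0 [simp]: "0 \<in> Zq" and Zq_1 [simp]: "1 \<in> Zq"
  by (simp_all add: Zq_iff Qq_closed)

lemma Zq_add: "x \<in> Zq \<Longrightarrow> y \<in> Zq \<Longrightarrow> x + y \<in> Zq"
  by (simp add: Zq_iff Qq_closed pabs_add_le)

lemma Zq_diff: "x \<in> Zq \<Longrightarrow> y \<in> Zq \<Longrightarrow> x - y \<in> Zq"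
  by (simp add: Zq_iff Qq_closed pabs_diff_le)

lemma Zq_minus: "x \<in> Zq \<Longrightarrow> - x \<in> Zq"
  by (simp add: Zq_iff Qq_closed)

lemma Zq_mult: "x \<in> Zq \<Longrightarrow> y \<in> Zq \<Longrightarrow> x * y \<in> Zq"
  by (simp add: Zq_iff Qq_closed pabs_mult_le_1)

lemma Zq_power: "x \<in> Zq \<Longrightarrow> x ^ n \<in> Zq"
  by (simp add: Zq_iff Qq_power pabs_power_le_1)

lemma Zq_sum: "(\<And>i. i \<in> I \<Longrightarrow> f i \<in> Zq) \<Longrightarrow> (\<Sum>i\<in>I. f i) \<in> Zq"
  by (induction I rule: infinite_finite_induct) (auto intro: Zq_add)

lemma Zq_of_nat: "of_nat n \<in> Zq"
  using Zp_subset_Zq Rats_subset_padic by (auto simp: Zp_iff pabs_of_nat_le_1 subset_iff)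

text \<open>The value group is that of Q_p, so no value lies strictly between 1/p and 1.
  Approximations in \<open>Qq\<close> therefore improve by a full factor p.\<close>

lemma Zq_discrete:
  assumes "x \<in> Qq" "pabs x < 1"
  shows "pabs x \<le> 1 / real p"
proof (cases "x = 0")
  case False
  then obtain n :: int where n: "pabs x = real p powi n"
    using unramified_Qq assms by blast
  have "n < 0"
    using assms(2) p_gt_1 by (metis n not_le one_le_power_int less_imp_le)
  then have "real p powi n \<le> real p powi (-1)"
    using p_gt_1 by (intro power_int_increasing) auto
  then show ?thesis
    by (simp add: n power_int_minus divide_inverse)
qed simp

lemma padic_residue:
  assumes "x \<in> Zp"
  obtains n :: nat where "n < p" "pabs (x - of_nat n) \<le> 1 / real p"
proof -
  obtain r where r: "r \<in> \<rat>" "pabs (x - r) < 1 / real p"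
  proof -
    have "x \<in> padic_numbers"
      using assms by (simp add: Zp_iff)
    then have "x \<in> closure \<rat>"
      by (simp add: padic_numbers_def)
    then show thesis
      using that p_gt_0 unfolding closure_iff_pabs
      by (meson divide_pos_pos of_nat_0_less_iff zero_less_one)
  qed
  have "pabs (x - r) \<le> 1"
    using r(2) inverse_p_less_1 by linarith
  then have "pabs r \<le> 1"
    using pabs_diff_le[of x 1 "x - r"] assms by (simp add: Zp_iff)
  then obtain n where "n < p" "pabs (r - of_nat n) \<le> 1 / real p"
    using rational_residue r(1) by blast
  then show thesis
    using that[of n] pabs_add_le[of "x - r" "1 / real p" "r - of_nat n"] r(2) by simp
qed

text \<open>By the ultrametric inequality a bound on consecutive differences bounds all later ones,
  so the rate passes to the limit without summing a series.\<close>

lemma geometric_Cauchy_limit: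
  fixes s :: "nat \<Rightarrow> 'k"
  assumes "\<And>n. pabs (s (Suc n) - s n) \<le> (1 / real p) ^ n"
  obtains x where "\<And>n. pabs (x - s n) \<le> (1 / real p) ^ n"
proof -
  have le: "pabs (s (n + k) - s n) \<le> (1 / real p) ^ n" for n k
  proof (induction k)
    case (Suc k)
    have "pabs (s (Suc (n + k)) - s (n + k)) \<le> (1 / real p) ^ (n + k)"
      using assms .
    also have "\<dots> \<le> (1 / real p) ^ n"
      using p_gt_1 by (intro power_decreasing) auto
    finally show ?case
      using pabs_add_le[OF _ Suc, of "s (Suc (n + k)) - s (n + k)"] by simp
  qed simp
  have "Cauchy s"
    unfolding Cauchy_altdef
  proof (intro allI impI)
    fix \<epsilon> :: real assume "0 < \<epsilon>"
    then obtain n where n: "(1 / real p) ^ n < \<epsilon>"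
      using inverse_power_less by blast
    have "dist (s m) (s k) < \<epsilon>" if "n \<le> m" "m < k" for m k
    proof -
      have "pabs (s m - s k) \<le> (1 / real p) ^ m"
        using le[of m "k - m"] that by (simp add: pabs_diff_commute)
      also have "\<dots> \<le> (1 / real p) ^ n"
        using p_gt_1 that by (intro power_decreasing) auto
      finally show ?thesis
        using n by (simp add: dist_eq_pabs)
    qed
    then show "\<exists>M. \<forall>m\<ge>M. \<forall>n>m. dist (s m) (s n) < \<epsilon>"
      by blast
  qed
  then obtain x where x: "s \<longlonglongrightarrow> x"
    by (meson Cauchy_convergent convergentD)
  have "pabs (x - s n) \<le> (1 / real p) ^ n" for n
  proof -
    have "eventually (\<lambda>k. dist (s k) x < (1 / real p) ^ n) sequentially"
      using x p_gt_0 by (intro tendstoD) auto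
    then obtain N where N: "\<And>k. N \<le> k \<Longrightarrow> dist (s k) x < (1 / real p) ^ n"
      unfolding eventually_sequentially by blast
    have "pabs (x - s (n + N)) \<le> (1 / real p) ^ n"
      using N[of "n + N"] by (simp add: dist_eq_pabs pabs_diff_commute)
    from pabs_add_le[OF this le[of n N]] show ?thesis
      by simp
  qed
  then show thesis
    using that by blast
qed

lemma pabs_zero_if_le_powers:
  assumes "\<And>n. pabs (x::'k) \<le> (1 / real p) ^ n"
  shows "x = 0"
proof (rule ccontr)
  assume "x \<noteq> 0"
  then obtain n where "(1 / real p) ^ n < pabs x"
    using inverse_power_less[of "pabs x"] by auto
  then show False
    using assms[of n] by simp
qed

section \<open>The residue field\<close>

text \<open>Linear independence over F_p of the residues, expressed by lifts: a relation that
  vanishes modulo the maximal ideal has all its coefficients there.\<close>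

definition res_indep :: "(nat \<Rightarrow> 'k) \<Rightarrow> nat \<Rightarrow> bool" where
  "res_indep e n \<longleftrightarrow> (\<forall>i<n. e i \<in> Zq) \<and>
     (\<forall>c. (\<forall>i<n. c i \<in> Zp) \<and> pabs (\<Sum>i<n. c i * e i) < 1 \<longrightarrow> (\<forall>i<n. pabs (c i) < 1))"

text \<open>More elements than the degree satisfy a relation over Q_p; dividing it by its largest
  coefficient makes it integral with a unit coefficient, which residual independence
  forbids.\<close>

lemma res_indep_le_degree:
  assumes "res_indep e n"
  shows "n \<le> a"
proof (rule ccontr)
  assume "\<not> n \<le> a"
  obtain b where b': "(\<forall>i<a. b i \<in> Qq) \<and>
      (\<forall>x\<in>Qq. \<exists>!c. c \<in> {..<a} \<rightarrow>\<^sub>E padic_numbers \<and> x = (\<Sum>i<a. c i * b i))"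
    using degree_Qq unfolding has_degree_def ..
  note b = bspec[OF conjunct2[OF b']]
  have "\<exists>c. (\<forall>i\<in>{..<a}. c i \<in> padic_numbers) \<and> e j = (\<Sum>i\<in>{..<a}. c i * b i)" if "j \<in> {..<n}" for j
  proof -
    have "e j \<in> Qq"
      using assms that by (auto simp: res_indep_def Zq_iff)
    from ex1_implies_ex[OF b[OF this]] show ?thesis
      by (auto simp: PiE_iff)
  qed
  then obtain v where v: "\<forall>j<n. v j \<in> padic_numbers" "\<exists>j<n. v j \<noteq> 0" "(\<Sum>j<n. v j * e j) = 0"
    using subfield_dependent[OF is_subfield_padic, of "{..<a}" "{..<n}" e b] \<open>\<not> n \<le> a\<close>
    by auto
  have "Max ((\<lambda>j. pabs (v j)) ` {..<n}) \<in> (\<lambda>j. pabs (v j)) ` {..<n}"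
    using v(2) by (intro Max_in) auto
  then obtain m where m: "m < n" "Max ((\<lambda>j. pabs (v j)) ` {..<n}) = pabs (v m)"
    by auto
  have m_max: "pabs (v j) \<le> pabs (v m)" if "j < n" for j
    using that m(2)[symmetric] by simp
  have vm: "v m \<noteq> 0"
    using v(2) m_max by (metis pabs_eq_0_iff pabs_nonneg order_antisym)
  have "(\<Sum>j<n. v j / v m * e j) = (\<Sum>j<n. v j * e j) / v m"
    by (simp add: sum_divide_distrib)
  then have "(\<Sum>j<n. v j / v m * e j) = 0"
    using v(3) by simp
  then have "pabs (\<Sum>j<n. v j / v m * e j) < 1"
    by simp
  moreover have "\<forall>j<n. v j / v m \<in> Zp"
    using v(1) m m_max vm by (auto simp: Zp_iff padic_closed pabs_divide divide_le_eq_1)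
  ultimately have "\<forall>j<n. pabs (v j / v m) < 1"
    using assms spec[of _ "\<lambda>j. v j / v m"] unfolding res_indep_def by blast
  then have "pabs (v m / v m) < 1"
    using m(1) by blast
  then show False
    using vm by simp
qed

text \<open>
  Lifts of a basis of the residue field form a \<open>Z\<^sub>p\<close>-basis of \<open>Z\<^sub>q\<close>, by successive approximation;
  this is where the extension being unramified enters.
\<close>

lemma residue_basis:
  obtains e where "res_indep e a"
    "\<And>x. x \<in> Zq \<Longrightarrow> \<exists>n. (\<forall>i<a. n i < p) \<and> pabs (x - (\<Sum>i<a. of_nat (n i) * e i)) \<le> 1 / real p"
    "\<And>x. x \<in> closure Qq \<Longrightarrow> pabs x \<le> 1 \<Longrightarrow> x \<in> Qq"
proof -
  have "res_indep e 0" for e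
    by (simp add: res_indep_def)
  \<comment> \<open>A family of maximal length exists because the degree bounds the length.
    Maximality makes it span the residue field, from which f = a follows.\<close>
  then obtain f where "\<exists>e. res_indep e f" and f_max: "\<And>g. \<exists>e. res_indep e g \<Longrightarrow> g \<le> f"
    using GreatestI_nat[of "\<lambda>n. \<exists>e. res_indep e n" 0 a] Greatest_le_nat[of "\<lambda>n. \<exists>e. res_indep e n" _ a]
      res_indep_le_degree by blast
  then obtain e where e: "res_indep e f"
    by blast
  have e_Zq: "e i \<in> Zq" if "i < f" for i
    using e that by (simp add: res_indep_def)
  have digits: "\<exists>n. (\<forall>i<f. n i < p) \<and> pabs (x - (\<Sum>i<f. of_nat (n i) * e i)) \<le> 1 / real p"
    if x: "x \<in> Zq" for x
  proof -
    define e' where "e' = e(f := x)"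
    have "\<not> res_indep e' (Suc f)"
      using f_max by fastforce
    moreover have "\<forall>i<Suc f. e' i \<in> Zq"
      using e_Zq x by (auto simp: e'_def less_Suc_eq)
    ultimately obtain c where c: "\<forall>i<Suc f. c i \<in> Zp" "pabs (\<Sum>i<Suc f. c i * e' i) < 1"
      "\<exists>i<Suc f. \<not> pabs (c i) < 1"
      unfolding res_indep_def by blast
    have sum: "(\<Sum>i<Suc f. c i * e' i) = (\<Sum>i<f. c i * e i) + c f * x"
      by (auto simp: e'_def intro!: sum.cong)
    \<comment> \<open>Were this coefficient small, the relation would already hold residually among
      the old elements. Being a unit, it can be divided out to express x.\<close>
    have "pabs (c f) = 1"
    proof (rule ccontr)
      assume "pabs (c f) \<noteq> 1"
      then have cf: "pabs (c f) < 1"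
        using c(1) by (auto simp: Zp_iff less_le)
      then have "pabs (c f * x) < 1"
        using x by (auto simp: Zq_iff pabs_mult intro: le_less_trans[OF mult_left_le])
      from pabs_diff_less[OF c(2) this] have "pabs (\<Sum>i<f. c i * e i) < 1"
        by (simp only: sum add_diff_cancel_right')
      then have "\<forall>i<f. pabs (c i) < 1"
        using e c(1) unfolding res_indep_def by auto
      then show False
        using c(3) cf less_Suc_eq by auto
    qed
    then have cf: "c f \<noteq> 0"
      by auto
    have "- (c i / c f) \<in> Zp" if "i < f" for i
      using c(1) that \<open>pabs (c f) = 1\<close> by (auto simp: Zp_iff pabs_divide padic_closed)
    then have "\<exists>n. i < f \<longrightarrow> n < p \<and> pabs (- (c i / c f) - of_nat n) \<le> 1 / real p" for i
      using padic_residue by metis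
    then obtain n where n: "\<And>i. i < f \<Longrightarrow> n i < p" "\<And>i. i < f \<Longrightarrow> pabs (- (c i / c f) - of_nat (n i)) \<le> 1 / real p"
      by metis
    let ?y = "x - (\<Sum>i<f. of_nat (n i) * e i)"
    have "?y = (\<Sum>i<Suc f. c i * e' i) / c f + (\<Sum>i<f. (- (c i / c f) - of_nat (n i)) * e i)"
    proof -
      have "(\<Sum>i<f. (- (c i / c f) - of_nat (n i)) * e i) = - ((\<Sum>i<f. c i * e i) / c f) - (\<Sum>i<f. of_nat (n i) * e i)"
        by (simp add: sum_subtractf sum_negf sum_divide_distrib left_diff_distrib)
      then show ?thesis
        unfolding sum using cf by (simp add: add_divide_distrib)
    qed
    moreover have "pabs ((\<Sum>i<Suc f. c i * e' i) / c f) < 1"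
      using c(2) \<open>pabs (c f) = 1\<close> by (simp only: pabs_divide div_by_1)
    moreover have "pabs (\<Sum>i<f. (- (c i / c f) - of_nat (n i)) * e i) < 1"
    proof (rule pabs_sum_less)
      fix i assume "i \<in> {..<f}"
      then have "pabs ((- (c i / c f) - of_nat (n i)) * e i) \<le> 1 / real p * 1"
        using n(2)[of i] e_Zq[of i] by (intro pabs_mult_le) (auto simp: Zq_iff)
      also have "\<dots> < 1"
        using p_gt_1 by simp
      finally show "pabs ((- (c i / c f) - of_nat (n i)) * e i) < 1" .
    qed simp
    ultimately have "pabs ?y < 1"
      by (simp only: pabs_add_less)
    moreover have "?y \<in> Zq"
      using x e_Zq by (intro Zq_diff Zq_sum Zq_mult Zq_of_nat) auto
    ultimately have "pabs ?y \<le> 1 / real p"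
      by (simp add: Zq_discrete Zq_iff)
    with n(1) show ?thesis
      by blast
  qed
  \<comment> \<open>Limits of \<open>Qq\<close> are included, since a close element of
    \<open>Qq\<close> supplies the digit. So integral limits of \<open>Qq\<close> turn out to lie in
    \<open>Qq\<close>, as Teichmueller representatives require.\<close>
  have span: "\<exists>c. (\<forall>i<f. c i \<in> padic_numbers) \<and> x = (\<Sum>i<f. c i * e i)"
    if x: "x \<in> closure Qq" "pabs x \<le> 1" for x
  proof -
    have "\<exists>n. (\<forall>i<f. n i < p) \<and> (y - (\<Sum>i<f. of_nat (n i) * e i)) / of_nat p \<in> closure Qq \<and>
        pabs ((y - (\<Sum>i<f. of_nat (n i) * e i)) / of_nat p) \<le> 1"
      if y: "y \<in> closure Qq" "pabs y \<le> 1" for y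
    proof -
      obtain y' where y': "y' \<in> Qq" "pabs (y - y') < 1 / real p"
        using y(1) p_gt_0 unfolding closure_iff_pabs by (meson divide_pos_pos of_nat_0_less_iff zero_less_one)
      have "pabs (y - y') \<le> 1"
        using y'(2) inverse_p_less_1 by linarith
      from pabs_diff_le[OF y(2) this] have "y' \<in> Zq"
        using y'(1) by (simp add: Zq_iff)
      then obtain n where n: "\<forall>i<f. n i < p" "pabs (y' - (\<Sum>i<f. of_nat (n i) * e i)) \<le> 1 / real p"
        using digits by blast
      let ?s = "\<Sum>i<f. of_nat (n i) * e i"
      have "pabs (y - ?s) \<le> 1 / real p"
        using pabs_add_le[OF less_imp_le[OF y'(2)] n(2)] by simp
      then have "pabs ((y - ?s) / of_nat p) \<le> 1"
        using p_gt_0 by (simp add: pabs_divide pabs_p field_simps)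
      moreover have "(y - ?s) / of_nat p \<in> closure Qq"
        unfolding closure_iff_pabs
      proof (intro allI impI)
        fix \<epsilon> :: real assume "0 < \<epsilon>"
        then obtain z where z: "z \<in> Qq" "pabs (y - z) < \<epsilon> / real p"
          using y(1) p_gt_0 unfolding closure_iff_pabs by (meson divide_pos_pos of_nat_0_less_iff)
        have "?s \<in> Qq"
          using e_Zq by (metis (no_types, lifting) Zq_iff Zq_mult Zq_of_nat Zq_sum lessThan_iff)
        moreover have "(y - ?s) / of_nat p - (z - ?s) / of_nat p = (y - z) / of_nat p"
          by (simp add: diff_divide_distrib)
        ultimately show "\<exists>z\<in>Qq. pabs ((y - ?s) / of_nat p - z) < \<epsilon>"
          using z p_gt_0 Zq_of_nat[of p]
          by (intro bexI[of _ "(z - ?s) / of_nat p"])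
             (simp_all add: pabs_divide pabs_p field_simps Qq_closed Zq_iff)
      qed
      ultimately show ?thesis
        using n(1) by blast
    qed
    then obtain N where N: "\<And>y. y \<in> closure Qq \<Longrightarrow> pabs y \<le> 1 \<Longrightarrow> (\<forall>i<f. N y i < p) \<and>
        (y - (\<Sum>i<f. of_nat (N y i) * e i)) / of_nat p \<in> closure Qq \<and>
        pabs ((y - (\<Sum>i<f. of_nat (N y i) * e i)) / of_nat p) \<le> 1"
      by metis
    \<comment> \<open>\<open>X k\<close> is the remainder after k digits have been split off and k
      factors p divided out; \<open>N\<close> chooses the digits, and \<open>s\<close> collects them
      for each basis element.\<close>
    define X where "X = rec_nat x (\<lambda>_ y. (y - (\<Sum>i<f. of_nat (N y i) * e i)) / of_nat p)"
    have X_simps: "X 0 = x" "X (Suc k) = (X k - (\<Sum>i<f. of_nat (N (X k) i) * e i)) / of_nat p" for k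
      by (simp_all add: X_def)
    have X: "X k \<in> closure Qq \<and> pabs (X k) \<le> 1" for k
    proof (induction k)
      case (Suc k)
      then show ?case
        unfolding X_simps using N by blast
    qed (use x in \<open>simp add: X_simps\<close>)
    define s where "s i K = (\<Sum>k<K. of_nat (N (X k) i) * of_nat p ^ k :: 'k)" for i K
    have x_eq: "x = (\<Sum>i<f. s i K * e i) + of_nat p ^ K * X K" for K
    proof (induction K)
      case (Suc K)
      have "of_nat p ^ Suc K * X (Suc K) = of_nat p ^ K * (X K - (\<Sum>i<f. of_nat (N (X K) i) * e i))"
        using p_gt_0 by (simp add: X_simps(2))
      moreover have "(\<Sum>i<f. s i (Suc K) * e i) =
          (\<Sum>i<f. s i K * e i) + of_nat p ^ K * (\<Sum>i<f. of_nat (N (X K) i) * e i)"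
        by (simp add: s_def sum_distrib_left sum.distrib algebra_simps)
      ultimately show ?case
        using Suc by (simp add: algebra_simps)
    qed (simp add: s_def X_simps(1))
    have "\<exists>c. \<forall>K. pabs (c - s i K) \<le> (1 / real p) ^ K" for i
    proof -
      have "pabs (s i (Suc K) - s i K) \<le> (1 / real p) ^ K" for K
        using mult_right_mono[OF pabs_of_nat_le_1[of "N (X K) i"], of "(1 / real p) ^ K"]
        by (simp add: s_def pabs_mult pabs_power pabs_p)
      then show ?thesis
        using geometric_Cauchy_limit[of "s i"] by metis
    qed
    then obtain c where c: "\<And>i K. pabs (c i - s i K) \<le> (1 / real p) ^ K"
      by metis
    have "c i \<in> padic_numbers" for i
      unfolding padic_numbers_def closure_iff_pabs
    proof (intro allI impI)
      fix \<epsilon> :: real assume "0 < \<epsilon>"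
      then obtain K where "(1 / real p) ^ K < \<epsilon>"
        using inverse_power_less by blast
      moreover have "s i K \<in> \<rat>"
        by (auto simp: s_def intro!: Rats_sum Rats_mult Rats_power)
      ultimately show "\<exists>r\<in>\<rat>. pabs (c i - r) < \<epsilon>"
        using c[of i K] by (intro bexI[of _ "s i K"]) auto
    qed
    moreover have "x - (\<Sum>i<f. c i * e i) = 0"
    proof (rule pabs_zero_if_le_powers)
      fix K
      have "x - (\<Sum>i<f. c i * e i) = of_nat p ^ K * X K - (\<Sum>i<f. (c i - s i K) * e i)"
        by (subst x_eq[of K]) (simp add: sum_subtractf left_diff_distrib)
      also have "pabs \<dots> \<le> (1 / real p) ^ K"
      proof (intro pabs_diff_le pabs_sum_le)
        show "pabs (of_nat p ^ K * X K) \<le> (1 / real p) ^ K"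
          using mult_left_mono[of "pabs (X K)" 1 "(1 / real p) ^ K"] X[of K]
          by (simp add: pabs_mult pabs_power pabs_p)
        show "pabs ((c i - s i K) * e i) \<le> (1 / real p) ^ K" if "i \<in> {..<f}" for i
          using pabs_mult_le[OF c, of "e i" 1 i K] e_Zq[of i] that by (simp add: Zq_iff)
      qed simp
      finally show "pabs (x - (\<Sum>i<f. c i * e i)) \<le> (1 / real p) ^ K" .
    qed
    ultimately show ?thesis
      by (intro exI[of _ c]) simp
  qed
  \<comment> \<open>Otherwise the given Q_p-basis would be spanned by fewer elements, and 0 would
    have two expansions in it.\<close>
  have "a \<le> f"
  proof (rule ccontr)
    assume "\<not> a \<le> f"
    obtain b where b': "(\<forall>i<a. b i \<in> Qq) \<and>
        (\<forall>x\<in>Qq. \<exists>!c. c \<in> {..<a} \<rightarrow>\<^sub>E padic_numbers \<and> x = (\<Sum>i<a. c i * b i))"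
      using degree_Qq unfolding has_degree_def ..
    note b = mp[OF spec[OF conjunct1[OF b']]] bspec[OF conjunct2[OF b']]
    have "\<exists>c. (\<forall>i\<in>{..<f}. c i \<in> padic_numbers) \<and> b j = (\<Sum>i\<in>{..<f}. c i * e i)" if "j \<in> {..<a}" for j
    proof -
      obtain m where m: "pabs (b j) < real p ^ m"
        using real_arch_pow p_gt_1 by blast
      have "pabs (of_nat p ^ m * b j) \<le> 1"
        using m p_gt_0 by (simp add: pabs_mult pabs_power pabs_p field_simps)
      moreover have pm: "(of_nat p ^ m :: 'k) \<in> padic_numbers"
        using Rats_subset_padic Rats_power[OF Rats_of_nat, of p m] by blast
      have "of_nat p ^ m * b j \<in> Qq"
        using Qq_closed(4)[OF subsetD[OF Qp_subset_Qq pm] b(1)] that by simp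
      then have "of_nat p ^ m * b j \<in> closure Qq"
        using closure_subset[of Qq] by blast
      ultimately obtain c where c: "\<forall>i<f. c i \<in> padic_numbers" "of_nat p ^ m * b j = (\<Sum>i<f. c i * e i)"
        using span by blast
      have "b j = (\<Sum>i<f. c i / of_nat p ^ m * e i)"
        using c(2) p_gt_0 by (simp add: field_simps flip: sum_divide_distrib)
      then show ?thesis
        using c(1) pm by (intro exI[of _ "\<lambda>i. c i / of_nat p ^ m"]) (auto intro: padic_closed)
    qed
    then obtain v where v: "\<forall>j<a. v j \<in> padic_numbers" "\<exists>j<a. v j \<noteq> 0" "(\<Sum>j<a. v j * b j) = 0"
      using subfield_dependent[OF is_subfield_padic, of "{..<f}" "{..<a}" b e] \<open>\<not> a \<le> f\<close> by auto
    have "restrict v {..<a} \<in> {..<a} \<rightarrow>\<^sub>E padic_numbers \<and> 0 = (\<Sum>i<a. restrict v {..<a} i * b i)"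
      using v by auto
    moreover have "(\<lambda>i\<in>{..<a}. 0::'k) \<in> {..<a} \<rightarrow>\<^sub>E padic_numbers \<and> 0 = (\<Sum>i<a. (\<lambda>i\<in>{..<a}. 0) i * b i)"
      using padic_closed(1) by auto
    ultimately have "restrict v {..<a} = (\<lambda>i\<in>{..<a}. 0)"
      using b(2)[OF Qq_closed(1)] by blast
    then show False
      using v(2) by (metis lessThan_iff restrict_apply')
  qed
  moreover have "f \<le> a"
    using e res_indep_le_degree by blast
  ultimately have fa: "f = a"
    by simp
  show thesis
  proof (rule that[of e])
    show "x \<in> Qq" if "x \<in> closure Qq" "pabs x \<le> 1" for x
    proof -
      obtain c where c: "\<forall>i<f. c i \<in> padic_numbers" "x = (\<Sum>i<f. c i * e i)"
        using span[OF \<open>x \<in> closure Qq\<close> \<open>pabs x \<le> 1\<close>] by blast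
      have "(\<Sum>i\<in>I. c i * e i) \<in> Qq" if "I \<subseteq> {..<f}" for I
        using finite_subset[OF that finite_lessThan] that
      proof (induction I rule: finite_induct)
        case (insert i I)
        then show ?case
          using c(1) e_Zq[of i] Qp_subset_Qq by (auto simp: Zq_iff intro!: Qq_closed)
      qed (auto intro: Qq_closed)
      then show ?thesis
        using c(2) by blast
    qed
  qed (use e digits fa in auto)
qed

text \<open>The digit combinations of a residue basis serve as representatives: independence
  separates them, as digits below p that agree modulo p are equal. In effect the residue field has
  p^a elements.\<close>

lemma residue_system:
  "\<exists>R. finite R \<and> card R = p ^ a \<and> R \<subseteq> Zq \<and> (\<forall>x\<in>Zq. \<exists>!r. r \<in> R \<and> pabs (x - r) < 1)"
proof -
  obtain e where e: "res_indep e a"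
    and digits: "\<And>x. x \<in> Zq \<Longrightarrow> \<exists>n. (\<forall>i<a. n i < p) \<and> pabs (x - (\<Sum>i<a. of_nat (n i) * e i)) \<le> 1 / real p"
    using residue_basis by metis
  define N where "N = {..<a} \<rightarrow>\<^sub>E {..<p}"
  define h where "h n = (\<Sum>i<a. of_nat (n i) * e i)" for n
  have h_close: "n = n'" if "n \<in> N" "n' \<in> N" "pabs (h n - h n') < 1" for n n'
  proof (rule PiE_ext)
    show "n \<in> {..<a} \<rightarrow>\<^sub>E {..<p}" "n' \<in> {..<a} \<rightarrow>\<^sub>E {..<p}"
      using that by (simp_all add: N_def)
    fix i assume "i \<in> {..<a}"
    define c where "c i = (of_nat (n i) - of_nat (n' i) :: 'k)" for i
    have "c i \<in> padic_numbers" for i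
      using Rats_subset_padic by (auto simp: c_def)
    then have "\<forall>i<a. c i \<in> Zp"
      by (auto simp: Zp_iff c_def pabs_of_nat_le_1 intro: pabs_diff_le)
    moreover have "h n - h n' = (\<Sum>i<a. c i * e i)"
      by (simp add: h_def c_def sum_subtractf left_diff_distrib)
    ultimately have "pabs (c i) < 1"
      using e that(3) \<open>i \<in> {..<a}\<close> unfolding res_indep_def by auto
    have small: "k = 0" if "pabs (of_nat k :: 'k) < 1" "k < p" for k
      using that by (metis dvd_imp_le not_le not_gr_zero pabs_of_nat_less_1_iff)
    have bnd: "n i < p" "n' i < p"
      using that \<open>i \<in> {..<a}\<close> by (auto simp: N_def)
    show "n i = n' i"
    proof (cases "n' i \<le> n i")
      case True
      have "pabs (of_nat (n i - n' i) :: 'k) < 1"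
        using True \<open>pabs (c i) < 1\<close> by (simp add: c_def of_nat_diff)
      from small[OF this] show ?thesis
        using True bnd by auto
    next
      case False
      have "pabs (of_nat (n' i - n i) :: 'k) < 1"
        using False \<open>pabs (c i) < 1\<close> by (simp add: c_def of_nat_diff pabs_diff_commute[of "of_nat (n i)"])
      from small[OF this] show ?thesis
        using False bnd less_imp_diff_less by auto
    qed
  qed
  have "inj_on h N"
    using h_close by (intro inj_onI) auto
  then have "card (h ` N) = p ^ a"
    by (simp add: card_image N_def card_PiE)
  moreover have "finite (h ` N)"
    by (simp add: N_def finite_PiE)
  moreover have "h ` N \<subseteq> Zq"
    using e by (auto simp: h_def res_indep_def intro!: Zq_sum Zq_mult Zq_of_nat)
  moreover have "\<forall>x\<in>Zq. \<exists>!r. r \<in> h ` N \<and> pabs (x - r) < 1"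
  proof
    fix x assume "x \<in> Zq"
    show "\<exists>!r. r \<in> h ` N \<and> pabs (x - r) < 1"
  proof -
    obtain n where n: "\<forall>i<a. n i < p" "pabs (x - h n) \<le> 1 / real p"
      using digits[OF \<open>x \<in> Zq\<close>] unfolding h_def by blast
    have "pabs (x - h n) < 1"
      using n(2) inverse_p_less_1 by linarith
    moreover have "h (restrict n {..<a}) = h n" "restrict n {..<a} \<in> N"
      using n(1) by (auto simp: h_def N_def)
    ultimately have ex: "h n \<in> h ` N \<and> pabs (x - h n) < 1"
      by (metis image_eqI)
    show ?thesis
    proof (rule ex1I[where a = "h n"])
      show "h n \<in> h ` N \<and> pabs (x - h n) < 1"
        by (fact ex)
    next
      fix r assume r: "r \<in> h ` N \<and> pabs (x - r) < 1"
      then have "pabs (r - h n) < 1"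
        using pabs_diff_less[of "x - h n" 1 "x - r"] ex by simp
      moreover obtain m where "m \<in> N" "r = h m"
        using r by auto
      moreover obtain m' where "m' \<in> N" "h n = h m'"
        using ex by auto
      ultimately show "r = h n"
        using h_close[of m m'] by simp
    qed
  qed
  qed
  ultimately show ?thesis
    by blast
qed

lemma pabs_prod_diff_less:
  assumes "finite I" "\<And>i. i \<in> I \<Longrightarrow> pabs (f i :: 'k) \<le> 1" "\<And>i. i \<in> I \<Longrightarrow> pabs (g i) \<le> 1"
    "\<And>i. i \<in> I \<Longrightarrow> pabs (f i - g i) < 1"
  shows "pabs ((\<Prod>i\<in>I. f i) - (\<Prod>i\<in>I. g i)) < 1"
  using assms
proof (induction I rule: finite_induct)
  case (insert i I)
  have "(\<Prod>i\<in>insert i I. f i) - (\<Prod>i\<in>insert i I. g i) =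
      (f i - g i) * (\<Prod>i\<in>I. f i) + g i * ((\<Prod>i\<in>I. f i) - (\<Prod>i\<in>I. g i))"
    using insert by (simp add: algebra_simps)
  also have "pabs \<dots> < 1"
  proof (rule pabs_add_less)
    have "pabs (\<Prod>i\<in>I. f i) \<le> 1"
      using insert by (auto simp: pabs_prod intro!: prod_le_1)
    then have "pabs ((f i - g i) * (\<Prod>i\<in>I. f i)) \<le> pabs (f i - g i)"
      by (simp add: pabs_mult mult_left_le)
    then show "pabs ((f i - g i) * (\<Prod>i\<in>I. f i)) < 1"
      using insert.prems(3)[of i] by simp
    have "pabs (g i * ((\<Prod>i\<in>I. f i) - (\<Prod>i\<in>I. g i))) \<le> pabs ((\<Prod>i\<in>I. f i) - (\<Prod>i\<in>I. g i))"
      using insert.prems(2)[of i] by (simp add: pabs_mult mult_left_le_one_le)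
    then show "pabs (g i * ((\<Prod>i\<in>I. f i) - (\<Prod>i\<in>I. g i))) < 1"
      using insert by simp
  qed
  finally show ?case .
qed simp

text \<open>A unit x permutes the nonzero residue classes, so the product of their representatives
  is congruent to x^(q-1) times itself, with q = p^a.\<close>

lemma residue_fermat:
  assumes x: "x \<in> Zq"
  shows "pabs (x ^ (p ^ a) - x) < 1"
proof (cases "pabs x < 1")
  case True
  have "pabs (x ^ (p ^ a)) < 1"
    using True by (simp add: pabs_power power_Suc_less_one power_less_one_iff)
  then show ?thesis
    using True by (intro pabs_diff_less)
next
  case False
  with x have x1: "pabs x = 1"
    by (auto simp: Zq_iff)
  obtain R where R0: "finite R \<and> card R = p ^ a \<and> R \<subseteq> Zq \<and> (\<forall>x\<in>Zq. \<exists>!r. r \<in> R \<and> pabs (x - r) < 1)"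
    using residue_system ..
  note R = conjunct1[OF R0] conjunct1[OF conjunct2[OF R0]] conjunct1[OF conjunct2[OF conjunct2[OF R0]]]
    bspec[OF conjunct2[OF conjunct2[OF conjunct2[OF R0]]]]
  define R' where "R' = {r \<in> R. pabs r = 1}"
  obtain r0 where r0: "r0 \<in> R" "pabs (0 - r0) < 1" "\<And>r. r \<in> R \<Longrightarrow> pabs (0 - r) < 1 \<Longrightarrow> r = r0"
    using R(4)[OF Zq_0] by blast
  have "R' = R - {r0}"
  proof (rule set_eqI)
    fix r
    have "pabs r = 1 \<longleftrightarrow> r \<noteq> r0" if "r \<in> R"
    proof -
      have "pabs r \<le> 1" "r = r0 \<Longrightarrow> pabs r < 1" "pabs r < 1 \<Longrightarrow> r = r0"
        using R(3) that r0(2) r0(3)[OF that] by (auto simp: Zq_iff)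
      then show ?thesis
        by linarith
    qed
    then show "r \<in> R' \<longleftrightarrow> r \<in> R - {r0}"
      unfolding R'_def by blast
  qed
  then have card: "card R' = p ^ a - 1"
    using r0(1) R(1,2) by simp
  obtain \<sigma> where \<sigma>: "\<And>r. r \<in> R' \<Longrightarrow> \<sigma> r \<in> R" "\<And>r. r \<in> R' \<Longrightarrow> pabs (x * r - \<sigma> r) < 1"
  proof -
    have "\<exists>s. r \<in> R' \<longrightarrow> s \<in> R \<and> pabs (x * r - s) < 1" for r
      using R(3) R(4)[of "x * r"] Zq_mult[OF x, of r] by (auto simp: R'_def)
    then show thesis
      using that by metis
  qed
  have unit: "pabs (\<sigma> r) = 1" if "r \<in> R'" for r
    using pabs_eq_if_close[of "x * r" "\<sigma> r"] \<sigma>(2)[OF that] that x1 by (simp add: pabs_mult R'_def)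
  have "inj_on \<sigma> R'"
  proof (rule inj_onI)
    fix r s assume rs: "r \<in> R'" "s \<in> R'" "\<sigma> r = \<sigma> s"
    have "pabs (x * r - x * s) < 1"
      using pabs_diff_less[OF \<sigma>(2)[OF rs(1)] \<sigma>(2)[OF rs(2)]] rs(3) by simp
    then have "pabs (r - s) < 1"
      using x1 by (simp add: pabs_mult flip: right_diff_distrib)
    then have "s \<in> R \<and> pabs (r - s) < 1"
      using rs by (simp add: R'_def)
    moreover have "r \<in> R \<and> pabs (r - r) < 1"
      using rs by (simp add: R'_def)
    moreover have "r \<in> Zq"
      using rs R(3) by (auto simp: R'_def)
    ultimately show "r = s"
      using R(4) by blast
  qed
  moreover have sub: "\<sigma> ` R' \<subseteq> R'"
    using \<sigma>(1) unit by (auto simp: R'_def)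
  moreover have fin: "finite R'"
    using R(1) by (simp add: R'_def)
  ultimately have "\<sigma> ` R' = R'"
    by (simp add: endo_inj_surj)
  then have "(\<Prod>r\<in>R'. \<sigma> r) = \<Prod>R'"
    using \<open>inj_on \<sigma> R'\<close> by (metis prod.reindex_cong)
  moreover have "pabs ((\<Prod>r\<in>R'. x * r) - (\<Prod>r\<in>R'. \<sigma> r)) < 1"
    using \<sigma> unit x1 fin by (intro pabs_prod_diff_less) (auto simp: R'_def pabs_mult)
  ultimately have "pabs ((x ^ (p ^ a - 1) - 1) * \<Prod>R') < 1"
    by (simp add: prod.distrib card left_diff_distrib)
  moreover have "pabs (\<Prod>R') = 1"
    using pabs_prod[of "\<lambda>r. r" R'] by (simp add: R'_def)
  ultimately have "pabs (x * (x ^ (p ^ a - 1) - 1)) < 1"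
    using x1 by (simp add: pabs_mult)
  moreover have "x * x ^ (p ^ a - 1) = x ^ (p ^ a)"
    using p_gt_0 by (metis power_eq_if zero_less_power neq0_conv)
  ultimately show ?thesis
    by (simp add: right_diff_distrib)
qed

text \<open>For d = x - y the mixed terms of (d + y)^p carry a factor p and a factor d, and |d|^p <=
  |d|^2 <= |d|/p. This contraction drives both existence and uniqueness of Teichmueller
  representatives.\<close>

lemma pabs_prime_power_diff:
  assumes "pabs (x::'k) \<le> 1" "pabs y \<le> 1" "pabs (x - y) \<le> 1 / real p"
  shows "pabs (x ^ p - y ^ p) \<le> pabs (x - y) / real p"
proof -
  let ?d = "x - y"
  obtain c :: "nat \<Rightarrow> nat" where
    c: "(?d + y) ^ p = ?d ^ p + y ^ p + of_nat p * (\<Sum>k\<in>{1..<p}. of_nat (c k) * ?d ^ k * y ^ (p - k))"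
    using prime_power_add[OF prime_p] .
  have d1: "pabs ?d \<le> 1"
    using assms pabs_diff_le by blast
  have pw: "pabs (?d ^ k) \<le> pabs ?d" if "1 \<le> k" for k
    using power_decreasing[of 1 k "pabs ?d"] that d1 by (simp add: pabs_power)
  have "pabs (\<Sum>k\<in>{1..<p}. of_nat (c k) * ?d ^ k * y ^ (p - k)) \<le> pabs ?d"
  proof (rule pabs_sum_le)
    fix k assume "k \<in> {1..<p}"
    then have "pabs (of_nat (c k) * ?d ^ k * y ^ (p - k)) \<le> 1 * pabs ?d * 1"
      using pw assms(2) by (intro pabs_mult_le pabs_of_nat_le_1 pabs_power_le_1) auto
    then show "pabs (of_nat (c k) * ?d ^ k * y ^ (p - k)) \<le> pabs ?d"
      by simp
  qed simp
  then have "pabs (of_nat p * (\<Sum>k\<in>{1..<p}. of_nat (c k) * ?d ^ k * y ^ (p - k))) \<le> pabs ?d / real p"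
    by (simp add: pabs_mult pabs_p divide_right_mono)
  moreover have "pabs (?d ^ p) \<le> pabs ?d / real p"
  proof -
    have "pabs (?d ^ p) \<le> pabs ?d ^ 2"
      using power_decreasing[of 2 p "pabs ?d"] p_ge_2 d1 by (simp add: pabs_power)
    also have "\<dots> \<le> pabs ?d * (1 / real p)"
      using mult_left_mono[OF assms(3), of "pabs ?d"] by (simp add: power2_eq_square)
    finally show ?thesis
      by simp
  qed
  ultimately have "pabs (?d ^ p + of_nat p * (\<Sum>k\<in>{1..<p}. of_nat (c k) * ?d ^ k * y ^ (p - k))) \<le> pabs ?d / real p"
    by (rule pabs_add_le[rotated])
  then show ?thesis
    using c by simp
qed

lemma pabs_q_power_diff:
  assumes "pabs (x::'k) \<le> 1" "pabs y \<le> 1" "pabs (x - y) \<le> 1 / real p"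
  shows "pabs (x ^ (p ^ a) - y ^ (p ^ a)) \<le> pabs (x - y) / real p"
proof -
  have q: "p ^ a = p * p ^ (a - 1)"
    using a_ge_1 by (metis One_nat_def Suc_pred power_Suc less_eq_Suc_le)
  have "pabs ((x ^ p) ^ (p ^ (a - 1)) - (y ^ p) ^ (p ^ (a - 1))) \<le> pabs (x ^ p - y ^ p)"
    using assms by (intro pabs_power_diff_le pabs_power_le_1)
  also have "\<dots> \<le> pabs (x - y) / real p"
    using pabs_prime_power_diff[OF assms] .
  finally show ?thesis
    by (simp add: q power_mult)
qed

text \<open>The powers x^(q^n), q = p^a, converge: the first difference is small by Fermat, and each
  further q-th power contracts it by 1/p. The limit is fixed by the q-th power.\<close>

lemma teichmueller_exists:
  assumes x: "x \<in> Zq"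
  obtains z where "z \<in> Zq" "pabs (x - z) < 1" "z ^ (p ^ a) = z"
proof -
  define s where "s n = x ^ ((p ^ a) ^ n)" for n
  have s_Suc: "s (Suc n) = s n ^ (p ^ a)" for n
    by (simp add: s_def power_Suc2 del: power_Suc flip: power_mult)
  have s_Zq: "s n \<in> Zq" for n
    by (simp add: s_def Zq_power x)
  \<comment> \<open>The exponent \<open>Suc n\<close> provides, already at n = 0, the closeness 1/p
    that the contraction presupposes.\<close>
  have step: "pabs (s (Suc n) - s n) \<le> (1 / real p) ^ Suc n" for n
  proof (induction n)
    case 0
    have "x ^ p ^ a - x \<in> Qq"
      using x by (simp add: Zq_iff Qq_closed Qq_power)
    then show ?case
      using Zq_discrete residue_fermat[OF x] by (simp add: s_def)
  next
    case (Suc n)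
    have "(1 / real p) ^ Suc n \<le> (1 / real p) ^ 1"
      using p_gt_1 by (intro power_decreasing) auto
    then have "pabs (s (Suc n) - s n) \<le> 1 / real p"
      using Suc by simp
    then have "pabs (s (Suc n) ^ (p ^ a) - s n ^ (p ^ a)) \<le> pabs (s (Suc n) - s n) / real p"
      using s_Zq by (intro pabs_q_power_diff) (auto simp: Zq_iff)
    also have "\<dots> \<le> (1 / real p) ^ Suc n / real p"
      using Suc by (intro divide_right_mono) auto
    finally show ?case
      by (simp add: s_Suc)
  qed
  have "pabs (s (Suc n) - s n) \<le> (1 / real p) ^ n" for n
    using step[of n] power_decreasing[of n "Suc n" "1 / real p"] p_gt_1 by auto
  then obtain z where z: "\<And>n. pabs (z - s n) \<le> (1 / real p) ^ n"
    using geometric_Cauchy_limit by blast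
  have z1: "pabs z \<le> 1"
    using pabs_add_le[OF _ , of "z - s 0" 1 "s 0"] z[of 0] s_Zq[of 0] by (auto simp: Zq_iff)
  have "z \<in> closure Qq"
    unfolding closure_iff_pabs
  proof (intro allI impI)
    fix \<epsilon> :: real assume "0 < \<epsilon>"
    then obtain K where "(1 / real p) ^ K < \<epsilon>"
      using inverse_power_less by blast
    then show "\<exists>y\<in>Qq. pabs (z - y) < \<epsilon>"
      using z[of K] s_Zq[of K] by (intro bexI[of _ "s K"]) (auto simp: Zq_iff)
  qed
  then have zZ: "z \<in> Zq"
    using residue_basis z1 by (metis Zq_iff)
  have "pabs (s 1 - s 0) < 1"
    using residue_fermat[OF x] by (simp add: s_def)
  moreover have "pabs (z - s 1) < 1"
    using z[of 1] inverse_p_less_1 unfolding power_one_right by linarith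
  ultimately have "pabs (z - s 0) < 1"
    using pabs_add_less[of "z - s 1" 1 "s 1 - s 0"] by simp
  then have zx: "pabs (x - z) < 1"
    by (simp add: s_def pabs_diff_commute)
  have "z ^ (p ^ a) - z = 0"
  proof (rule pabs_zero_if_le_powers)
    fix n
    have "pabs (z ^ (p ^ a) - s n ^ (p ^ a)) \<le> pabs (z - s n)"
      using z1 s_Zq by (intro pabs_power_diff_le) (auto simp: Zq_iff)
    also have "\<dots> \<le> (1 / real p) ^ n"
      by (rule z)
    finally have "pabs (z ^ (p ^ a) - s (Suc n)) \<le> (1 / real p) ^ n"
      by (simp add: s_Suc)
    moreover have "pabs (z - s (Suc n)) \<le> (1 / real p) ^ n"
      using z[of "Suc n"] power_decreasing[of n "Suc n" "1 / real p"] p_gt_1 by auto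
    ultimately show "pabs (z ^ (p ^ a) - z) \<le> (1 / real p) ^ n"
      using pabs_diff_le[of "z ^ (p ^ a) - s (Suc n)" _ "z - s (Suc n)"] by simp
  qed
  then show thesis
    using that zZ zx by simp
qed

text \<open>The q-th power map would move two distinct fixed points of one residue class closer
  together.\<close>

lemma teichmueller_unique:
  assumes "z \<in> Zq" "w \<in> Zq" "pabs (z - w) < 1" "z ^ (p ^ a) = z" "w ^ (p ^ a) = w"
  shows "z = w"
proof (rule ccontr)
  assume "z \<noteq> w"
  have "pabs (z - w) \<le> 1 / real p"
    using assms(1-3) by (intro Zq_discrete Qq_closed(7)) (simp_all add: Zq_iff)
  then have "pabs (z - w) \<le> pabs (z - w) / real p"
    using pabs_q_power_diff[of z w] assms by (simp add: Zq_iff)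
  then show False
    using \<open>z \<noteq> w\<close> p_gt_1 by (simp add: le_divide_eq del: p_gt_1)
qed

lemma teichmueller_spec:
  assumes "r \<in> residue_field Qq"
  shows "teichmueller (p ^ a) r \<in> r" "teichmueller (p ^ a) r ^ (p ^ a) = teichmueller (p ^ a) r"
proof -
  obtain x where x: "x \<in> Zq" "r = residue_rel Qq `` {x}"
    using assms unfolding residue_field_def by (auto elim: quotientE)
  have r: "z \<in> r \<longleftrightarrow> z \<in> Zq \<and> pabs (x - z) < 1" for z
    using x by (auto simp: residue_rel_def)
  obtain z where z: "z \<in> Zq" "pabs (x - z) < 1" "z ^ (p ^ a) = z"
    using teichmueller_exists[OF x(1)] .
  have "\<exists>!z. z \<in> r \<and> z ^ (p ^ a) = z"
  proof (rule ex1I[of _ z])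
    fix w assume w: "w \<in> r \<and> w ^ (p ^ a) = w"
    have w': "w \<in> Zq" "pabs (x - w) < 1"
      using conjunct1[OF w] r[of w] by blast+
    then have "pabs (w - z) < 1"
      using z(2) pabs_diff_less[of "x - z" 1 "x - w"] by simp
    then show "w = z"
      using teichmueller_unique[OF w'(1) z(1) _ conjunct2[OF w] z(3)] by blast
  next
    show "z \<in> r \<and> z ^ (p ^ a) = z"
      using z r by blast
  qed
  from theI'[OF this] show "teichmueller (p ^ a) r \<in> r" "teichmueller (p ^ a) r ^ (p ^ a) = teichmueller (p ^ a) r"
    unfolding teichmueller_def by blast+
qed

lemma frob_0 [simp]: "\<tau> 0 = 0" and frob_1 [simp]: "\<tau> 1 = 1"
  by (simp_all add: frob_Qp padic_closed)

lemma frob_in_Qq: "x \<in> Qq \<Longrightarrow> \<tau> x \<in> Qq"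
  using frob_bij by (auto simp: bij_betw_def)

text \<open>For a unit y, \<open>\<tau> y\<close> is congruent to the unit y^p. The general case
  reduces to this by a power of p, which \<open>\<tau>\<close> fixes and which realizes every value
  because the extension is unramified.\<close>

lemma pabs_frob:
  assumes "x \<in> Qq"
  shows "pabs (\<tau> x) = pabs x"
proof (cases "x = 0")
  case False
  have unit: "pabs (\<tau> y) = 1" if "y \<in> Qq" "pabs y = 1" for y
    using frob_residue[of y] that pabs_eq_if_close[of "y ^ p" "\<tau> y"]
    by (simp add: Zq_iff pabs_power pabs_diff_commute)
  obtain n where n: "pabs x = real p powi n"
    using unramified_Qq[OF assms False] by blast
  obtain y :: 'k where y: "y \<in> padic_numbers" "pabs y = pabs x"
  proof (cases "0 \<le> n")
    case True
    have "inverse (of_nat p ^ nat n) \<in> (\<rat> :: 'k set)"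
      by simp
    then have "inverse (of_nat p ^ nat n :: 'k) \<in> padic_numbers"
      using Rats_subset_padic by blast
    then show thesis
      using that[of "inverse (of_nat p ^ nat n)"] True n
      by (auto simp: pabs_inverse pabs_divide pabs_power pabs_p power_int_def divide_simps)
  next
    case False
    have "of_nat p ^ nat (- n) \<in> (\<rat> :: 'k set)"
      by simp
    then have "(of_nat p ^ nat (- n) :: 'k) \<in> padic_numbers"
      using Rats_subset_padic by blast
    then show thesis
      using that[of "of_nat p ^ nat (- n)"] False n
      by (auto simp: pabs_power pabs_p power_int_def divide_simps)
  qed
  have y0: "y \<noteq> 0"
    using y(2) False by auto
  have yQ: "y \<in> Qq"
    using y(1) Qp_subset_Qq by blast
  have "\<tau> x = \<tau> (y * (x / y))"
    using y0 by simp
  also have "\<dots> = y * \<tau> (x / y)"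
    using frob_mult[OF yQ Qq_closed(8)[OF assms yQ]] frob_Qp[OF y(1)] by simp
  finally have "pabs (\<tau> x) = pabs x * pabs (\<tau> (x / y))"
    using y(2) by (simp add: pabs_mult)
  moreover have "pabs (x / y) = 1"
    using y(2) False by (simp add: pabs_divide)
  ultimately show ?thesis
    using unit[of "x / y"] Qq_closed(8)[OF assms yQ] by simp
qed simp

lemma inv_frob_in_Qq: "x \<in> Qq \<Longrightarrow> inv_into Qq \<tau> x \<in> Qq"
  using frob_bij by (metis bij_betw_imp_surj_on inv_into_into)

lemma frob_inv_frob: "x \<in> Qq \<Longrightarrow> \<tau> (inv_into Qq \<tau> x) = x"
  using frob_bij by (metis bij_betw_inv_into_right)

lemma pabs_inv_frob: "x \<in> Qq \<Longrightarrow> pabs (inv_into Qq \<tau> x) = pabs x"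
  using pabs_frob[of "inv_into Qq \<tau> x"] by (simp add: inv_frob_in_Qq frob_inv_frob)

text \<open>Partial sums over the terms of size at least p^(-n) form a geometric Cauchy sequence.
  Its limit is the unordered sum, and the part outside \<open>T\<close> is bounded term by term.
  This reduces an infinite expansion to finitely many terms.\<close>

lemma infsum_approx:
  fixes f :: "'i \<Rightarrow> 'k"
  assumes null: "\<And>\<epsilon>. 0 < \<epsilon> \<Longrightarrow> finite {u \<in> A. \<epsilon> \<le> pabs (f u)}"
    and T: "finite T" "T \<subseteq> A" and small: "\<And>u. u \<in> A - T \<Longrightarrow> pabs (f u) \<le> b" and "0 < b"
  shows "pabs (infsum f A - sum f T) \<le> b"
proof -
  define S where "S n = {u \<in> A. (1 / real p) ^ n \<le> pabs (f u)}" for n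
  have S_fin: "finite (S n)" for n
    unfolding S_def using null by simp
  have sum_diff: "pabs (sum f F - sum f G) \<le> c"
    if "finite F" "G \<subseteq> F" "0 \<le> c" "\<And>u. u \<in> F - G \<Longrightarrow> pabs (f u) \<le> c" for F G c
  proof -
    have "sum f F - sum f G = sum f (F - G)"
      using that by (simp add: sum_diff)
    then show ?thesis
      using pabs_sum_le[of "F - G" f c] that(3,4) by simp
  qed
  have "pabs (sum f (S (Suc n)) - sum f (S n)) \<le> (1 / real p) ^ n" for n
  proof (rule sum_diff)
    have "(1 / real p) ^ Suc n \<le> (1 / real p) ^ n"
      using p_gt_1 by (intro power_decreasing) auto
    then show "S n \<subseteq> S (Suc n)"
      unfolding S_def by fastforce
  qed (auto simp: S_fin, auto simp: S_def)
  then obtain L where L: "\<And>n. pabs (L - sum f (S n)) \<le> (1 / real p) ^ n"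
    using geometric_Cauchy_limit[of "\<lambda>n. sum f (S n)"] by metis
  have F_close: "pabs (L - sum f F) \<le> (1 / real p) ^ n" if "finite F" "S n \<subseteq> F" "F \<subseteq> A" for F n
  proof -
    have "pabs (sum f F - sum f (S n)) \<le> (1 / real p) ^ n"
    proof (rule sum_diff)
      show "pabs (f u) \<le> (1 / real p) ^ n" if "u \<in> F - S n" for u
        using that \<open>F \<subseteq> A\<close> unfolding S_def by fastforce
    qed (use that in auto)
    from pabs_diff_le[OF L[of n] this] show ?thesis
      by simp
  qed
  have "(f has_sum L) A"
    unfolding has_sum_def
  proof (rule tendstoI)
    fix \<epsilon> :: real assume "0 < \<epsilon>"
    then obtain n where n: "(1 / real p) ^ n < \<epsilon>"
      using inverse_power_less by blast
    show "\<forall>\<^sub>F F in finite_subsets_at_top A. dist (sum f F) L < \<epsilon>"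
      unfolding eventually_finite_subsets_at_top
    proof (intro exI[of _ "S n"] conjI allI impI)
      fix F assume "finite F \<and> S n \<subseteq> F \<and> F \<subseteq> A"
      then have "pabs (L - sum f F) \<le> (1 / real p) ^ n"
        using F_close by blast
      then show "dist (sum f F) L < \<epsilon>"
        using n by (simp add: dist_eq_pabs pabs_diff_commute)
    qed (auto simp: S_fin, auto simp: S_def)
  qed
  then have inf: "infsum f A = L"
    by (rule infsumI)
  obtain n where n: "(1 / real p) ^ n < b"
    using inverse_power_less \<open>0 < b\<close> by blast
  have "pabs (L - sum f (T \<union> S n)) \<le> (1 / real p) ^ n"
    using T S_fin by (intro F_close) (auto simp: S_def)
  then have "pabs (L - sum f (T \<union> S n)) \<le> b"
    using n by linarith
  moreover have "pabs (sum f (T \<union> S n) - sum f T) \<le> b"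
    using T S_fin small \<open>0 < b\<close> by (intro sum_diff) (auto simp: S_def)
  ultimately show ?thesis
    using pabs_add_le[of "L - sum f (T \<union> S n)" b "sum f (T \<union> S n) - sum f T"] inf by simp
qed

section \<open>Averages over \<open>p\<close>-th roots\<close>

text \<open>X^p - x is separable for x \<noteq> 0: its derivative p X^(p-1) does not vanish at a
  root, so no factor of the splitting repeats.\<close>

lemma card_prime_roots:
  assumes "x \<noteq> (0::'k)"
  shows "card {z. z ^ p = x} = p"
proof -
  let ?f = "monom 1 p - [:x:]"
  have coeff: "coeff ?f i = (if i = p then 1 else 0) - (if i = 0 then x else 0)" for i
    by (simp add: coeff_pCons split: nat.splits)
  have deg: "degree ?f = p"
  proof (rule antisym)
    show "degree ?f \<le> p"
    proof (rule degree_le, intro allI impI)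
      fix i assume "p < i"
      then show "coeff ?f i = 0"
        unfolding coeff by simp
    qed
    show "p \<le> degree ?f"
      using coeff[of p] p_gt_0 by (intro le_degree) (auto simp del: coeff_diff)
  qed
  have lc: "lead_coeff ?f = 1"
    unfolding deg coeff by simp
  have "?f \<noteq> 0"
    using deg p_neq_0 by (metis degree_0)
  then obtain M where M: "size M = p" "?f = (\<Prod>z\<in>#M. [:- z, 1:])"
    using alg_closed_imp_factorization[of ?f] deg lc by auto
  have roots: "set_mset M = {z. z ^ p = x}"
  proof -
    have "poly ?f z = (\<Prod>w\<in>#M. z - w)" for z
      unfolding M(2) by (simp add: poly_prod_mset image_mset.compositionality o_def)
    moreover have "poly ?f z = 0 \<longleftrightarrow> z ^ p = x" for z
      by (simp add: poly_monom)
    moreover have "(\<Prod>w\<in>#M. z - w) = 0 \<longleftrightarrow> z \<in># M" for z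
      by (force simp: prod_mset_zero_iff)
    ultimately have "z \<in># M \<longleftrightarrow> z ^ p = x" for z
      by simp
    then show ?thesis
      by blast
  qed
  have "count M w = 1" if w: "w \<in># M" for w
  proof -
    obtain M' where M': "M = add_mset w M'"
      using mset_add[OF w] by blast
    let ?g = "\<Prod>z\<in>#M'. [:- z, 1:]"
    have f: "?f = [:- w, 1:] * ?g"
      unfolding M(2) M' by simp
    have "poly (pderiv ?f) w = poly ?g w"
      unfolding f pderiv_mult by (simp add: pderiv_pCons)
    moreover have "poly (pderiv ?f) w = of_nat p * w ^ (p - 1)"
      by (simp add: pderiv_diff pderiv_monom poly_monom pderiv_pCons)
    moreover have "w \<noteq> 0"
    proof
      assume "w = 0"
      then have "x = 0"
        using w roots p_gt_0 by (auto simp: power_0_left)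
      with assms show False ..
    qed
    ultimately have "poly ?g w \<noteq> 0"
      by (metis mult_eq_0_iff of_nat_eq_0_iff p_neq_0 power_not_zero)
    then have "w \<notin># M'"
      by (auto simp: poly_prod_mset image_mset.compositionality o_def)
    then show ?thesis
      by (simp add: M' not_in_iff)
  qed
  then have "size M = card (set_mset M)"
    by (simp add: size_multiset_overloaded_eq)
  then show ?thesis
    using M(1) roots by simp
qed

lemma finite_prime_roots: "finite {z::'k. z ^ p = x}"
proof (cases "x = 0")
  case False
  then show ?thesis
    using card_prime_roots p_gt_0 by (metis card.infinite neq0_conv)
next
  case True
  then have "{z. z ^ p = x} = {0}"
    by auto
  then show ?thesis
    by simp
qed

text \<open>When p does not divide j, multiplying by a nontrivial p-th root of unity w permutes the
  roots and scales the sum by w^j, which differs from 1.\<close>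

lemma sum_prime_roots_power:
  assumes "x \<noteq> (0::'k)"
  shows "(\<Sum>z | z ^ p = x. z ^ j) = (if p dvd j then of_nat p * x ^ (j div p) else 0)"
proof (cases "p dvd j")
  case True
  then obtain k where "j = p * k"
    by auto
  then have "(\<Sum>z | z ^ p = x. z ^ j) = (\<Sum>z | z ^ p = x. x ^ k)"
    by (intro sum.cong) (auto simp: power_mult)
  then show ?thesis
    using \<open>j = p * k\<close> card_prime_roots[OF assms] by simp
next
  case False
  have "card {z::'k. z ^ p = 1} \<noteq> card {1::'k}"
    using card_prime_roots[of 1] p_ge_2 by simp
  then have "{z::'k. z ^ p = 1} \<noteq> {1}"
    by metis
  then obtain w :: 'k where w: "w ^ p = 1" "w \<noteq> 1"
    by (auto simp: set_eq_iff)
  have "w \<noteq> 0"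
    using w p_gt_0 by (auto simp: power_0_left)
  have wj: "w ^ j \<noteq> 1"
  proof
    assume "w ^ j = 1"
    have "coprime j p"
      using prime_imp_coprime[OF prime_p False] by (simp add: coprime_commute)
    then obtain u v where "u * j = v * p + 1"
      using coprime_bezout_strong[of j p] p_ge_2 by (metis Suc_1 mult.commute not_less_eq_eq order_refl)
    then have "(w ^ j) ^ u = (w ^ p) ^ v * w"
      by (metis mult.commute power_add power_mult power_one_right)
    then show False
      using \<open>w ^ j = 1\<close> w by simp
  qed
  have "(\<Sum>z | z ^ p = x. z ^ j) = (\<Sum>z | z ^ p = x. (w * z) ^ j)"
    by (rule sum.reindex_bij_witness[of _ "\<lambda>z. w * z" "\<lambda>z. z / w"])
       (use \<open>w \<noteq> 0\<close> w in \<open>auto simp: power_mult_distrib power_divide\<close>)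
  also have "\<dots> = w ^ j * (\<Sum>z | z ^ p = x. z ^ j)"
    by (simp add: power_mult_distrib sum_distrib_left)
  finally have "(1 - w ^ j) * (\<Sum>z | z ^ p = x. z ^ j) = 0"
    by (simp add: left_diff_distrib)
  then show ?thesis
    using wj False by simp
qed

text \<open>The operator \<open>U\<close> on the coefficient of a single power of \<pi>.\<close>

definition avg :: "('k \<Rightarrow> 'k) \<Rightarrow> 'k \<Rightarrow> 'k" where
  "avg g x = 1 / of_nat p * (\<Sum>z | z ^ p = x. g z)"

definition sect :: "'k poly \<Rightarrow> 'k poly" where
  "sect f = (\<Sum>k\<le>degree f. monom (coeff f (p * k)) k)"

lemma coeff_sect: "coeff (sect f) k = coeff f (p * k)"
proof -
  have "coeff (sect f) k = (if k \<le> degree f then coeff f (p * k) else 0)"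
    by (simp add: sect_def coeff_sum)
  moreover have "coeff f (p * k) = 0" if "\<not> k \<le> degree f"
  proof (rule coeff_eq_0)
    have "k \<le> p * k"
      using p_gt_0 by (cases p) auto
    then show "degree f < p * k"
      using that by linarith
  qed
  ultimately show ?thesis
    by simp
qed

text \<open>The power sums single out the exponents divisible by p. At x = 0 there is one root
  instead of p, and the identity would fail for a nonzero constant term.\<close>

lemma avg_poly:
  assumes "x \<noteq> 0"
  shows "avg (poly f) x = poly (sect f) x"
proof -
  let ?n = "degree f"
  have "(\<Sum>z | z ^ p = x. poly f z) = (\<Sum>i\<le>?n. coeff f i * (\<Sum>z | z ^ p = x. z ^ i))"
    unfolding poly_altdef sum_distrib_left by (rule sum.swap)
  also have "\<dots> = (\<Sum>i\<le>?n. if p dvd i then coeff f i * (of_nat p * x ^ (i div p)) else 0)"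
    by (intro sum.cong) (auto simp: sum_prime_roots_power[OF assms])
  also have "\<dots> = (\<Sum>i | i \<le> ?n \<and> p dvd i. coeff f i * (of_nat p * x ^ (i div p)))"
    by (subst sum.inter_filter[symmetric]) auto
  also have "\<dots> = (\<Sum>k | p * k \<le> ?n. coeff f (p * k) * (of_nat p * x ^ k))"
    using p_gt_0 by (intro sum.reindex_bij_witness[of _ "\<lambda>k. p * k" "\<lambda>i. i div p"]) auto
  also have "\<dots> = (\<Sum>k\<le>?n. coeff f (p * k) * (of_nat p * x ^ k))"
  proof (intro sum.mono_neutral_left)
    show "{k. p * k \<le> ?n} \<subseteq> {..?n}"
    proof
      fix k assume "k \<in> {k. p * k \<le> ?n}"
      moreover have "k \<le> p * k"
        using p_gt_0 by (cases p) auto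
      ultimately show "k \<in> {..?n}"
        by (meson atMost_iff mem_Collect_eq order_trans)
    qed
  qed (auto simp: coeff_eq_0)
  also have "\<dots> = of_nat p * poly (sect f) x"
    by (simp add: sect_def poly_sum poly_monom sum_distrib_left mult.left_commute)
  finally show ?thesis
    by (simp add: avg_def)
qed

lemma avg_bound:
  assumes "\<And>z. z ^ p = x \<Longrightarrow> pabs (g z) \<le> b" "0 \<le> b"
  shows "pabs (avg g x) \<le> real p * b"
proof -
  have "pabs (\<Sum>z | z ^ p = x. g z) \<le> b"
    using assms by (intro pabs_sum_le) auto
  then show ?thesis
    by (simp add: avg_def pabs_mult pabs_divide pabs_p mult_left_mono)
qed

text \<open>The polynomial \<open>(z\<^sup>p - c\<^sup>p) / (z - c)\<close>, written in powers of \<open>z - c\<close>.\<close>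

definition quot_poly :: "'k \<Rightarrow> 'k poly" where
  "quot_poly c = (\<Sum>k<p. smult (of_nat (p choose Suc k) * c ^ (p - Suc k)) ([:- c, 1:] ^ k))"

lemma quot_poly_mult: "[:- c, 1:] * quot_poly c = monom 1 p - [:c ^ p:]"
proof -
  have "monom 1 p = ([:- c, 1:] + [:c:]) ^ p"
    by (simp add: monom_altdef)
  also have "\<dots> = (\<Sum>k\<le>p. of_nat (p choose k) * [:- c, 1:] ^ k * [:c:] ^ (p - k))"
    by (rule binomial_ring)
  also have "\<dots> = [:c ^ p:] + (\<Sum>k<p. of_nat (p choose Suc k) * [:- c, 1:] ^ Suc k * [:c:] ^ (p - Suc k))"
    by (simp add: sum.atMost_shift poly_const_pow)
  also have "(\<Sum>k<p. of_nat (p choose Suc k) * [:- c, 1:] ^ Suc k * [:c:] ^ (p - Suc k)) = [:- c, 1:] * quot_poly c"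
    unfolding quot_poly_def sum_distrib_left
    by (intro sum.cong refl) (simp add: of_nat_poly poly_const_pow mult_ac)
  finally show ?thesis
    by (simp add: algebra_simps)
qed

lemma poly_quot_poly: "(z - c) * poly (quot_poly c) z = z ^ p - c ^ p"
  using arg_cong[OF quot_poly_mult[of c], of "\<lambda>f. poly f z"]
  by (simp add: poly_monom left_diff_distrib)

lemma poly_quot_poly_self: "poly (quot_poly c) c = of_nat p * c ^ (p - 1)"
  using p_gt_0 by (simp add: quot_poly_def poly_sum power_0_left if_distrib sum.delta cong: if_cong)

lemma degree_quot_poly: "degree (quot_poly c) \<le> p - 1"
  unfolding quot_poly_def
proof (rule degree_sum_le)
  fix k assume "k \<in> {..<p}"
  then have "degree ([:- c, 1:] ^ k) \<le> p - 1"
    by (simp add: degree_power_eq)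
  then show "degree (smult (of_nat (p choose Suc k) * c ^ (p - Suc k)) ([:- c, 1:] ^ k)) \<le> p - 1"
    using degree_smult_le order_trans by blast
qed simp

lemma Zq_poly_mult:
  assumes "\<And>i. coeff f i \<in> Zq" "\<And>i. coeff g i \<in> Zq"
  shows "coeff (f * g) i \<in> Zq"
  unfolding coeff_mult using assms by (intro Zq_sum Zq_mult)

lemma Zq_poly_power:
  assumes "\<And>i. coeff f i \<in> Zq"
  shows "coeff (f ^ n) i \<in> Zq"
proof (induction n arbitrary: i)
  case (Suc n)
  then show ?case
    using Zq_poly_mult[of f "f ^ n"] assms by simp
qed (auto simp: coeff_pCons split: nat.splits)

lemma Zq_poly_linear: "c \<in> Zq \<Longrightarrow> coeff [:c, 1:] i \<in> Zq"
  by (auto simp: coeff_pCons split: nat.splits)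

lemma Zq_quot_poly: "c \<in> Zq \<Longrightarrow> coeff (quot_poly c) i \<in> Zq"
  unfolding quot_poly_def coeff_sum coeff_smult
  by (intro Zq_sum Zq_mult Zq_of_nat Zq_power Zq_poly_power Zq_poly_linear Zq_minus)

text \<open>The hypothesis forces |z - c| <= p^(-1/p), so the top term (z - c)^(p-1) has size at
  most p^(1/p - 1). All other terms carry a binomial coefficient divisible by p, and 1/p does not
  exceed this bound.\<close>

lemma pabs_quot_poly_le:
  assumes c: "pabs (c::'k) \<le> 1" and z: "pabs z \<le> 1" and close: "pabs (z ^ p - c ^ p) \<le> 1 / real p"
  shows "pabs (poly (quot_poly c) z) \<le> real p powr (1 / real p - 1)"
proof -
  let ?b = "real p powr (1 / real p - 1)"
  have "pabs ((z - c + c) ^ p - ((z - c) ^ p + c ^ p)) \<le> 1 / real p"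
    using c z by (intro pabs_prime_power_add pabs_diff_le)
  from pabs_diff_le[OF close this] have "pabs (z - c) ^ p \<le> 1 / real p"
    by (simp add: pabs_power algebra_simps)
  then have "(pabs (z - c) ^ p) powr (1 / real p) \<le> (1 / real p) powr (1 / real p)"
    by (intro powr_mono2) auto
  then have zc: "pabs (z - c) \<le> real p powr (- (1 / real p))"
    by (cases "z = c") (auto simp: powr_realpow[symmetric] powr_powr powr_divide powr_minus_divide)
  have p_inv: "1 / real p \<le> ?b"
  proof -
    have "real p powr (- 1) \<le> ?b"
      using p_gt_1 by (intro powr_mono) auto
    then show ?thesis
      by (simp add: powr_minus_divide)
  qed
  show ?thesis
    unfolding quot_poly_def poly_sum
  proof (rule pabs_sum_le)
    fix k assume "k \<in> {..<p}"
    then have k: "k < p"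
      by simp
    have rest: "pabs (c ^ (p - Suc k)) \<le> 1"
      by (rule pabs_power_le_1[OF c])
    have *: "poly (smult (of_nat (p choose Suc k) * c ^ (p - Suc k)) ([:- c, 1:] ^ k)) z =
        of_nat (p choose Suc k) * (c ^ (p - Suc k) * (z - c) ^ k)"
      by (simp add: mult.assoc)
    show "pabs (poly (smult (of_nat (p choose Suc k) * c ^ (p - Suc k)) ([:- c, 1:] ^ k)) z) \<le> ?b"
    proof (cases "Suc k = p")
      case True
      have "pabs (z - c) ^ k \<le> (real p powr (- (1 / real p))) ^ k"
        by (intro power_mono zc) simp
      also have "\<dots> = real p powr (- (1 / real p) * real k)"
        by (simp add: powr_powr flip: powr_realpow)
      also have "- (1 / real p) * real k = 1 / real p - 1"
        using True p_gt_0 by (auto simp: field_simps of_nat_diff)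
      finally have "pabs (z - c) ^ k \<le> ?b" .
      then show ?thesis
        unfolding * using True by (simp add: pabs_power)
    next
      case False
      then have "p dvd p choose Suc k"
        using k prime_p by (intro dvd_choose_prime) auto
      then have "pabs (of_nat (p choose Suc k) * (c ^ (p - Suc k) * (z - c) ^ k)) \<le> 1 / real p * 1"
        using rest c z
        by (intro pabs_mult_le pabs_of_nat_dvd pabs_mult_le_1 pabs_power_le_1 pabs_diff_le)
      then show ?thesis
        unfolding * using p_inv by simp
    qed
  qed simp
qed

text \<open>
  With \<open>h = quot_poly c\<close> and \<open>X = x - c\<^sup>p\<close>, averaging \<open>(z - c)\<^sup>-\<^sup>n = h\<^sup>n / X\<^sup>n\<close> gives
  \<open>avg_poly_coeffs c n\<close>, evaluated at \<open>X\<close>, over \<open>X\<^sup>n\<close>.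
\<close>

definition avg_poly_coeffs :: "'k \<Rightarrow> nat \<Rightarrow> 'k poly" where
  "avg_poly_coeffs c n = sect (quot_poly c ^ n) \<circ>\<^sub>p [:c ^ p, 1:]"

lemma poly_avg_poly_coeffs:
  "c ^ p + y \<noteq> 0 \<Longrightarrow> poly (avg_poly_coeffs c n) y = avg (\<lambda>z. poly (quot_poly c) z ^ n) (c ^ p + y)"
  using avg_poly[of "c ^ p + y" "quot_poly c ^ n"] 
  by (simp add: avg_poly_coeffs_def poly_pcompose poly_power[abs_def])

text \<open>The degree of h^n is at most (p - 1) n < p n, so less than n survives the division of
  exponents by p. Hence averaging a principal part creates no polynomial part.\<close>

lemma degree_avg_poly_coeffs:
  assumes "0 < n"
  shows "degree (avg_poly_coeffs c n) < n"
proof -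
  have "degree (quot_poly c ^ n) \<le> (p - 1) * n"
    using degree_power_le[of "quot_poly c" n] mult_right_mono[OF degree_quot_poly[of c], of n]
    by (meson le0 order_trans)
  then have "coeff (sect (quot_poly c ^ n)) k = 0" if "n \<le> k" for k
  proof -
    have "(p - 1) * n < p * n"
      using assms p_gt_0 by simp
    also have "p * n \<le> p * k"
      using that by simp
    finally show ?thesis
      using \<open>degree (quot_poly c ^ n) \<le> (p - 1) * n\<close> by (simp add: coeff_sect coeff_eq_0)
  qed
  then have "degree (sect (quot_poly c ^ n)) \<le> n - 1"
    using assms by (intro degree_le) auto
  moreover have "degree (avg_poly_coeffs c n) \<le> degree (sect (quot_poly c ^ n))"
    unfolding avg_poly_coeffs_def using degree_pcompose_le[of _ "[:c ^ p, 1:]"] by (auto intro: order_trans)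
  ultimately show ?thesis
    using assms by linarith
qed

lemma Zq_avg_poly_coeffs:
  assumes "c \<in> Zq"
  shows "coeff (avg_poly_coeffs c n) i \<in> Zq"
  unfolding avg_poly_coeffs_def
proof (rule coeff_pcompose_semiring_closed[where R = Zq])
  show "coeff (sect (quot_poly c ^ n)) i \<in> Zq" for i
    unfolding coeff_sect by (intro Zq_poly_power Zq_quot_poly assms)
  show "coeff [:c ^ p, 1:] i \<in> Zq" for i
    by (intro Zq_poly_linear Zq_power assms)
qed (auto intro: Zq_add Zq_mult)

text \<open>
  The coefficients are read off, by the maximum principle, from the values on the circle
  \<open>|x - c\<^sup>p| = 1/p\<close>, where every \<open>p\<close>-th root of \<open>x\<close> is close to \<open>c\<close>.
\<close>

lemma pabs_avg_poly_coeffs_le: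
  assumes c: "c = 0 \<or> pabs (c::'k) = 1"
  shows "pabs (coeff (avg_poly_coeffs c n) k) \<le> real p powr (1 + real n / real p + real k - real n)"
proof -
  let ?G = "avg_poly_coeffs c n"
  let ?b = "real p powr (1 / real p - 1)"
  have c1: "pabs c \<le> 1"
    using c by auto
  have cp: "c ^ p = 0 \<or> pabs (c ^ p) = 1"
    using c by (auto simp: pabs_power power_0_left)
  \<comment> \<open>Replacing y by p y turns the circle of radius 1/p into the unit circle and
    multiplies the k-th coefficient by p^k, which is undone at the end. The factor
    \<open>real p\<close> comes from the division by p in \<open>avg\<close>.\<close>
  have "pabs (coeff (?G \<circ>\<^sub>p [:0, of_nat p:]) k) \<le> real p * ?b ^ n"
  proof (rule pabs_coeff_le_of_poly_le[of "{0}"])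
    fix y :: 'k assume y: "\<And>s. s \<in> {0} \<Longrightarrow> pabs (y - s) = 1"
    let ?x = "c ^ p + of_nat p * y"
    have py: "pabs (of_nat p * y) = 1 / real p"
      using y by (simp add: pabs_mult pabs_p)
    have x0: "?x \<noteq> 0"
      using cp
    proof
      assume "c ^ p = 0"
      moreover have "of_nat p * y \<noteq> 0"
        using py p_gt_0 by (metis divide_eq_0_iff of_nat_eq_0_iff p_neq_0 pabs_0 zero_neq_one)
      ultimately show ?thesis
        by (simp only: add_0 not_False_eq_True)
    next
      assume "pabs (c ^ p) = 1"
      moreover have "pabs (of_nat p * y) < 1"
        using py p_gt_1 by simp
      ultimately have "pabs ?x = 1"
        using pabs_add_eq[of "of_nat p * y" "c ^ p"] by simp
      then show ?thesis
        by auto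
    qed
    have x1: "pabs ?x \<le> 1"
      using c1 py p_gt_1 by (intro pabs_add_le pabs_power_le_1) auto
    have "pabs (poly (quot_poly c) z ^ n) \<le> ?b ^ n" if z: "z ^ p = ?x" for z
    proof -
      have "pabs z ^ p \<le> 1"
        using x1 by (simp add: z flip: pabs_power)
      then have "pabs z \<le> 1"
        by (metis p_gt_0 not_le one_less_power)
      then have "pabs (poly (quot_poly c) z) \<le> ?b"
        using z py by (intro pabs_quot_poly_le c1) auto
      then show ?thesis
        by (simp add: pabs_power power_mono)
    qed
    then have "pabs (avg (\<lambda>z. poly (quot_poly c) z ^ n) ?x) \<le> real p * ?b ^ n"
      by (intro avg_bound) auto
    then show "pabs (poly (?G \<circ>\<^sub>p [:0, of_nat p:]) y) \<le> real p * ?b ^ n"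
      using poly_avg_poly_coeffs[OF x0] by (simp add: poly_pcompose mult.commute)
  qed auto
  then have "(1 / real p) ^ k * pabs (coeff ?G k) \<le> real p * ?b ^ n"
    by (simp add: coeff_pcompose_linear pabs_mult pabs_power pabs_p)
  then have "pabs (coeff ?G k) \<le> real p * ?b ^ n * real p ^ k"
    using p_gt_0 by (simp add: power_one_over field_simps)
  also have "\<dots> = real p powr 1 * real p powr ((1 / real p - 1) * real n) * real p powr real k"
    by (simp add: powr_powr powr_realpow flip: powr_realpow)
  also have "\<dots> = real p powr (1 + real n / real p + real k - real n)"
    by (simp only: powr_add[symmetric]) (simp add: algebra_simps)
  finally show ?thesis .
qed

text \<open>Every p-th root of c^p other than c is a zero of h = \<open>quot_poly c\<close>, and
  h(c) = p c^(p-1) is nonzero in characteristic zero. For n = 0 all roots contribute, and the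
  average is 1.\<close>

lemma avg_poly_coeffs_0:
  assumes "c \<noteq> 0"
  shows "coeff (avg_poly_coeffs c n) 0 \<noteq> 0"
proof (cases "n = 0")
  case True
  have "coeff (avg_poly_coeffs c n) 0 = poly (avg_poly_coeffs c n) 0"
    by (simp add: poly_0_coeff_0)
  also have "\<dots> = avg (\<lambda>z. 1) (c ^ p)"
    using poly_avg_poly_coeffs[of c 0 n] assms True by simp
  also have "\<dots> = 1"
    using card_prime_roots[of "c ^ p"] assms by (simp add: avg_def)
  finally show ?thesis
    by simp
next
  case False
  have "coeff (avg_poly_coeffs c n) 0 = poly (avg_poly_coeffs c n) 0"
    by (simp add: poly_0_coeff_0)
  also have "\<dots> = avg (\<lambda>z. poly (quot_poly c) z ^ n) (c ^ p)"
    using poly_avg_poly_coeffs[of c 0 n] assms by simp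
  also have "(\<Sum>z | z ^ p = c ^ p. poly (quot_poly c) z ^ n) = (\<Sum>z\<in>{c}. poly (quot_poly c) z ^ n)"
  proof (rule sum.mono_neutral_right[OF finite_prime_roots])
    show "\<forall>z\<in>{z. z ^ p = c ^ p} - {c}. poly (quot_poly c) z ^ n = 0"
    proof
      fix z assume "z \<in> {z. z ^ p = c ^ p} - {c}"
      then have "poly (quot_poly c) z = 0"
        using poly_quot_poly[of z c] by auto
      then show "poly (quot_poly c) z ^ n = 0"
        using False by simp
    qed
  qed simp
  then have "avg (\<lambda>z. poly (quot_poly c) z ^ n) (c ^ p) = (of_nat p * c ^ (p - 1)) ^ n / of_nat p"
    by (simp add: avg_def poly_quot_poly_self)
  finally show ?thesis
    using assms by simp
qed

end

context exponential_sum
begin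

section \<open>Uniqueness of expansions\<close>

definition pt :: "nat \<Rightarrow> nat \<Rightarrow> 'k" where
  "pt m j = pole j ^ p ^ m"

lemma P_some:
  assumes "j \<in> {2..l}"
  obtains r where "P j = Some r" "r \<in> residue_field Qq"
proof -
  have "P j \<noteq> None"
    using inj_onD[OF P_inj, of j 1] P_1 assms by auto
  then show thesis
    using P_mem[of j] assms that by auto
qed

lemma P_eq_None_iff: "j \<in> {1..l} \<Longrightarrow> P j = None \<longleftrightarrow> j = 1"
  using P_1 P_some[of j] by (cases "j = 1") auto

lemma residue_class_subset: "r \<in> residue_field Qq \<Longrightarrow> r \<subseteq> Zq"
  by (auto simp: residue_field_def quotient_def residue_rel_def)

lemma residue_class_eqI:
  assumes "r \<in> residue_field Qq" "s \<in> residue_field Qq" "x \<in> r" "y \<in> s" "pabs (x - y) < 1"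
  shows "r = s"
proof -
  obtain v where v: "r = {z \<in> Zq. pabs (v - z) < 1}" "v \<in> Zq"
    using assms(1) by (auto simp: residue_field_def quotient_def residue_rel_def)
  obtain w where w: "s = {z \<in> Zq. pabs (w - z) < 1}" "w \<in> Zq"
    using assms(2) by (auto simp: residue_field_def quotient_def residue_rel_def)
  have "pabs (v - x) < 1" "pabs (w - y) < 1"
    using assms v w by auto
  then have "pabs (v - x + (x - y)) < 1" "pabs (w - y) < 1"
    using pabs_add_less assms(5) by blast+
  then have vw: "pabs (v - w) < 1"
    using pabs_diff_less[of "v - x + (x - y)" 1 "w - y"] by simp
  have "pabs (v - z) < 1 \<longleftrightarrow> pabs (w - z) < 1" for z
    using pabs_diff_less[of "v - z" 1 "v - w"] pabs_add_less[of "w - z" 1 "v - w"] vw by auto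
  then show ?thesis
    using v w by simp
qed

lemma pole_spec:
  assumes "j \<in> {2..l}"
  shows "pole j \<in> the (P j)" "pole j ^ p ^ a = pole j" "the (P j) \<in> residue_field Qq" "pole j \<in> Zq"
proof -
  obtain r where r: "P j = Some r" "r \<in> residue_field Qq"
    using P_some[OF assms] .
  show "the (P j) \<in> residue_field Qq"
    using r by simp
  show "pole j \<in> the (P j)" "pole j ^ p ^ a = pole j"
    using teichmueller_spec[OF r(2)] r(1) by (simp_all only: pole_def option.sel)
  then show "pole j \<in> Zq"
    using r residue_class_subset by auto
qed

lemma pt_0: "pt 0 j = pole j"
  by (simp add: pt_def)

lemma pt_Suc: "pt (Suc m) j = pt m j ^ p"
  by (simp only: pt_def power_Suc2 power_mult)

lemma pt_Zq: "j \<in> {2..l} \<Longrightarrow> pt m j \<in> Zq"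
  by (simp add: pt_def Zq_power pole_spec)

lemma pt_integral: "j \<in> {2..l} \<Longrightarrow> pabs (pt m j) \<le> 1"
  using pt_Zq by (auto simp: Zq_iff)

lemma pt_a: "j \<in> {2..l} \<Longrightarrow> pt a j = pt 0 j"
  unfolding pt_def power_0 power_one_right by (rule pole_spec(2))

lemma pole_2: "pole 2 = 0"
proof -
  have 2: "2 \<in> {2..l}"
    using l_ge_2 by simp
  have "pabs (pole 2) < 1"
    using pole_spec(1)[OF 2] P_2 by simp
  then show ?thesis
    using teichmueller_unique[OF pole_spec(4)[OF 2] Zq_0 _ pole_spec(2)[OF 2]] by (simp add: power_0_left)
qed

lemma pt_2: "pt m 2 = 0"
  by (simp add: pt_def pole_2 power_0_left)

text \<open>The p-th power is additive modulo p, and (x - y)^p is small only if x - y is. So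
  twisting keeps the poles in distinct residue classes, and p-th roots of points of one domain lie
  in the previous one.\<close>

lemma pabs_diff_less_iff_power:
  assumes "pabs (x::'k) \<le> 1" "pabs y \<le> 1"
  shows "pabs (x ^ p - y ^ p) < 1 \<longleftrightarrow> pabs (x - y) < 1"
proof
  assume "pabs (x - y) < 1"
  then show "pabs (x ^ p - y ^ p) < 1"
    using pabs_power_diff_le[OF assms, of p] by simp
next
  assume *: "pabs (x ^ p - y ^ p) < 1"
  have "pabs ((x - y + y) ^ p - ((x - y) ^ p + y ^ p)) \<le> 1 / real p"
    using assms by (intro pabs_prime_power_add pabs_diff_le)
  also note inverse_p_less_1
  finally have "pabs (x ^ p - y ^ p - (x - y) ^ p) < 1"
    by (simp add: algebra_simps)
  from pabs_diff_less[OF * this] have "pabs (x - y) ^ p < 1"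
    by (simp add: pabs_power)
  then show "pabs (x - y) < 1"
    by (meson not_le one_le_power)
qed

lemma pt_diff:
  assumes "j \<in> {2..l}" "k \<in> {2..l}" "j \<noteq> k"
  shows "pabs (pt m j - pt m k) = 1"
proof -
  have "\<not> pabs (pt m j - pt m k) < 1"
  proof (induction m)
    case 0
    have "P j \<noteq> P k"
      using assms inj_onD[OF P_inj, of j k] by auto
    moreover have "P j \<noteq> None" "P k \<noteq> None"
      using assms P_eq_None_iff[of j] P_eq_None_iff[of k] by auto
    ultimately have "the (P j) \<noteq> the (P k)"
      by auto
    then show ?case
      using residue_class_eqI[OF pole_spec(3)[OF assms(1)] pole_spec(3)[OF assms(2)]
          pole_spec(1)[OF assms(1)] pole_spec(1)[OF assms(2)]]
      unfolding pt_0 by blast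
  next
    case (Suc m)
    then show ?case
      using pabs_diff_less_iff_power[OF pt_integral[OF assms(1)] pt_integral[OF assms(2)]]
      by (simp add: pt_Suc)
  qed
  moreover have "pabs (pt m j - pt m k) \<le> 1"
    using assms by (intro pabs_diff_le pt_integral)
  ultimately show ?thesis
    by simp
qed

lemma pt_unit:
  assumes "j \<in> {3..l}"
  shows "pabs (pt m j) = 1"
  using pt_diff[of j 2 m] assms by (simp add: pt_2)

lemma domain_iff:
  "x \<in> domain m \<longleftrightarrow> pabs x \<le> 1 \<and> (\<forall>j\<in>{2..l}. pabs (x - pt m j) = 1)"
proof -
  have "pabs x \<le> 1 \<Longrightarrow> j \<in> {2..l} \<Longrightarrow> pabs (x - pt m j) \<le> 1" for j
    by (intro pabs_diff_le pt_integral)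
  then show ?thesis
    by (force simp: domain_def pt_def)
qed

lemma domain_neq_pt: "x \<in> domain m \<Longrightarrow> j \<in> {2..l} \<Longrightarrow> x \<noteq> pt m j"
  unfolding domain_iff by (metis diff_self pabs_0 zero_neq_one)

lemma domain_neq_0: "x \<in> domain m \<Longrightarrow> x \<noteq> 0"
  using domain_neq_pt[of x m 2] l_ge_2 by (simp add: pt_2)

lemma domain_a: "domain a = domain 0"
  by (auto simp: domain_iff pt_a)

lemma domain_root:
  assumes "z ^ p = x" "x \<in> domain (Suc m)"
  shows "z \<in> domain m"
proof -
  have "pabs z ^ p \<le> 1"
    using assms by (auto simp: domain_iff simp flip: pabs_power)
  then have z: "pabs z \<le> 1"
    by (metis p_gt_0 not_le one_less_power)
  moreover have "pabs (z - pt m j) = 1" if j: "j \<in> {2..l}" for j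
  proof -
    have "\<not> pabs (z ^ p - pt m j ^ p) < 1"
      using assms j by (auto simp: domain_iff pt_Suc)
    then have "\<not> pabs (z - pt m j) < 1"
      using pabs_diff_less_iff_power[OF z pt_integral[OF j]] by simp
    moreover have "pabs (z - pt m j) \<le> 1"
      using z j by (intro pabs_diff_le pt_integral)
    ultimately show ?thesis
      by simp
  qed
  ultimately show ?thesis
    by (simp add: domain_iff)
qed

lemma B_infinity: "B m (i, 1) x = x ^ i" "B m (i, Suc 0) x = x ^ i"
  by (simp_all add: B_def P_1 flip: One_nat_def)

lemma B_finite: "j \<in> {2..l} \<Longrightarrow> B m (i, j) x = 1 / (x - pt m j) ^ i"
  using P_eq_None_iff[of j] by (auto simp: B_def pt_def power_one_over)

lemma B_0: "B m (0, j) x = 1"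
  by (simp add: B_def)

lemma B_add: "B m (i + k, j) x = B m (i, j) x * B m (k, j) x"
  by (simp add: B_def power_add)

lemma B_mult_power: "B m (i, j) x ^ k = B m (i * k, j) x"
  by (simp add: B_def power_mult)

lemma B_a: "u \<in> idx \<Longrightarrow> B a u x = B 0 u x"
proof -
  have *: "pole j ^ p ^ a = pole j ^ p ^ 0" if "j \<in> {2..l}" for j
    using pt_a[OF that] by (simp only: pt_def)
  assume u: "u \<in> idx"
  obtain i j where ij: "u = (i, j)" "j \<in> {1..l}"
    using u l_ge_2 by (cases u) (auto simp: idx_def)
  show ?thesis
  proof (cases "j = 1")
    case False
    then have "j \<in> {2..l}"
      using ij by auto
    from *[OF this] show ?thesis
      by (simp only: B_def ij prod.case)
  qed (use ij P_1 in \<open>simp add: B_def\<close>)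
qed

lemma idx_cases:
  assumes "u \<in> idx"
  obtains i where "u = (i, 1)" | i j where "u = (i, j)" "1 \<le> i" "j \<in> {2..l}"
proof (cases u)
  case (Pair i j)
  show thesis
    using assms that(1)[of i] that(2)[of i j] unfolding Pair idx_def
    by (cases "j = 1") auto
qed

lemma idx_infinity: "(i, 1) \<in> idx" "(i, Suc 0) \<in> idx"
  using l_ge_2 by (cases i; auto simp: idx_def)+

lemma idx_finite: "1 \<le> i \<Longrightarrow> j \<in> {1..l} \<Longrightarrow> (i, j) \<in> idx"
  by (auto simp: idx_def)

lemma B_integral:
  assumes "u \<in> idx" "x \<in> domain m"
  shows "pabs (B m u x) \<le> 1"
  using assms(1)
proof (cases rule: idx_cases)
  case (1 i)
  then show ?thesis
    using assms by (simp add: B_infinity domain_iff pabs_power_le_1)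
next
  case (2 i j)
  then show ?thesis
    using assms by (simp add: B_finite domain_iff pabs_divide pabs_power)
qed

lemma pabs_coeff_le_of_domain:
  assumes "0 \<le> b" "\<And>x. x \<in> domain m \<Longrightarrow> pabs (poly f x) \<le> b"
  shows "pabs (coeff f i) \<le> b"
proof (rule pabs_coeff_le_of_poly_le[of "pt m ` {2..l}"])
  show "pt m ` {2..l} \<noteq> {}"
    using l_ge_2 by simp
  show "pabs (poly f y) \<le> b" if "pabs y \<le> 1" "\<And>s. s \<in> pt m ` {2..l} \<Longrightarrow> pabs (y - s) = 1" for y
    using that by (intro assms(2)) (auto simp: domain_iff)
qed (use assms(1) pt_integral in auto)

text \<open>
  To isolate the leading coefficient at a finite pole, multiply by a polynomial that cancels all
  poles and evaluate the resulting polynomial at that pole: its coefficients are bounded by its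
  values on the domain, which does not contain the pole.
\<close>

lemma combination_coeff_bound:
  assumes T: "finite T" "T \<subseteq> idx" and b: "0 \<le> b"
    and le: "\<And>x. x \<in> domain m \<Longrightarrow> pabs (\<Sum>u\<in>T. e u * B m u x) \<le> b"
    and u: "u \<in> T"
  shows "pabs (e u) \<le> b"
proof (rule ccontr)
  assume "\<not> pabs (e u) \<le> b"
  define T' where "T' = {v \<in> T. b < pabs (e v)}"
  have T': "finite T'" "T' \<subseteq> idx" "u \<in> T'"
    using T u \<open>\<not> pabs (e u) \<le> b\<close> by (auto simp: T'_def)
  have le': "pabs (\<Sum>u\<in>T'. e u * B m u x) \<le> b" if x: "x \<in> domain m" for x
  proof -
    have "pabs (\<Sum>u\<in>T - T'. e u * B m u x) \<le> b"
    proof (rule pabs_sum_le[OF _ b])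
      fix v assume v: "v \<in> T - T'"
      have "pabs (e v * B m v x) \<le> b * 1"
        using v T x by (intro pabs_mult_le B_integral) (auto simp: T'_def)
      then show "pabs (e v * B m v x) \<le> b"
        by simp
    qed
    moreover have "(\<Sum>u\<in>T'. e u * B m u x) = (\<Sum>u\<in>T. e u * B m u x) - (\<Sum>u\<in>T - T'. e u * B m u x)"
      using T(1) sum.subset_diff[of T' T "\<lambda>u. e u * B m u x"] by (auto simp: T'_def)
    ultimately show ?thesis
      using pabs_diff_le[OF le[OF x]] by simp
  qed
  show False
  proof (cases "\<exists>i j. (i, j) \<in> T' \<and> j \<in> {2..l}")
    case True
    then obtain j where j: "j \<in> {2..l}" "{i. (i, j) \<in> T'} \<noteq> {}"
      by blast
    define N where "N = Max {i. (i, j) \<in> T'}"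
    define N' where "N' = Max (fst ` T')"
    have fin: "finite {i. (i, j) \<in> T'}"
      by (rule finite_subset[of _ "fst ` T'"]) (use T'(1) in force)+
    have N: "(N, j) \<in> T'"
      using Max_in[OF fin j(2)] by (simp add: N_def)
    have N_max: "i \<le> N" if "(i, j) \<in> T'" for i
      using Max_ge[OF fin] that by (simp add: N_def)
    have N'_max: "i \<le> N'" if "(i, k) \<in> T'" for i k
      unfolding N'_def using T'(1) that by (intro Max_ge) force+
    have "1 \<le> N"
      using N T'(2) j(1) by (auto simp: idx_def)
    define X where "X k = [:- pt m k, 1:]" for k
    define J where "J = {2..l} - {j}"
    \<comment> \<open>The exponent N is exact, so only the term of order N at the chosen pole
      survives evaluation there; N' is large enough to clear the other poles. On the domain R has
      absolute value 1.\<close>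
    define R where "R = X j ^ N * (\<Prod>k\<in>J. X k ^ N')"
    have X: "poly (X k) x = x - pt m k" for k x
      by (simp add: X_def)
    define c where "c = (\<Prod>k\<in>J. (pt m j - pt m k) ^ N')"
    have c: "pabs c = 1"
      unfolding c_def pabs_prod pabs_power
      using j(1) by (intro prod.neutral) (auto simp: J_def pt_diff)
    have "\<exists>g. (\<forall>x\<in>domain m. B m v x * poly R x = poly g x) \<and>
        poly g (pt m j) = (if v = (N, j) then c else 0)" if v: "v \<in> T'" for v
    proof -
      have "v \<in> idx"
        using v T' by auto
      then show ?thesis
      proof (cases rule: idx_cases)
        case (1 i)
        then show ?thesis
          using \<open>1 \<le> N\<close> j(1)
          by (intro exI[of _ "monom 1 i * R"]) (auto simp: B_infinity R_def X poly_monom power_0_left)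
      next
        case (2 i k)
        show ?thesis
        proof (cases "k = j")
          case True
          let ?g = "X j ^ (N - i) * (\<Prod>k\<in>J. X k ^ N')"
          have i: "i \<le> N"
            using N_max v 2 True by simp
          have "B m v x * poly R x = poly ?g x" if "x \<in> domain m" for x
          proof -
            have "(x - pt m j) ^ N = (x - pt m j) ^ i * (x - pt m j) ^ (N - i)"
              using i by (simp flip: power_add)
            then show ?thesis
              using domain_neq_pt[OF that j(1)] 2 True by (simp add: R_def X B_finite)
          qed
          moreover have "poly ?g (pt m j) = (if v = (N, j) then c else 0)"
            using i 2 True by (auto simp: X poly_prod c_def power_0_left)
          ultimately show ?thesis
            by blast
        next
          case False
          then have k: "k \<in> J"
            using 2 by (simp add: J_def)
          let ?g = "X j ^ N * (X k ^ (N' - i) * (\<Prod>k\<in>J - {k}. X k ^ N'))"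
          have i: "i \<le> N'"
            using N'_max v 2 by simp
          have R: "R = X j ^ N * (X k ^ N' * (\<Prod>k\<in>J - {k}. X k ^ N'))"
            using k by (simp add: R_def J_def prod.remove)
          have "B m v x * poly R x = poly ?g x" if "x \<in> domain m" for x
          proof -
            have "(x - pt m k) ^ N' = (x - pt m k) ^ i * (x - pt m k) ^ (N' - i)"
              using i by (simp flip: power_add)
            then show ?thesis
              using domain_neq_pt[OF that 2(3)] 2 by (simp add: R X B_finite)
          qed
          moreover have "poly ?g (pt m j) = (if v = (N, j) then c else 0)"
            using \<open>1 \<le> N\<close> 2 False by (auto simp: X power_0_left)
          ultimately show ?thesis
            by blast
        qed
      qed
    qed
    then obtain g where g: "\<And>v x. v \<in> T' \<Longrightarrow> x \<in> domain m \<Longrightarrow> B m v x * poly R x = poly (g v) x"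
      "\<And>v. v \<in> T' \<Longrightarrow> poly (g v) (pt m j) = (if v = (N, j) then c else 0)"
      by metis
    define G where "G = (\<Sum>v\<in>T'. smult (e v) (g v))"
    have "pabs (poly G x) \<le> b" if x: "x \<in> domain m" for x
    proof -
      have "poly G x = (\<Sum>v\<in>T'. e v * B m v x) * poly R x"
        by (simp add: G_def poly_sum g(1)[OF _ x, symmetric] sum_distrib_right mult.assoc)
      moreover have "pabs (poly R x) = 1"
        using x j(1) by (auto simp: R_def X poly_prod pabs_mult pabs_power pabs_prod domain_iff J_def)
      ultimately show ?thesis
        using le'[OF x] by (simp add: pabs_mult)
    qed
    then have "pabs (poly G (pt m j)) \<le> b"
      using pabs_coeff_le_of_domain[OF b] by (intro pabs_poly_le pt_integral j(1)) blast
    moreover have "poly G (pt m j) = (\<Sum>v\<in>T'. if v = (N, j) then e v * c else 0)"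
      unfolding G_def poly_sum by (intro sum.cong) (auto simp: g(2))
    then have "poly G (pt m j) = e (N, j) * c"
      using N T'(1) by simp
    ultimately show False
      using N c by (simp add: pabs_mult T'_def)
  next
    case False
    \<comment> \<open>Without finite poles the combination is a polynomial, and its coefficients are
      bounded directly by its values.\<close>
    then have inf: "v = (fst v, 1)" if "v \<in> T'" for v
      using idx_cases[of v] that T'(2) by (metis fst_conv subsetD)
    define G where "G = (\<Sum>v\<in>T'. monom (e v) (fst v))"
    have "pabs (poly G x) \<le> b" if x: "x \<in> domain m" for x
    proof -
      have "poly G x = (\<Sum>v\<in>T'. e v * B m v x)"
        unfolding G_def poly_sum
      proof (intro sum.cong refl)
        fix v assume "v \<in> T'"
        then show "poly (monom (e v) (fst v)) x = e v * B m v x"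
          by (metis B_infinity(1) inf poly_monom)
      qed
      then show ?thesis
        using le'[OF x] by simp
    qed
    then have "pabs (coeff G (fst u)) \<le> b"
      by (rule pabs_coeff_le_of_domain[OF b])
    moreover have "coeff G (fst u) = (\<Sum>v\<in>T'. if v = u then e v else 0)"
      unfolding G_def coeff_sum
    proof (intro sum.cong refl)
      fix v assume "v \<in> T'"
      then have "fst v = fst u \<longleftrightarrow> v = u"
        using inf[of v] inf[OF T'(3)] by metis
      then show "coeff (monom (e v) (fst v)) (fst u) = (if v = u then e v else 0)"
        by simp
    qed
    then have "coeff G (fst u) = e u"
      using T' by simp
    ultimately show False
      using \<open>\<not> pabs (e u) \<le> b\<close> by simp
  qed
qed

definition fin_rep :: "nat \<Rightarrow> (nat \<times> nat \<Rightarrow> 'k) \<Rightarrow> ('k \<Rightarrow> 'k) \<Rightarrow> bool" where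
  "fin_rep m c g \<longleftrightarrow> finite {u. c u \<noteq> 0} \<and> {u. c u \<noteq> 0} \<subseteq> idx \<and> (\<forall>u. c u \<in> Zq) \<and>
     (\<forall>x\<in>domain m. g x = (\<Sum>u | c u \<noteq> 0. c u * B m u x))"

lemma fin_rep_sum_superset:
  assumes "fin_rep m c g" "x \<in> domain m" "finite T" "{u. c u \<noteq> 0} \<subseteq> T"
  shows "g x = (\<Sum>u\<in>T. c u * B m u x)"
proof -
  have "g x = (\<Sum>u | c u \<noteq> 0. c u * B m u x)"
    using assms by (simp add: fin_rep_def)
  also have "\<dots> = (\<Sum>u\<in>T. c u * B m u x)"
    using assms by (intro sum.mono_neutral_left) auto
  finally show ?thesis .
qed

lemma fin_rep_infsum:
  assumes "fin_rep m c g" "x \<in> domain m"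
  shows "(\<Sum>\<^sub>\<infinity>u\<in>idx. c u * B m u x) = g x"
proof -
  have "(\<Sum>\<^sub>\<infinity>u\<in>idx. c u * B m u x) = (\<Sum>\<^sub>\<infinity>u\<in>{u. c u \<noteq> 0}. c u * B m u x)"
    using assms by (intro infsum_cong_neutral) (auto simp: fin_rep_def)
  also have "\<dots> = (\<Sum>u | c u \<noteq> 0. c u * B m u x)"
    using assms by (intro infsum_finite) (auto simp: fin_rep_def)
  finally show ?thesis
    using assms by (simp add: fin_rep_def)
qed

lemma fps_nth_le_pinorm:
  assumes "\<And>t. fps_nth b t \<in> Zq"
  shows "pabs (fps_nth b t) * (1 / real p) ^ t \<le> pinorm p b"
  unfolding pinorm_def
proof (rule cSUP_upper)
  show "bdd_above (range (\<lambda>t. pabs (fps_nth b t) * (1 / real p) ^ t))"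
  proof (rule bdd_aboveI2[of _ _ 1])
    show "pabs (fps_nth b t) * (1 / real p) ^ t \<le> 1" for t
      using assms[of t] p_gt_1 by (intro mult_le_one power_le_one) (auto simp: Zq_iff)
  qed
qed simp

lemma tendsto_idx_iff:
  "(f \<longlongrightarrow> 0) idx_at_infinity \<longleftrightarrow> (\<forall>\<epsilon>>0. finite {u \<in> idx. \<epsilon> \<le> \<bar>f u :: real\<bar>})"
proof -
  have "{u. \<not> (u \<in> idx \<longrightarrow> dist (f u) 0 < \<epsilon>)} = {u \<in> idx. \<epsilon> \<le> \<bar>f u\<bar>}" for \<epsilon>
    by auto
  then show ?thesis
    by (simp add: tendsto_iff eventually_inf_principal eventually_cofinite)
qed

text \<open>Norms tend to zero because finitely many indices occur below each power of \<pi> and the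
  later powers are small. For uniqueness, a competing expansion is cut to finitely many terms and
  compared by \<open>combination_coeff_bound\<close>. All access to \<open>coeffs_of\<close> goes
  through this lemma.\<close>

lemma coeffs_of_eq:
  assumes rep: "\<And>t. fin_rep m (c t) (\<lambda>x. fps_nth (\<xi> x) t)"
  shows "coeffs_of m \<xi> = (\<lambda>u. Abs_fps (\<lambda>t. c t u))"
  unfolding coeffs_of_def
proof (rule the_equality)
  let ?c = "\<lambda>u. Abs_fps (\<lambda>t. c t u)"
  have Zq: "c t u \<in> Zq" for t u
    using rep[of t] unfolding fin_rep_def by blast
  have "((\<lambda>u. pinorm p (?c u)) \<longlongrightarrow> 0) idx_at_infinity"
    unfolding tendsto_idx_iff
  proof (intro allI impI)
    fix \<epsilon> :: real assume "0 < \<epsilon>"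
    then obtain N where N: "(1 / real p) ^ N < \<epsilon>"
      using inverse_power_less by blast
    have "pinorm p (?c u) < \<epsilon>" "0 \<le> pinorm p (?c u)" if "\<And>t. t < N \<Longrightarrow> c t u = 0" for u
    proof -
      have "pinorm p (?c u) \<le> (1 / real p) ^ N"
        unfolding pinorm_def
      proof (rule cSUP_least)
        fix t
        show "pabs (fps_nth (?c u) t) * (1 / real p) ^ t \<le> (1 / real p) ^ N"
        proof (cases "t < N")
          case False
          have "pabs (c t u) * (1 / real p) ^ t \<le> 1 * (1 / real p) ^ N"
            using False Zq[of t u] p_gt_1
            by (intro mult_mono power_decreasing) (auto simp: Zq_iff)
          then show ?thesis
            by simp
        qed (simp add: that)
      qed simp
      then show "pinorm p (?c u) < \<epsilon>"
        using N by linarith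
      have "0 \<le> pabs (fps_nth (?c u) 0) * (1 / real p) ^ 0"
        by simp
      also have "\<dots> \<le> pinorm p (?c u)"
        by (rule fps_nth_le_pinorm) (simp add: Zq)
      finally show "0 \<le> pinorm p (?c u)" .
    qed
    then have "{u \<in> idx. \<epsilon> \<le> \<bar>pinorm p (?c u)\<bar>} \<subseteq> (\<Union>t<N. {u. c t u \<noteq> 0})"
      by fastforce
    moreover have "finite (\<Union>t<N. {u. c t u \<noteq> 0})"
      using rep by (auto simp: fin_rep_def)
    ultimately show "finite {u \<in> idx. \<epsilon> \<le> \<bar>pinorm p (?c u)\<bar>}"
      by (rule finite_subset)
  qed
  moreover have "?c u = 0" if "u \<notin> idx" for u
  proof -
    have "c t u = 0" for t
      using rep[of t] that unfolding fin_rep_def by blast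
    then show ?thesis
      by (simp add: fps_eq_iff)
  qed
  ultimately have "?c \<in> coeff_families"
    using Zq by (simp add: coeff_families_def)
  moreover have "\<xi> x = expansion m ?c x" if "x \<in> domain m" for x
    using fin_rep_infsum[OF rep that] by (simp add: fps_eq_iff expansion_def)
  ultimately show "?c \<in> coeff_families \<and> (\<forall>x\<in>domain m. \<xi> x = expansion m ?c x)"
    by blast
next
  fix \<gamma> assume \<gamma>: "\<gamma> \<in> coeff_families \<and> (\<forall>x\<in>domain m. \<xi> x = expansion m \<gamma> x)"
  have "fps_nth (\<gamma> u0) t = c t u0" for u0 t
  proof (rule ccontr)
    assume ne: "fps_nth (\<gamma> u0) t \<noteq> c t u0"
    define f where "f u = fps_nth (\<gamma> u) t" for u
    have c: "finite {u. c t u \<noteq> 0}" "{u. c t u \<noteq> 0} \<subseteq> idx" "\<And>u. c t u \<in> Zq"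
      using rep[of t] unfolding fin_rep_def by blast+
    have fZ: "fps_nth (\<gamma> u) s \<in> Zq" if "u \<in> idx" for u s
      using \<gamma> that by (simp add: coeff_families_def)
    have u0: "u0 \<in> idx"
    proof (rule ccontr)
      assume "u0 \<notin> idx"
      then have "\<gamma> u0 = 0" "c t u0 = 0"
        using \<gamma> c(2) unfolding coeff_families_def by blast+
      then show False
        using ne by simp
    qed
    have null: "finite {u \<in> idx. \<epsilon> \<le> pabs (f u)}" if "0 < \<epsilon>" for \<epsilon>
    proof -
      have "finite {u \<in> idx. \<epsilon> * (1 / real p) ^ t \<le> \<bar>pinorm p (\<gamma> u)\<bar>}"
        using \<gamma> that by (auto simp: coeff_families_def tendsto_idx_iff)
      moreover have "\<epsilon> * (1 / real p) ^ t \<le> \<bar>pinorm p (\<gamma> u)\<bar>" if "u \<in> idx" "\<epsilon> \<le> pabs (f u)" for u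
      proof -
        have "\<epsilon> * (1 / real p) ^ t \<le> pabs (f u) * (1 / real p) ^ t"
          using that by (intro mult_right_mono) auto
        also have "\<dots> \<le> pinorm p (\<gamma> u)"
          unfolding f_def using fZ[OF that(1)] by (rule fps_nth_le_pinorm)
        finally show ?thesis
          by simp
      qed
      ultimately show ?thesis
        by (elim finite_subset[rotated]) auto
    qed
    \<comment> \<open>Half the alleged difference: \<open>T\<close> leaves out only terms of size
      below b, so the comparison bounds the difference by its own half.\<close>
    define b where "b = pabs (f u0 - c t u0) / 2"
    have b: "0 < b"
      using ne by (simp add: b_def f_def)
    define T where "T = insert u0 ({u \<in> idx. b \<le> pabs (f u)} \<union> {u. c t u \<noteq> 0})"
    have T: "finite T" "T \<subseteq> idx"
      using null[OF b] c u0 by (auto simp: T_def)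
    have "pabs (f u0 - c t u0) \<le> b"
    proof (rule combination_coeff_bound[OF T, where m = m and e = "\<lambda>u. f u - c t u"])
      fix x assume x: "x \<in> domain m"
      have fB: "pabs (f u * B m u x) \<le> pabs (f u)" if "u \<in> idx" for u
        using pabs_mult_le[OF order_refl B_integral[OF that x], of "f u"] by simp
      have "pabs (infsum (\<lambda>u. f u * B m u x) idx - (\<Sum>u\<in>T. f u * B m u x)) \<le> b"
      proof (rule infsum_approx[OF _ T _ b])
        show "finite {u \<in> idx. \<epsilon> \<le> pabs (f u * B m u x)}" if "0 < \<epsilon>" for \<epsilon>
          by (rule finite_subset[OF _ null[OF that]]) (use fB in \<open>force intro: order_trans\<close>)
        show "pabs (f u * B m u x) \<le> b" if "u \<in> idx - T" for u
          using fB[of u] that by (auto simp: T_def)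
      qed
      moreover have "infsum (\<lambda>u. f u * B m u x) idx = fps_nth (\<xi> x) t"
        using \<gamma> x by (simp add: expansion_def f_def)
      moreover have "fps_nth (\<xi> x) t = (\<Sum>u\<in>T. c t u * B m u x)"
        by (rule fin_rep_sum_superset[OF rep x T(1)]) (auto simp: T_def)
      ultimately show "pabs (\<Sum>u\<in>T. (f u - c t u) * B m u x) \<le> b"
        by (simp add: sum_subtractf left_diff_distrib pabs_diff_commute)
    qed (use b T_def in auto)
    then show False
      using b unfolding b_def by linarith
  qed
  then show "\<gamma> = (\<lambda>u. Abs_fps (\<lambda>t. c t u))"
    by (simp add: fun_eq_iff fps_eq_iff)
qed

section \<open>Multiplication and Frobenius\<close>

text \<open>The bound concerns nonzero coefficients only, so \<open>\<phi> u\<close> = 0 says that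
  \<open>u\<close> does not occur: \<open>\<phi>\<close> records supports and sizes
  together.\<close>

definition rep_le :: "nat \<Rightarrow> (nat \<times> nat \<Rightarrow> real) \<Rightarrow> ('k \<Rightarrow> 'k) \<Rightarrow> bool" where
  "rep_le m \<phi> g \<longleftrightarrow> (\<exists>c. fin_rep m c g \<and> (\<forall>u. c u \<noteq> 0 \<longrightarrow> pabs (c u) \<le> \<phi> u))"

lemma fin_repI:
  assumes "finite T" "T \<subseteq> idx" "\<And>u. u \<in> T \<Longrightarrow> c u \<in> Zq" "\<And>u. u \<notin> T \<Longrightarrow> c u = 0"
    and g: "\<And>x. x \<in> domain m \<Longrightarrow> g x = (\<Sum>u\<in>T. c u * B m u x)"
  shows "fin_rep m c g"
  unfolding fin_rep_def
proof (intro conjI allI ballI)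
  have sub: "{u. c u \<noteq> 0} \<subseteq> T"
    using assms(4) by blast
  then show "finite {u. c u \<noteq> 0}" "{u. c u \<noteq> 0} \<subseteq> idx"
    using assms finite_subset by blast+
  show "c u \<in> Zq" for u
    using assms(3,4) by (cases "u \<in> T") auto
  show "g x = (\<Sum>u | c u \<noteq> 0. c u * B m u x)" if "x \<in> domain m" for x
    unfolding g[OF that] using sub assms(1) by (intro sum.mono_neutral_right) auto
qed

lemma fin_repD:
  assumes "fin_rep m c g"
  shows "finite {u. c u \<noteq> 0}" "c u \<noteq> 0 \<Longrightarrow> u \<in> idx" "c u \<in> Zq"
    "x \<in> domain m \<Longrightarrow> g x = (\<Sum>u | c u \<noteq> 0. c u * B m u x)"
  using assms unfolding fin_rep_def by blast+

lemma rep_le_cong: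
  assumes "rep_le m \<phi> f" "\<And>x. x \<in> domain m \<Longrightarrow> g x = f x"
  shows "rep_le m \<phi> g"
proof -
  obtain c where c: "fin_rep m c f" "\<forall>u. c u \<noteq> 0 \<longrightarrow> pabs (c u) \<le> \<phi> u"
    using assms(1) unfolding rep_le_def by blast
  have "fin_rep m c g"
    using c(1) assms(2) by (simp add: fin_rep_def)
  then show ?thesis
    using c(2) unfolding rep_le_def by blast
qed

lemma rep_le_mono:
  assumes "rep_le m \<phi> g" "\<And>u. \<phi> u \<le> \<psi> u"
  shows "rep_le m \<psi> g"
  using assms unfolding rep_le_def by (meson order_trans)

lemma rep_le_zero: "rep_le m \<phi> (\<lambda>x. 0)"
  unfolding rep_le_def by (intro exI[of _ "\<lambda>u. 0"]) (auto simp: fin_rep_def)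

lemma rep_le_add:
  assumes "rep_le m \<phi> f" "rep_le m \<phi> g"
  shows "rep_le m \<phi> (\<lambda>x. f x + g x)"
proof -
  obtain c where c: "fin_rep m c f" "\<And>u. c u \<noteq> 0 \<Longrightarrow> pabs (c u) \<le> \<phi> u"
    using assms(1) unfolding rep_le_def by blast
  obtain e where e: "fin_rep m e g" "\<And>u. e u \<noteq> 0 \<Longrightarrow> pabs (e u) \<le> \<phi> u"
    using assms(2) unfolding rep_le_def by blast
  let ?T = "{u. c u \<noteq> 0} \<union> {u. e u \<noteq> 0}"
  have T: "finite ?T"
    using fin_repD(1)[OF c(1)] fin_repD(1)[OF e(1)] by simp
  have "fin_rep m (\<lambda>u. c u + e u) (\<lambda>x. f x + g x)"
  proof (rule fin_repI[OF T])
    show "?T \<subseteq> idx"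
      using fin_repD(2)[OF c(1)] fin_repD(2)[OF e(1)] by blast
    show "f x + g x = (\<Sum>u\<in>?T. (c u + e u) * B m u x)" if "x \<in> domain m" for x
      using fin_rep_sum_superset[OF c(1) that T] fin_rep_sum_superset[OF e(1) that T]
      by (simp add: sum.distrib distrib_right)
  qed (use fin_repD(3)[OF c(1)] fin_repD(3)[OF e(1)] in \<open>auto intro: Zq_add\<close>)
  moreover have "pabs (c u + e u) \<le> \<phi> u" if "c u + e u \<noteq> 0" for u
    using that c(2)[of u] e(2)[of u] pabs_add_le[of "c u" "\<phi> u" "e u"]
    by (cases "c u = 0"; cases "e u = 0") auto
  ultimately show ?thesis
    unfolding rep_le_def by blast
qed

lemma rep_le_sum:
  assumes "\<And>i. i \<in> I \<Longrightarrow> rep_le m \<phi> (f i)"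
  shows "rep_le m \<phi> (\<lambda>x. \<Sum>i\<in>I. f i x)"
  using assms
  by (induction I rule: infinite_finite_induct) (auto intro: rep_le_zero rep_le_add)

lemma rep_le_scale:
  assumes g: "rep_le m \<phi> g" and z: "z \<in> Zq" and le: "\<And>u. u \<in> idx \<Longrightarrow> z \<noteq> 0 \<Longrightarrow> pabs z * \<phi> u \<le> \<psi> u"
  shows "rep_le m \<psi> (\<lambda>x. z * g x)"
proof -
  obtain c where c: "fin_rep m c g" "\<And>u. c u \<noteq> 0 \<Longrightarrow> pabs (c u) \<le> \<phi> u"
    using g unfolding rep_le_def by blast
  have "fin_rep m (\<lambda>u. z * c u) (\<lambda>x. z * g x)"
    by (rule fin_repI[OF fin_repD(1)[OF c(1)]])
       (use fin_repD[OF c(1)] z in \<open>auto simp: sum_distrib_left mult.assoc intro: Zq_mult\<close>)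
  moreover have "pabs (z * c u) \<le> \<psi> u" if "z * c u \<noteq> 0" for u
  proof -
    have "pabs z * pabs (c u) \<le> pabs z * \<phi> u"
      using c(2)[of u] that by (intro mult_left_mono) auto
    also have "\<dots> \<le> \<psi> u"
      using le[of u] fin_repD(2)[OF c(1), of u] that by simp
    finally show ?thesis
      by (simp add: pabs_mult)
  qed
  ultimately show ?thesis
    unfolding rep_le_def by blast
qed

lemma rep_le_linear:
  assumes c: "fin_rep m c g"
    and h: "\<And>u. c u \<noteq> 0 \<Longrightarrow> rep_le m' (\<psi> u) (h u)"
    and le: "\<And>u w. c u \<noteq> 0 \<Longrightarrow> w \<in> idx \<Longrightarrow> pabs (c u) * \<psi> u w \<le> \<theta> w"
  shows "rep_le m' \<theta> (\<lambda>x. \<Sum>u | c u \<noteq> 0. c u * h u x)"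
  by (intro rep_le_sum rep_le_scale[where \<phi> = "\<psi> _"]) (use assms fin_repD(3)[OF c] in auto)

text \<open>For i = 0 the function is 1, which is indexed by (0, 1) whatever the pole; hence the
  case distinction.\<close>

lemma rep_le_B:
  assumes j: "j \<in> {1..l}" and \<phi>: "1 \<le> \<phi> (if i = 0 then (0, 1) else (i, j))"
  shows "rep_le m \<phi> (B m (i, j))"
proof -
  let ?u = "if i = 0 then (0, 1) else (i, j)"
  have "fin_rep m (\<lambda>u. if u = ?u then 1 else 0) (B m (i, j))"
  proof (rule fin_repI[of "{?u}"])
    show "{?u} \<subseteq> idx"
      using j idx_infinity(1)[of 0] by (auto intro: idx_finite)
    show "B m (i, j) x = (\<Sum>u\<in>{?u}. (if u = ?u then 1 else 0) * B m u x)" for x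
      by (simp add: B_0)
  qed auto
  then show ?thesis
    using \<phi> unfolding rep_le_def by (intro exI[of _ "\<lambda>u. if u = ?u then 1 else 0"]) auto
qed

lemma d_pos: "j \<in> {1..l} \<Longrightarrow> 0 < d j"
  using d_ge_1[of j] by simp

lemma weight_index: "weight (if i = 0 then (0, 1) else (i, j)) = real i / real (d j)"
  by (simp add: weight_def)

abbreviation weight_le :: "real \<Rightarrow> nat \<times> nat \<Rightarrow> real" where
  "weight_le s u \<equiv> if weight u \<le> s then 1 else 0"

lemma rep_le_B_weight:
  assumes "j \<in> {1..l}" "real i / real (d j) \<le> s"
  shows "rep_le m (weight_le s) (B m (i, j))"
  using assms by (intro rep_le_B) (auto simp: weight_index simp del: One_nat_def)

lemma rep_le_weight_mono: "rep_le m (weight_le s) g \<Longrightarrow> s \<le> s' \<Longrightarrow> rep_le m (weight_le s') g"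
  by (erule rep_le_mono) auto

lemma rep_le_weight_scale: "rep_le m (weight_le s) g \<Longrightarrow> z \<in> Zq \<Longrightarrow> rep_le m (weight_le s) (\<lambda>x. z * g x)"
  by (erule rep_le_scale) (auto simp: Zq_iff)

text \<open>Partial fractions: 1/((x - P)(x - Q)) splits with the factor 1/(P - Q), integral because
  P - Q is a unit; at infinity x/(x - Q) = 1 + Q/(x - Q). Each step lowers at least one of the
  orders and raises neither, so weights do not rise.\<close>

lemma rep_le_B_mult_distinct:
  assumes j: "j \<in> {1..l}" and k: "k \<in> {2..l}" and "j \<noteq> k"
  shows "rep_le m (weight_le (real i / real (d j) + real n / real (d k))) (\<lambda>x. B m (i, j) x * B m (n, k) x)"
proof (induction "i + n" arbitrary: i n rule: less_induct)
  case less
  let ?s = "real i / real (d j) + real n / real (d k)"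
  have k1: "k \<in> {1..l}"
    using k by auto
  show ?case
  proof (cases "i = 0 \<or> n = 0")
    case True
    then show ?thesis
      using rep_le_B_weight[OF j, of i ?s m] rep_le_B_weight[OF k1, of n ?s m]
      by (auto simp: B_0)
  next
    case False
    then obtain i' n' where in': "i = Suc i'" "n = Suc n'"
      by (meson not0_implies_Suc)
    have r1: "rep_le m (weight_le ?s) (\<lambda>x. B m (i, j) x * B m (n', k) x)"
      by (rule rep_le_weight_mono[OF less]) (auto simp: in' divide_right_mono)
    have r2: "rep_le m (weight_le ?s) (\<lambda>x. B m (i', j) x * B m (n, k) x)"
      by (rule rep_le_weight_mono[OF less]) (auto simp: in' divide_right_mono)
    have r3: "rep_le m (weight_le ?s) (\<lambda>x. B m (i', j) x * B m (n', k) x)"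
      by (rule rep_le_weight_mono[OF less]) (auto simp: in' divide_right_mono intro!: add_mono)
    show ?thesis
    proof (cases "j = 1")
      case True
      have "rep_le m (weight_le ?s) (\<lambda>x. B m (i', j) x * B m (n', k) x + pt m k * (B m (i', j) x * B m (n, k) x))"
        by (intro rep_le_add r3 rep_le_weight_scale r2 pt_Zq k)
      then show ?thesis
      proof (rule rep_le_cong)
        fix x assume x: "x \<in> domain m"
        then show "B m (i, j) x * B m (n, k) x =
            B m (i', j) x * B m (n', k) x + pt m k * (B m (i', j) x * B m (n, k) x)"
          using domain_neq_pt[OF x k] k True in' by (simp add: B_infinity B_finite divide_simps) (simp add: algebra_simps)
      qed
    next
      case False
      then have j2: "j \<in> {2..l}"
        using j by auto
      let ?z = "1 / (pt m j - pt m k)"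
      have z: "?z \<in> Zq"
        using pt_diff[OF j2 k \<open>j \<noteq> k\<close>] pt_Zq[OF j2] pt_Zq[OF k]
        by (auto simp: Zq_iff pabs_divide intro!: Qq_closed)
      have "rep_le m (weight_le ?s) (\<lambda>x. ?z * (B m (i, j) x * B m (n', k) x) + (- ?z) * (B m (i', j) x * B m (n, k) x))"
        by (intro rep_le_add rep_le_weight_scale r1 r2 z Zq_minus)
      then show ?thesis
      proof (rule rep_le_cong)
        fix x assume x: "x \<in> domain m"
        let ?P = "pt m j" and ?Q = "pt m k"
        have ne: "x - ?P \<noteq> 0" "x - ?Q \<noteq> 0" "?P - ?Q \<noteq> 0"
          using domain_neq_pt[OF x j2] domain_neq_pt[OF x k] pt_diff[OF j2 k \<open>j \<noteq> k\<close>, of m] by fastforce+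
        have "1 / (x - ?P) * (1 / (x - ?Q)) = ?z * (1 / (x - ?P)) + (- ?z) * (1 / (x - ?Q))"
          using ne by (simp add: divide_simps)
        then have "1 / (x - ?P) ^ i' * (1 / (x - ?Q) ^ n') * (1 / (x - ?P) * (1 / (x - ?Q))) =
            1 / (x - ?P) ^ i' * (1 / (x - ?Q) ^ n') * (?z * (1 / (x - ?P)) + (- ?z) * (1 / (x - ?Q)))"
          by (simp only:)
        then show "B m (i, j) x * B m (n, k) x =
            ?z * (B m (i, j) x * B m (n', k) x) + (- ?z) * (B m (i', j) x * B m (n, k) x)"
          using j2 k in' by (simp add: B_finite algebra_simps)
      qed
    qed
  qed
qed

lemma rep_le_B_mult:
  assumes "u \<in> idx" "w \<in> idx"
  shows "rep_le m (weight_le (weight u + weight w)) (\<lambda>x. B m u x * B m w x)"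
proof -
  obtain i j n k where uw: "u = (i, j)" "w = (n, k)"
    by (cases u, cases w)
  have jk: "j \<in> {1..l}" "k \<in> {1..l}"
    using assms l_ge_2 by (auto simp: uw idx_def)
  show ?thesis
  proof (cases "j = k")
    case True
    have "rep_le m (weight_le (weight u + weight w)) (B m (i + n, j))"
      using jk by (intro rep_le_B_weight) (auto simp: uw True weight_def add_divide_distrib)
    then show ?thesis
      by (rule rep_le_cong) (simp add: uw True B_add)
  next
    case False
    then consider "k \<in> {2..l}" | "j \<in> {2..l}"
      using jk by fastforce
    then show ?thesis
    proof cases
      case 1
      show ?thesis
        using rep_le_B_mult_distinct[OF jk(1) 1 False, of m i n] by (simp add: uw weight_def)
    next
      case 2
      show ?thesis
        using rep_le_B_mult_distinct[OF jk(2) 2, of m n i] False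
        by (simp add: uw weight_def mult.commute add.commute)
    qed
  qed
qed

section \<open>p-orders that grow with the weight\<close>

text \<open>The condition that the p-order at \<open>u\<close> be at least N +
  \<open>\<kappa>\<close> \<open>weight u\<close>, written as a bound for the absolute
  value.\<close>

definition level :: "real \<Rightarrow> real \<Rightarrow> nat \<times> nat \<Rightarrow> real" where
  "level \<kappa> N u = real p powr (- (N + \<kappa> * weight u))"

lemma level_ge_1: "N + \<kappa> * weight u \<le> 0 \<Longrightarrow> 1 \<le> level \<kappa> N u"
  unfolding level_def using p_gt_1 by (intro ge_one_powr_ge_zero) auto

text \<open>A product of basis functions involves only weights up to the sum of the two weights, and
  for \<open>\<kappa> \<ge> 0\<close> a smaller weight means a weaker condition.\<close>

lemma rep_le_mult:
  assumes "0 \<le> \<kappa>" and f: "rep_le m (level \<kappa> N) f" and g: "rep_le m (level \<kappa> N') g"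
  shows "rep_le m (level \<kappa> (N + N')) (\<lambda>x. f x * g x)"
proof -
  obtain c where c: "fin_rep m c f" "\<And>u. c u \<noteq> 0 \<Longrightarrow> pabs (c u) \<le> level \<kappa> N u"
    using f unfolding rep_le_def by blast
  obtain e where e: "fin_rep m e g" "\<And>u. e u \<noteq> 0 \<Longrightarrow> pabs (e u) \<le> level \<kappa> N' u"
    using g unfolding rep_le_def by blast
  have "rep_le m (level \<kappa> (N + N'))
      (\<lambda>x. \<Sum>u | c u \<noteq> 0. \<Sum>w | e w \<noteq> 0. (c u * e w) * (B m u x * B m w x))"
  proof (intro rep_le_sum)
    fix u w assume "u \<in> {u. c u \<noteq> 0}" "w \<in> {w. e w \<noteq> 0}"
    then have u: "c u \<noteq> 0" "u \<in> idx" and w: "e w \<noteq> 0" "w \<in> idx"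
      using fin_repD(2)[OF c(1)] fin_repD(2)[OF e(1)] by auto
    show "rep_le m (level \<kappa> (N + N')) (\<lambda>x. (c u * e w) * (B m u x * B m w x))"
    proof (rule rep_le_scale[OF rep_le_B_mult[OF u(2) w(2)]])
      show "c u * e w \<in> Zq"
        using fin_repD(3)[OF c(1)] fin_repD(3)[OF e(1)] by (intro Zq_mult)
      fix v
      show "pabs (c u * e w) * weight_le (weight u + weight w) v \<le> level \<kappa> (N + N') v"
      proof (cases "weight v \<le> weight u + weight w")
        case True
        have "pabs (c u * e w) \<le> level \<kappa> N u * level \<kappa> N' w"
          using c(2)[OF u(1)] e(2)[OF w(1)] by (rule pabs_mult_le)
        also have "\<dots> = real p powr (- (N + N' + \<kappa> * (weight u + weight w)))"
          by (simp add: level_def powr_add[symmetric] algebra_simps)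
        also have "\<dots> \<le> level \<kappa> (N + N') v"
          unfolding level_def using p_gt_1 mult_left_mono[OF True \<open>0 \<le> \<kappa>\<close>]
          by (intro powr_mono) auto
        finally show ?thesis
          using True by simp
      qed (simp add: level_def)
    qed
  qed
  then show ?thesis
  proof (rule rep_le_cong)
    fix x assume "x \<in> domain m"
    then show "f x * g x = (\<Sum>u | c u \<noteq> 0. \<Sum>w | e w \<noteq> 0. (c u * e w) * (B m u x * B m w x))"
      using fin_repD(4)[OF c(1)] fin_repD(4)[OF e(1)]
      by (simp add: sum_product mult_ac)
  qed
qed

definition fps_rep :: "nat \<Rightarrow> (nat \<Rightarrow> nat \<times> nat \<Rightarrow> real) \<Rightarrow> ('k \<Rightarrow> 'k fps) \<Rightarrow> bool" where
  "fps_rep m \<Phi> \<xi> \<longleftrightarrow> (\<forall>t. rep_le m (\<Phi> t) (\<lambda>x. fps_nth (\<xi> x) t))"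

text \<open>Each factor \<pi> is credited with p-order \<open>\<kappa>\<close>; with
  \<open>\<kappa>\<close> = c this is the (\<pi>^(1/c), p)-adic order.\<close>

definition fps_level :: "real \<Rightarrow> real \<Rightarrow> nat \<Rightarrow> nat \<times> nat \<Rightarrow> real" where
  "fps_level \<kappa> N t = level \<kappa> (N - \<kappa> * real t)"

lemma fps_rep_mult:
  assumes "0 \<le> \<kappa>" "fps_rep m (fps_level \<kappa> N) \<xi>" "fps_rep m (fps_level \<kappa> N') \<eta>"
  shows "fps_rep m (fps_level \<kappa> (N + N')) (\<lambda>x. \<xi> x * \<eta> x)"
  unfolding fps_rep_def fps_mult_nth
proof (intro allI rep_le_sum)
  fix t s :: nat assume s: "s \<in> {0..t}"
  have "rep_le m (level \<kappa> ((N - \<kappa> * real s) + (N' - \<kappa> * real (t - s))))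
      (\<lambda>x. fps_nth (\<xi> x) s * fps_nth (\<eta> x) (t - s))"
    using assms by (intro rep_le_mult) (auto simp: fps_rep_def fps_level_def)
  then show "rep_le m (fps_level \<kappa> (N + N') t) (\<lambda>x. fps_nth (\<xi> x) s * fps_nth (\<eta> x) (t - s))"
    using s by (simp add: fps_level_def algebra_simps of_nat_diff)
qed

lemma fps_rep_const_B:
  assumes "u \<in> idx"
  shows "fps_rep m (fps_level \<kappa> (- (\<kappa> * weight u))) (\<lambda>x. fps_const (B m u x))"
  unfolding fps_rep_def
proof
  fix t
  obtain i j where ij: "u = (i, j)" "i = 0 \<Longrightarrow> j = 1" "j \<in> {1..l}"
    using assms l_ge_2 by (cases u) (auto simp: idx_def)
  show "rep_le m (fps_level \<kappa> (- (\<kappa> * weight u)) t) (\<lambda>x. fps_nth (fps_const (B m u x)) t)"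
  proof (cases "t = 0")
    case True
    have "rep_le m (level \<kappa> (- (\<kappa> * weight u))) (B m (i, j))"
      using ij by (intro rep_le_B level_ge_1) (auto simp: weight_index weight_def simp del: One_nat_def)
    then show ?thesis
      by (simp add: True ij(1) fps_level_def)
  qed (simp add: rep_le_zero)
qed

lemma fps_rep_1: "fps_rep m (fps_level \<kappa> 0) (\<lambda>x. 1)"
  using fps_rep_const_B[OF idx_infinity(1)[of 0], of m \<kappa>] by (simp add: B_0 weight_def)

lemma fps_rep_prod:
  assumes "0 \<le> \<kappa>" "\<And>i. i \<in> I \<Longrightarrow> fps_rep m (fps_level \<kappa> 0) (\<xi> i)"
  shows "fps_rep m (fps_level \<kappa> 0) (\<lambda>x. \<Prod>i\<in>I. \<xi> i x)"
  using assms(2)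
proof (induction I rule: infinite_finite_induct)
  case (insert i I)
  then show ?case
    using fps_rep_mult[OF assms(1), of m 0 "\<xi> i" 0] by simp
qed (simp_all add: fps_rep_1)

lemma artin_hasse_Zq: "fps_nth (artin_hasse p) t \<in> Zq"
proof -
  have "fps_nth (artin_hasse p) t \<in> Zp"
    using artin_hasse_rational[OF p_gt_0, where 'a='k] artin_hasse_integral Rats_subset_padic
    by (auto simp: Zp_iff)
  then show ?thesis
    using Zp_subset_Zq by blast
qed

text \<open>In each factor the coefficient of \<open>\<pi>^t\<close> is an integral multiple of the
  basis function of order i t at the pole j. Its weight i t / d j is at most t because i <= d j, so
  the credit of \<pi> pays for it.\<close>

lemma fps_rep_F:
  assumes "0 \<le> \<kappa>"
  shows "fps_rep 0 (fps_level \<kappa> 0) F"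
  unfolding F_def
proof (intro fps_rep_prod[OF assms])
  fix j i assume j: "j \<in> {1..l}" and i: "i \<in> {1..d j}"
  show "fps_rep 0 (fps_level \<kappa> 0) (\<lambda>x. artin_hasse p oo fps_const (A i j * B 0 (i, j) x) * fps_X)"
    unfolding fps_rep_def
  proof
    fix t
    have wt: "real (i * t) / real (d j) \<le> real t"
      using i d_pos[OF j] mult_right_mono[of "real i" "real (d j)" "real t"]
      by (simp add: divide_le_eq mult.commute)
    have "rep_le 0 (fps_level \<kappa> 0 t) (\<lambda>x. (fps_nth (artin_hasse p) t * A i j ^ t) * B 0 (i * t, j) x)"
    proof (rule rep_le_scale)
      show "rep_le 0 (fps_level \<kappa> 0 t) (B 0 (i * t, j))"
      proof -
        have "0 - \<kappa> * real t + \<kappa> * weight (if i * t = 0 then (0, 1) else (i * t, j)) \<le> 0"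
          using mult_left_mono[OF wt assms] unfolding weight_index by simp
        then show ?thesis
          unfolding fps_level_def by (rule rep_le_B[OF j level_ge_1])
      qed
      show z: "fps_nth (artin_hasse p) t * A i j ^ t \<in> Zq"
        using A_integral[OF j i] by (intro Zq_mult Zq_power artin_hasse_Zq)
      show "pabs (fps_nth (artin_hasse p) t * A i j ^ t) * fps_level \<kappa> 0 t u \<le> fps_level \<kappa> 0 t u" for u
        using z by (intro mult_left_le_one_le) (auto simp: Zq_iff fps_level_def level_def)
    qed
    then show "rep_le 0 (fps_level \<kappa> 0 t)
        (\<lambda>x. fps_nth (artin_hasse p oo fps_const (A i j * B 0 (i, j) x) * fps_X) t)"
      by (rule rep_le_cong)
         (simp add: fps_compose_linear, simp add: power_mult_distrib B_mult_power mult_ac)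
  qed
qed

lemma fps_rep_choose:
  assumes "fps_rep m \<Phi> \<xi>"
  shows "\<exists>c. \<forall>t. fin_rep m (c t) (\<lambda>x. fps_nth (\<xi> x) t) \<and> (\<forall>u. c t u \<noteq> 0 \<longrightarrow> pabs (c t u) \<le> \<Phi> t u)"
  using assms unfolding fps_rep_def rep_le_def by (rule choice)

lemma fps_rep_coeffs_of:
  assumes "fps_rep m \<Phi> \<xi>" "fps_nth (coeffs_of m \<xi> u) t \<noteq> 0"
  shows "pabs (fps_nth (coeffs_of m \<xi> u) t) \<le> \<Phi> t u"
proof -
  obtain c where c: "\<And>t. fin_rep m (c t) (\<lambda>x. fps_nth (\<xi> x) t)"
    "\<And>t u. c t u \<noteq> 0 \<Longrightarrow> pabs (c t u) \<le> \<Phi> t u"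
    using fps_rep_choose[OF assms(1)] by blast
  show ?thesis
    using c(2) assms(2) by (simp add: coeffs_of_eq[OF c(1)])
qed

lemma fps_rep_fin_rep:
  assumes "fps_rep m \<Phi> \<xi>"
  shows "fin_rep m (\<lambda>u. fps_nth (coeffs_of m \<xi> u) t) (\<lambda>x. fps_nth (\<xi> x) t)"
proof -
  obtain c where c: "\<And>t. fin_rep m (c t) (\<lambda>x. fps_nth (\<xi> x) t)"
    using fps_rep_choose[OF assms] by blast
  show ?thesis
    using c[of t] by (simp add: coeffs_of_eq[OF c])
qed

text \<open>One statement serves \<open>\<tau>\<close> and its inverse: an isometry of
  \<open>Qq\<close> keeps supports, integrality and bounds. The infinite sum describing \<eta> is
  finite for each power of \<pi>.\<close>

lemma fps_rep_map:
  assumes \<xi>: "fps_rep m \<Phi> \<xi>"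
    and \<sigma>: "\<And>z. z \<in> Qq \<Longrightarrow> \<sigma> z \<in> Qq" "\<And>z. z \<in> Qq \<Longrightarrow> pabs (\<sigma> z) = pabs z"
    and \<eta>: "\<And>x t. fps_nth (\<eta> x) t = (\<Sum>\<^sub>\<infinity>u\<in>idx. \<sigma> (fps_nth (coeffs_of m \<xi> u) t) * B m' u x)"
  shows "fin_rep m' (\<lambda>u. \<sigma> (fps_nth (coeffs_of m \<xi> u) t)) (\<lambda>x. fps_nth (\<eta> x) t)"
    and "fps_rep m' \<Phi> \<eta>"
proof -
  define c where "c t u = fps_nth (coeffs_of m \<xi> u) t" for t u
  have c: "fin_rep m (c t) (\<lambda>x. fps_nth (\<xi> x) t)" for t
    unfolding c_def by (rule fps_rep_fin_rep[OF \<xi>])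
  have c_Zq: "c t u \<in> Qq" "pabs (c t u) \<le> 1" for t u
    using fin_repD(3)[OF c] by (simp_all add: Zq_iff)
  have "\<sigma> 0 = 0"
    using \<sigma>(2)[OF Qq_closed(1)] by simp
  have rep: "fin_rep m' (\<lambda>u. \<sigma> (c t u)) (\<lambda>x. fps_nth (\<eta> x) t)" for t
  proof (rule fin_repI[OF fin_repD(1)[OF c]])
    show "{u. c t u \<noteq> 0} \<subseteq> idx"
      using fin_repD(2)[OF c] by blast
    show "fps_nth (\<eta> x) t = (\<Sum>u | c t u \<noteq> 0. \<sigma> (c t u) * B m' u x)" for x
    proof -
      have "fps_nth (\<eta> x) t = (\<Sum>\<^sub>\<infinity>u\<in>{u. c t u \<noteq> 0}. \<sigma> (c t u) * B m' u x)"
        unfolding \<eta> c_def[symmetric]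
        using fin_repD(2)[OF c] \<open>\<sigma> 0 = 0\<close> by (intro infsum_cong_neutral) auto
      then show ?thesis
        using fin_repD(1)[OF c] by simp
    qed
  qed (use \<sigma> c_Zq \<open>\<sigma> 0 = 0\<close> in \<open>auto simp: Zq_iff\<close>)
  then show "fin_rep m' (\<lambda>u. \<sigma> (fps_nth (coeffs_of m \<xi> u) t)) (\<lambda>x. fps_nth (\<eta> x) t)"
    by (simp add: c_def)
  have "pabs (\<sigma> (c t u)) \<le> \<Phi> t u" if ne: "\<sigma> (c t u) \<noteq> 0" for t u
  proof -
    have "c t u \<noteq> 0"
      using ne \<open>\<sigma> 0 = 0\<close> by metis
    then show ?thesis
      using fps_rep_coeffs_of[OF \<xi>, of u t] \<sigma>(2)[OF c_Zq(1)] by (simp add: c_def)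
  qed
  then show "fps_rep m' \<Phi> \<eta>"
    using rep unfolding fps_rep_def rep_le_def by blast
qed

lemma fps_nth_frob:
  "fps_nth (frob m \<xi> x) t = (\<Sum>\<^sub>\<infinity>u\<in>idx. \<tau> (fps_nth (coeffs_of m \<xi> u) t) * B (Suc m) u x)"
  by (simp add: frob_def expansion_def)

lemma fps_nth_inv_frob:
  "fps_nth (inv_frob m \<xi> x) t =
    (\<Sum>\<^sub>\<infinity>u\<in>idx. inv_into Qq \<tau> (fps_nth (coeffs_of (Suc m) \<xi> u) t) * B m u x)"
  by (simp add: inv_frob_def expansion_def)

lemmas fps_rep_frob = fps_rep_map[OF _ frob_in_Qq pabs_frob fps_nth_frob]
lemmas fps_rep_inv_frob = fps_rep_map[OF _ inv_frob_in_Qq pabs_inv_frob fps_nth_inv_frob]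

lemma fps_rep_frob_pow:
  assumes "0 \<le> \<kappa>"
  shows "fps_rep m (fps_level \<kappa> 0) (frob_pow m F)"
  by (induction m) (auto intro: fps_rep_F[OF assms] fps_rep_frob(2))

section \<open>The operators\<close>

text \<open>Exact coefficients are kept here, not just bounds, because the nonvanishing of a leading
  coefficient has to be traced through \<open>U\<close>.\<close>

lemma fin_rep_linear:
  assumes c: "fin_rep m c g" and e: "\<And>u. c u \<noteq> 0 \<Longrightarrow> fin_rep m' (e u) (h u)"
  shows "fin_rep m' (\<lambda>w. \<Sum>u | c u \<noteq> 0. c u * e u w) (\<lambda>x. \<Sum>u | c u \<noteq> 0. c u * h u x)"
proof (rule fin_repI[of "\<Union>u\<in>{u. c u \<noteq> 0}. {w. e u w \<noteq> 0}"])
  let ?T = "\<Union>u\<in>{u. c u \<noteq> 0}. {w. e u w \<noteq> 0}"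
  show T: "finite ?T"
    using fin_repD(1)[OF c] fin_repD(1)[OF e] by auto
  show "?T \<subseteq> idx"
    using fin_repD(2)[OF e] by auto
  show "(\<Sum>u | c u \<noteq> 0. c u * e u w) \<in> Zq" for w
    using fin_repD(3)[OF c] fin_repD(3)[OF e] by (intro Zq_sum Zq_mult) auto
  show "(\<Sum>u | c u \<noteq> 0. c u * e u w) = 0" if "w \<notin> ?T" for w
    using that by (intro sum.neutral) auto
  show "(\<Sum>u | c u \<noteq> 0. c u * h u x) = (\<Sum>w\<in>?T. (\<Sum>u | c u \<noteq> 0. c u * e u w) * B m' w x)"
    if x: "x \<in> domain m'" for x
  proof -
    have "(\<Sum>u | c u \<noteq> 0. c u * h u x) = (\<Sum>u | c u \<noteq> 0. c u * (\<Sum>w\<in>?T. e u w * B m' w x))"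
      using fin_rep_sum_superset[OF e x T] by (intro sum.cong) auto
    also have "\<dots> = (\<Sum>w\<in>?T. \<Sum>u | c u \<noteq> 0. c u * e u w * B m' w x)"
      unfolding sum_distrib_left by (subst sum.swap) (simp add: mult.assoc)
    finally show ?thesis
      by (simp add: sum_distrib_right)
  qed
qed

lemma avg_fin_rep:
  assumes c: "fin_rep m c g" and x: "x \<in> domain (Suc m)"
  shows "avg g x = (\<Sum>u | c u \<noteq> 0. c u * avg (B m u) x)"
proof -
  have "(\<Sum>z | z ^ p = x. g z) = (\<Sum>z | z ^ p = x. \<Sum>u | c u \<noteq> 0. c u * B m u z)"
    using domain_root[OF _ x] fin_repD(4)[OF c] by (intro sum.cong) auto
  also have "\<dots> = (\<Sum>u | c u \<noteq> 0. c u * (\<Sum>z | z ^ p = x. B m u z))"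
    unfolding sum_distrib_left by (rule sum.swap)
  finally have "avg g x = 1 / of_nat p * (\<Sum>u | c u \<noteq> 0. c u * (\<Sum>z | z ^ p = x. B m u z))"
    by (simp only: avg_def)
  also have "\<dots> = (\<Sum>u | c u \<noteq> 0. 1 / of_nat p * (c u * (\<Sum>z | z ^ p = x. B m u z)))"
    by (rule sum_distrib_left)
  finally show ?thesis
    by (simp only: avg_def mult.left_commute)
qed

lemma fps_nth_U: "fps_nth (U \<xi> x) t = avg (\<lambda>z. fps_nth (\<xi> z) t) x"
  by (simp add: U_def avg_def fps_sum_nth)

lemma avg_B_infinity:
  assumes "x \<noteq> 0"
  shows "avg (B m (n, 1)) x = (if p dvd n then x ^ (n div p) else 0)"
proof -
  have "(\<Sum>z | z ^ p = x. B m (n, 1) z) = (\<Sum>z | z ^ p = x. z ^ n)"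
    by (simp add: B_infinity)
  then show ?thesis
    by (simp add: avg_def sum_prime_roots_power[OF assms])
qed

lemma avg_B_finite:
  assumes j: "j \<in> {2..l}" and "0 < n" and x: "x \<in> domain (Suc m)"
  shows "avg (B m (n, j)) x = (\<Sum>i\<in>{1..n}. coeff (avg_poly_coeffs (pt m j) n) (n - i) * B (Suc m) (i, j) x)"
proof -
  let ?c = "pt m j"
  let ?X = "x - ?c ^ p"
  let ?G = "avg_poly_coeffs ?c n"
  have X: "?X \<noteq> 0"
    using domain_neq_pt[OF x j] by (simp add: pt_Suc)
  have "B m (n, j) z = poly (quot_poly ?c) z ^ n / ?X ^ n" if z: "z ^ p = x" for z
  proof -
    have eq: "(z - ?c) * poly (quot_poly ?c) z = ?X"
      using poly_quot_poly[of z ?c] z by simp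
    then have "z - ?c \<noteq> 0"
      using X by auto
    then have "poly (quot_poly ?c) z = ?X / (z - ?c)"
      using eq by (simp add: field_simps)
    then show ?thesis
      using X j by (simp add: B_finite power_divide)
  qed
  then have "avg (B m (n, j)) x = avg (\<lambda>z. poly (quot_poly ?c) z ^ n) x / ?X ^ n"
    by (simp add: avg_def sum_divide_distrib mult.commute)
  also have "avg (\<lambda>z. poly (quot_poly ?c) z ^ n) x = poly ?G ?X"
    using poly_avg_poly_coeffs[of ?c ?X n] domain_neq_0[OF x] by simp
  \<comment> \<open>Only k < n occurs, so after division by X^n the orders n - k run through 1, ...,
    n and no constant term arises.\<close>
  also have "\<dots> = (\<Sum>k\<le>n - 1. coeff ?G k * ?X ^ k)"
    unfolding poly_altdef using degree_avg_poly_coeffs[OF \<open>0 < n\<close>, of ?c]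
    by (intro sum.mono_neutral_left) (auto simp: coeff_eq_0)
  also have "\<dots> / ?X ^ n = (\<Sum>k\<le>n - 1. coeff ?G k * (1 / ?X ^ (n - k)))"
    unfolding sum_divide_distrib
  proof (intro sum.cong refl)
    fix k assume "k \<in> {..n - 1}"
    then have "?X ^ n = ?X ^ k * ?X ^ (n - k)"
      using \<open>0 < n\<close> by (simp flip: power_add)
    then show "coeff ?G k * ?X ^ k / ?X ^ n = coeff ?G k * (1 / ?X ^ (n - k))"
      using X by simp
  qed
  also have "\<dots> = (\<Sum>i\<in>{1..n}. coeff ?G (n - i) * B (Suc m) (i, j) x)"
    using \<open>0 < n\<close> j
    by (intro sum.reindex_bij_witness[of _ "\<lambda>i. n - i" "\<lambda>k. n - k"]) (auto simp: B_finite pt_Suc)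
  finally show ?thesis .
qed

text \<open>At a finite pole the entries are those of \<open>avg_poly_coeffs\<close>. At infinity
  the only possible entry is 1 at n / p, where the bound equals p. Nonvanishing starts at j = 3
  because the pole j = 2 is 0, where the leading entry vanishes.\<close>

lemma avg_B_fin_rep:
  assumes w: "(n, j) \<in> idx"
  obtains c where "fin_rep (Suc m) c (avg (B m (n, j)))"
    "\<And>i k. c (i, k) \<noteq> 0 \<Longrightarrow> k = j \<and> i \<le> n \<and> pabs (c (i, k)) \<le> real p powr (1 + real n / real p - real i)"
    "3 \<le> j \<Longrightarrow> c (n, j) \<noteq> 0"
  using w
proof (cases rule: idx_cases)
  case (1 i)
  then have j: "j = 1"
    by simp
  define c :: "nat \<times> nat \<Rightarrow> 'k" where "c u = (if p dvd n \<and> u = (n div p, 1) then 1 else 0)" for u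
  show thesis
  proof (rule that[of c])
    show "fin_rep (Suc m) c (avg (B m (n, j)))"
    proof (rule fin_repI[of "{(n div p, 1)}"])
      fix x assume "x \<in> domain (Suc m)"
      then have "avg (B m (n, 1)) x = (if p dvd n then x ^ (n div p) else 0)"
        by (intro avg_B_infinity domain_neq_0)
      then show "avg (B m (n, j)) x = (\<Sum>u\<in>{(n div p, 1)}. c u * B (Suc m) u x)"
        by (simp add: j c_def B_infinity)
    qed (auto simp: c_def idx_infinity)
    show "k = j \<and> i \<le> n \<and> pabs (c (i, k)) \<le> real p powr (1 + real n / real p - real i)"
      if "c (i, k) \<noteq> 0" for i k
    proof -
      have "p dvd n" "i = n div p" "k = 1"
        using that by (auto simp: c_def split: if_splits)
      moreover from this have "real i = real n / real p"
        by (simp add: real_of_nat_div)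
      ultimately show ?thesis
        using p_gt_1 by (simp add: c_def j)
    qed
  qed (use j in simp)
next
  case (2 n' j')
  then have n: "1 \<le> n" and j: "j \<in> {2..l}"
    by simp_all
  let ?G = "avg_poly_coeffs (pt m j) n"
  define c where "c u = (if u \<in> (\<lambda>i. (i, j)) ` {1..n} then coeff ?G (n - fst u) else 0)" for u
  have G_Zq: "coeff ?G i \<in> Zq" for i
    by (rule Zq_avg_poly_coeffs[OF pt_Zq[OF j]])
  show thesis
  proof (rule that[of c])
    show "fin_rep (Suc m) c (avg (B m (n, j)))"
    proof (rule fin_repI[of "(\<lambda>i. (i, j)) ` {1..n}"])
      show "(\<lambda>i. (i, j)) ` {1..n} \<subseteq> idx"
        using j by (auto intro: idx_finite)
      show "avg (B m (n, j)) x = (\<Sum>u\<in>(\<lambda>i. (i, j)) ` {1..n}. c u * B (Suc m) u x)"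
        if "x \<in> domain (Suc m)" for x
        using avg_B_finite[OF j _ that, of n] n
        by (subst sum.reindex) (auto simp: inj_on_def c_def intro!: sum.cong)
    qed (auto simp: c_def G_Zq)
    show "k = j \<and> i \<le> n \<and> pabs (c (i, k)) \<le> real p powr (1 + real n / real p - real i)"
      if "c (i, k) \<noteq> 0" for i k
    proof -
      have ik: "k = j" "i \<in> {1..n}"
        using that by (auto simp: c_def split: if_splits)
      have "pt m j = 0 \<or> pabs (pt m j) = 1"
        using j pt_2 pt_unit[of j m] by (cases "j = 2") auto
      from pabs_avg_poly_coeffs_le[OF this, of n "n - i"] show ?thesis
        using ik by (simp add: c_def of_nat_diff add_diff_eq)
    qed
    show "c (n, j) \<noteq> 0" if "3 \<le> j"
    proof -
      have "pt m j \<noteq> 0"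
        using pt_unit[of j m] j that by auto
      then show ?thesis
        using avg_poly_coeffs_0 n by (auto simp: c_def)
    qed
  qed
qed

text \<open>
  A basis function of order \<open>m\<close> is sent to orders \<open>n \<le> m\<close>. When \<open>n\<close> stays close to \<open>m\<close>, the
  coefficient has \<open>p\<close>-order about \<open>n - m/p\<close>; when it does not, the weight drops by a multiple
  of \<open>m - n\<close>. A convex combination of both gains is linear in \<open>n\<close> alone.
\<close>

definition gain_rate :: "real \<Rightarrow> real" where
  "gain_rate \<kappa> = min 1 (\<kappa> / real (\<Sum>j=1..l. d j))"

definition gain :: "real \<Rightarrow> nat \<times> nat \<Rightarrow> real" where
  "gain \<kappa> u = max 0 (gain_rate \<kappa> * (real (fst u) / 2 - 1))"

lemma gain_nonneg: "0 \<le> gain \<kappa> u"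
  by (simp add: gain_def)

lemma d_sum_pos: "0 < (\<Sum>j=1..l. d j)"
  using d_pos l_ge_2 by (intro sum_pos) auto

lemma gain_rate_pos: "0 < \<kappa> \<Longrightarrow> 0 < gain_rate \<kappa>"
  using d_sum_pos by (simp add: gain_rate_def del: of_nat_sum)

text \<open>The identity (n - i)/p + (i - n/p - 1) = i (1 - 1/p) - 1 eliminates n, and 1 - 1/p is at
  least 1/2; hence i/2 - 1 in \<open>gain\<close>. The rate exceeds neither 1 nor
  \<open>\<kappa>\<close> / d j for any j, which is why it involves the sum of all d j.\<close>

lemma gain_le:
  assumes "0 < \<kappa>" "j \<in> {1..l}" "i \<le> n"
  shows "\<kappa> * weight (i, j) + gain \<kappa> (i, j) \<le> \<kappa> * weight (n, j) + max 0 (real i - real n / real p - 1)"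
proof -
  let ?\<mu> = "gain_rate \<kappa>"
  have dj: "0 < real (d j)"
    using d_pos[OF assms(2)] by simp
  have "d j \<le> (\<Sum>j=1..l. d j)"
    using assms(2) by (intro member_le_sum) auto
  then have "\<kappa> / real (\<Sum>j=1..l. d j) \<le> \<kappa> / real (d j)"
    using assms(1) dj by (intro divide_left_mono) (auto simp del: of_nat_sum)
  then have \<mu>: "0 < ?\<mu>" "?\<mu> \<le> 1" "?\<mu> \<le> \<kappa> / real (d j)"
    using gain_rate_pos[OF assms(1)] by (auto simp: gain_rate_def)
  have diff: "\<kappa> * weight (n, j) - \<kappa> * weight (i, j) = \<kappa> / real (d j) * (real n - real i)"
    by (simp add: weight_def diff_divide_distrib right_diff_distrib)
  have ni: "0 \<le> real n - real i"
    using assms(3) by simp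
  have "?\<mu> * (real i / 2 - 1) \<le> \<kappa> / real (d j) * (real n - real i) + max 0 (real i - real n / real p - 1)"
  proof -
    have p2: "1 / real p \<le> 1 / 2"
      using p_ge_2 by (intro divide_left_mono) auto
    have "real i / real p \<le> real i / 2"
      using mult_left_mono[OF p2, of "real i"] by simp
    then have "?\<mu> * (real i / 2 - 1) \<le> ?\<mu> * ((real n - real i) / real p + (real i - real n / real p - 1))"
      using \<mu>(1) by (intro mult_left_mono) (auto simp: diff_divide_distrib)
    also have "\<dots> = ?\<mu> * ((real n - real i) / real p) + ?\<mu> * (real i - real n / real p - 1)"
      by (rule distrib_left)
    also have "\<dots> \<le> \<kappa> / real (d j) * (real n - real i) + max 0 (real i - real n / real p - 1)"
    proof (rule add_mono)
      have "(real n - real i) / real p \<le> (real n - real i) / 1"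
        using p_gt_1 ni by (intro divide_left_mono) auto
      then show "?\<mu> * ((real n - real i) / real p) \<le> \<kappa> / real (d j) * (real n - real i)"
        using \<mu> ni by (intro mult_mono) auto
      have "?\<mu> * (real i - real n / real p - 1) \<le> ?\<mu> * max 0 (real i - real n / real p - 1)"
        using \<mu>(1) by (intro mult_left_mono) auto
      also have "\<dots> \<le> max 0 (real i - real n / real p - 1)"
        using \<mu> by (intro mult_left_le_one_le) auto
      finally show "?\<mu> * (real i - real n / real p - 1) \<le> max 0 (real i - real n / real p - 1)" .
    qed
    finally show ?thesis .
  qed
  moreover have "0 \<le> \<kappa> / real (d j) * (real n - real i) + max 0 (real i - real n / real p - 1)"
    using ni assms(1) by (intro add_nonneg_nonneg mult_nonneg_nonneg) auto
  ultimately show ?thesis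
    using diff by (simp add: gain_def)
qed

definition gained_level :: "real \<Rightarrow> real \<Rightarrow> nat \<Rightarrow> nat \<times> nat \<Rightarrow> real" where
  "gained_level \<kappa> N t u = real p powr (- (N - \<kappa> * real t + \<kappa> * weight u + gain \<kappa> u))"

lemma gained_level_le: "gained_level \<kappa> N t u \<le> fps_level \<kappa> N t u"
  unfolding gained_level_def fps_level_def level_def
  using p_gt_1 gain_nonneg by (intro powr_mono) auto

lemma fps_rep_U:
  assumes "0 < \<kappa>" and \<xi>: "fps_rep m (fps_level \<kappa> N) \<xi>"
  shows "fps_rep (Suc m) (gained_level \<kappa> N) (U \<xi>)"
  unfolding fps_rep_def
proof
  fix t
  obtain c where c: "fin_rep m c (\<lambda>x. fps_nth (\<xi> x) t)" "\<And>u. c u \<noteq> 0 \<Longrightarrow> pabs (c u) \<le> fps_level \<kappa> N t u"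
    using \<xi> unfolding fps_rep_def rep_le_def by blast
  \<comment> \<open>Entries are integral and also at most p^(1 + n/p - i); \<open>max 0\<close>
    takes the better of the two. The value 0 excludes entries at another pole or of higher
    order.\<close>
  define \<psi> where "\<psi> u w = (if snd w = snd u \<and> fst w \<le> fst u
    then real p powr (- max 0 (real (fst w) - real (fst u) / real p - 1)) else 0)" for u w :: "nat \<times> nat"
  have "rep_le (Suc m) (gained_level \<kappa> N t) (\<lambda>x. \<Sum>u | c u \<noteq> 0. c u * avg (B m u) x)"
  proof (rule rep_le_linear[OF c(1)])
    fix u assume "c u \<noteq> 0"
    then have u: "u \<in> idx"
      using fin_repD(2)[OF c(1)] by blast
    obtain n j where nj: "u = (n, j)"
      by (cases u)
    obtain e where e: "fin_rep (Suc m) e (avg (B m (n, j)))"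
      "\<And>i k. e (i, k) \<noteq> 0 \<Longrightarrow> k = j \<and> i \<le> n \<and> pabs (e (i, k)) \<le> real p powr (1 + real n / real p - real i)"
      using avg_B_fin_rep[of n j m] u nj by metis
    have "pabs (e w) \<le> \<psi> u w" if "e w \<noteq> 0" for w
    proof -
      obtain i k where w: "w = (i, k)"
        by (cases w)
      have ik: "k = j" "i \<le> n" "pabs (e (i, k)) \<le> real p powr (1 + real n / real p - real i)"
        using e(2)[of i k] that w by auto
      have "pabs (e (i, k)) \<le> real p powr 0"
        using fin_repD(3)[OF e(1)] p_gt_0 by (simp add: Zq_iff)
      then have "pabs (e (i, k)) \<le> real p powr (- max 0 (real i - real n / real p - 1))"
        using ik(3) by (cases "0 \<le> real i - real n / real p - 1") (auto simp: max_def algebra_simps)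
      then show ?thesis
        using ik w nj by (simp add: \<psi>_def)
    qed
    then show "rep_le (Suc m) (\<psi> u) (avg (B m u))"
      using e(1) nj unfolding rep_le_def by blast
  next
    fix u w assume cu: "c u \<noteq> 0" and w: "w \<in> idx"
    obtain n j i k where nj: "u = (n, j)" "w = (i, k)"
      by (cases u, cases w)
    show "pabs (c u) * \<psi> u w \<le> gained_level \<kappa> N t w"
    proof (cases "k = j \<and> i \<le> n")
      case True
      then have jk: "k = j" "i \<le> n" "j \<in> {1..l}"
        using w nj l_ge_2 by (auto simp: idx_def)
      have "pabs (c u) * \<psi> u w \<le> fps_level \<kappa> N t u * \<psi> u w"
        using c(2)[OF cu] by (intro mult_right_mono) (auto simp: \<psi>_def)
      also have "\<dots> = real p powr (- (N - \<kappa> * real t + (\<kappa> * weight (n, j) + max 0 (real i - real n / real p - 1))))"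
        using jk nj by (simp add: \<psi>_def fps_level_def level_def powr_add[symmetric] algebra_simps)
      also have "\<dots> \<le> gained_level \<kappa> N t w"
        unfolding gained_level_def using gain_le[OF assms(1) jk(3,2)] jk nj p_gt_1
        by (intro powr_mono) auto
      finally show ?thesis .
    next
      case False
      then have "\<psi> u w = 0"
        using nj by (auto simp: \<psi>_def)
      then show ?thesis
        by (simp add: gained_level_def)
    qed
  qed
  then show "rep_le (Suc m) (gained_level \<kappa> N t) (\<lambda>x. fps_nth (U \<xi> x) t)"
    by (rule rep_le_cong) (simp add: fps_nth_U avg_fin_rep[OF c(1)])
qed

lemma fps_rep_mono: "fps_rep m \<Phi> \<xi> \<Longrightarrow> (\<And>t u. \<Phi> t u \<le> \<Psi> t u) \<Longrightarrow> fps_rep m \<Psi> \<xi>"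
  unfolding fps_rep_def using rep_le_mono by blast

lemma fin_rep_a: "fin_rep a c g \<longleftrightarrow> fin_rep 0 c g"
proof -
  have "(\<Sum>u | c u \<noteq> 0. c u * B a u x) = (\<Sum>u | c u \<noteq> 0. c u * B 0 u x)" if "{u. c u \<noteq> 0} \<subseteq> idx" for x
    using that by (intro sum.cong) (auto simp: B_a subset_iff)
  then show ?thesis
    unfolding fin_rep_def domain_a by auto
qed

lemma fps_rep_a: "fps_rep a \<Phi> \<xi> \<longleftrightarrow> fps_rep 0 \<Phi> \<xi>"
  by (simp add: fps_rep_def rep_le_def fin_rep_a)

section \<open>Unrolling the product in \<open>alpha_a\<close>\<close>

text \<open>Multiplication by one twist of \<open>F\<close> alternates with one \<open>U\<close>.
  Stage m lives on the m-th twist, so each \<open>U\<close> can be estimated separately.\<close>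

primrec chain :: "('k \<Rightarrow> 'k fps) \<Rightarrow> nat \<Rightarrow> 'k \<Rightarrow> 'k fps" where
  "chain \<xi> 0 = \<xi>"
| "chain \<xi> (Suc m) = U (\<lambda>x. frob_pow m F x * chain \<xi> m x)"

text \<open>The projection formula: G(z^p) is constant on the fibre over x.\<close>

lemma U_mult_power: "U (\<lambda>z. G (z ^ p) * \<xi> z) x = G x * U \<xi> x"
proof -
  have "(\<Sum>z | z ^ p = x. G (z ^ p) * \<xi> z) = G x * (\<Sum>z | z ^ p = x. \<xi> z)"
    unfolding sum_distrib_left by (intro sum.cong) auto
  then show ?thesis
    by (simp add: U_def mult.left_commute)
qed

lemma alpha_a_eq_chain: "alpha_a \<xi> = chain \<xi> a"
proof -
  \<comment> \<open>After k applications the factors with m < k are absorbed in the chain; each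
    remaining argument has lost k of its p-th powers, so the factor m = k is the next
    multiplier.\<close>
  have "(U ^^ k) (\<lambda>x. F_a x * \<xi> x) = (\<lambda>y. (\<Prod>m\<in>{k..<a}. frob_pow m F (y ^ p ^ (m - k))) * chain \<xi> k y)"
    if "k \<le> a" for k
    using that
  proof (induction k)
    case 0
    then show ?case
      by (simp add: F_a_def atLeast0LessThan)
  next
    case (Suc k)
    define G where "G y = (\<Prod>m\<in>{Suc k..<a}. frob_pow m F (y ^ p ^ (m - Suc k)))" for y
    have "(\<Prod>m\<in>{k..<a}. frob_pow m F (y ^ p ^ (m - k))) = frob_pow k F y * G (y ^ p)" for y
    proof -
      have "(\<Prod>m\<in>{k..<a}. frob_pow m F (y ^ p ^ (m - k))) =
          frob_pow k F y * (\<Prod>m\<in>{Suc k..<a}. frob_pow m F (y ^ p ^ (m - k)))"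
        using Suc.prems by (simp add: prod.atLeast_Suc_lessThan)
      also have "(\<Prod>m\<in>{Suc k..<a}. frob_pow m F (y ^ p ^ (m - k))) = G (y ^ p)"
        unfolding G_def
      proof (intro prod.cong refl)
        fix m assume "m \<in> {Suc k..<a}"
        then have "m - k = Suc (m - Suc k)"
          by auto
        then have "y ^ p ^ (m - k) = (y ^ p) ^ p ^ (m - Suc k)"
          by (simp only: power_Suc power_mult)
        then show "frob_pow m F (y ^ p ^ (m - k)) = frob_pow m F ((y ^ p) ^ p ^ (m - Suc k))"
          by (simp only:)
      qed
      finally show ?thesis .
    qed
    then have "(U ^^ Suc k) (\<lambda>x. F_a x * \<xi> x) = U (\<lambda>y. G (y ^ p) * (frob_pow k F y * chain \<xi> k y))"
      using Suc by (simp add: mult_ac)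
    also have "\<dots> = (\<lambda>y. G y * chain \<xi> (Suc k) y)"
      unfolding chain.simps by (intro ext U_mult_power)
    finally show ?case
      by (simp add: G_def)
  qed
  from this[of a] show ?thesis
    by (simp add: alpha_a_def)
qed

text \<open>The gains are given up here: these stages only have to keep the level, as the final
  \<open>U\<close> supplies the gain.\<close>

lemma fps_rep_chain:
  assumes "0 < \<kappa>" "fps_rep 0 (fps_level \<kappa> N) \<xi>"
  shows "fps_rep m (fps_level \<kappa> N) (chain \<xi> m)"
proof (induction m)
  case (Suc m)
  have "fps_rep m (fps_level \<kappa> N) (\<lambda>x. frob_pow m F x * chain \<xi> m x)"
    using fps_rep_mult[of \<kappa> m 0 "frob_pow m F" N] fps_rep_frob_pow Suc assms by simp
  from fps_rep_U[OF assms(1) this] show ?case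
    using gained_level_le by (auto intro: fps_rep_mono)
qed (use assms in simp)

lemma fps_rep_alpha_1:
  assumes "0 < \<kappa>" "fps_rep 0 (fps_level \<kappa> N) \<xi>"
  shows "fps_rep 0 (gained_level \<kappa> N) (alpha_1 \<xi>)"
proof -
  have "fps_rep 0 (fps_level \<kappa> N) (\<lambda>x. F x * \<xi> x)"
    using fps_rep_mult[OF _ fps_rep_F assms(2)] assms by simp
  from fps_rep_inv_frob(2)[OF fps_rep_U[OF assms(1) this]] show ?thesis
    by (simp add: alpha_1_def)
qed

lemma fps_rep_alpha_a:
  assumes "0 < \<kappa>" "fps_rep 0 (fps_level \<kappa> N) \<xi>"
  shows "fps_rep 0 (gained_level \<kappa> N) (alpha_a \<xi>)"
proof -
  obtain m where m: "a = Suc m"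
    using a_ge_1 by (cases a) auto
  have "fps_rep m (fps_level \<kappa> N) (\<lambda>x. frob_pow m F x * chain \<xi> m x)"
    using fps_rep_mult[of \<kappa> m 0 "frob_pow m F" N] fps_rep_frob_pow fps_rep_chain[OF assms] assms by simp
  from fps_rep_U[OF assms(1) this] have "fps_rep (Suc m) (gained_level \<kappa> N) (chain \<xi> (Suc m))"
    by simp
  then have "fps_rep a (gained_level \<kappa> N) (chain \<xi> a)"
    by (simp only: m[symmetric])
  then show ?thesis
    by (simp add: fps_rep_a alpha_a_eq_chain)
qed

section \<open>Complete continuity\<close>

text \<open>The shift \<open>weight u - weight w\<close> in \<open>D\<close> cancels the source
  level -\<open>\<kappa>\<close> \<open>weight u\<close> and the target term \<open>\<kappa>\<close>
  \<open>weight w\<close>. Only the gain at \<open>w\<close> remains, independently of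
  \<open>u\<close>.\<close>

lemma ord_pi_p_D_ge:
  assumes "0 < \<kappa>" "u \<in> idx"
    and \<alpha>: "\<And>N \<xi>. fps_rep 0 (fps_level \<kappa> N) \<xi> \<Longrightarrow> fps_rep 0 (gained_level \<kappa> N) (\<alpha> \<xi>)"
  shows "ereal (gain \<kappa> w) \<le> ord_pi_p p \<kappa> (D \<alpha> u w)"
  unfolding ord_pi_p_def
proof (rule INF_greatest)
  fix r
  let ?s = "weight u - weight w"
  have rep: "fps_rep 0 (gained_level \<kappa> (- (\<kappa> * weight u))) (\<alpha> (\<lambda>x. fps_const (B 0 u x)))"
    by (intro \<alpha> fps_rep_const_B assms)
  show "ereal (gain \<kappa> w) \<le> ord_p p (D \<alpha> u w r) + ereal (\<kappa> * r)"
  proof (cases "D \<alpha> u w r = 0")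
    case False
    then have "r - ?s \<in> \<nat>"
      by (auto simp: D_def pi_shift_def split: if_splits)
    then obtain t where t: "r = ?s + real t"
      by (metis Nats_cases diff_add_cancel add.commute)
    then have D: "D \<alpha> u w r = fps_nth (coeffs_of 0 (\<alpha> (\<lambda>x. fps_const (B 0 u x))) w) t"
      by (simp add: D_def C_def pi_shift_def)
    have "pabs (D \<alpha> u w r) \<le> gained_level \<kappa> (- (\<kappa> * weight u)) t w"
      unfolding D using fps_rep_coeffs_of[OF rep, of w t] False D by simp
    then have "log (real p) (pabs (D \<alpha> u w r)) \<le> - (- (\<kappa> * weight u) - \<kappa> * real t + \<kappa> * weight w + gain \<kappa> w)"
      unfolding gained_level_def using False p_gt_1 by (subst log_le_iff) auto
    then have "gain \<kappa> w \<le> - log (real p) (pabs (D \<alpha> u w r)) + \<kappa> * r"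
      by (simp add: t algebra_simps)
    then show ?thesis
      using False by (simp add: ord_p_def)
  qed (simp add: ord_p_def)
qed

lemma completely_continuous_if_gain:
  assumes "0 < \<kappa>"
    and \<alpha>: "\<And>N \<xi>. fps_rep 0 (fps_level \<kappa> N) \<xi> \<Longrightarrow> fps_rep 0 (gained_level \<kappa> N) (\<alpha> \<xi>)"
  shows "completely_continuous (ord_pi_p p \<kappa>) \<alpha>"
  unfolding completely_continuous_def tendsto_PInfty eventually_inf_principal eventually_cofinite
proof
  fix r :: real
  \<comment> \<open>Solves \<open>gain_rate \<kappa>\<close> (i/2 - 1) > |r| for the order i;
    finitely many orders at l poles are left.\<close>
  define M where "M = nat \<lceil>2 * (\<bar>r\<bar> / gain_rate \<kappa> + 1)\<rceil>"
  have big: "ereal r < (INF u\<in>idx. ord_pi_p p \<kappa> (D \<alpha> u w))" if "M < fst w" for w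
  proof -
    have "2 * (\<bar>r\<bar> / gain_rate \<kappa> + 1) < real (fst w)"
      using that unfolding M_def by linarith
    then have "\<bar>r\<bar> / gain_rate \<kappa> < real (fst w) / 2 - 1"
      by simp
    then have "\<bar>r\<bar> < gain_rate \<kappa> * (real (fst w) / 2 - 1)"
      using gain_rate_pos[OF assms(1)] by (simp add: pos_divide_less_eq mult.commute)
    then have "ereal r < ereal (gain \<kappa> w)"
      by (simp add: gain_def)
    also have "\<dots> \<le> (INF u\<in>idx. ord_pi_p p \<kappa> (D \<alpha> u w))"
      by (intro INF_greatest ord_pi_p_D_ge assms)
    finally show ?thesis .
  qed
  have "{w. \<not> (w \<in> idx \<longrightarrow> ereal r < (INF u\<in>idx. ord_pi_p p \<kappa> (D \<alpha> u w)))} \<subseteq> {..M} \<times> {1..l}"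
  proof
    fix w assume w: "w \<in> {w. \<not> (w \<in> idx \<longrightarrow> ereal r < (INF u\<in>idx. ord_pi_p p \<kappa> (D \<alpha> u w)))}"
    then have "fst w \<le> M"
      using big[of w] by force
    moreover have "snd w \<in> {1..l}"
      using w l_ge_2 by (auto simp: idx_def)
    ultimately show "w \<in> {..M} \<times> {1..l}"
      by (simp add: mem_Times_iff)
  qed
  then show "finite {w. \<not> (w \<in> idx \<longrightarrow> ereal r < (INF u\<in>idx. ord_pi_p p \<kappa> (D \<alpha> u w)))}"
    by (rule finite_subset) simp
qed

section \<open>Leading coefficients at a third pole\<close>

definition leads :: "nat \<Rightarrow> nat \<Rightarrow> nat \<Rightarrow> ('k \<Rightarrow> 'k) \<Rightarrow> bool" where
  "leads m n j g \<longleftrightarrow> (\<exists>c. fin_rep m c g \<and> c (n, j) \<noteq> 0 \<and> (\<forall>i k. c (i, k) \<noteq> 0 \<longrightarrow> k = j \<and> i \<le> n))"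

lemma leads_cong:
  assumes "leads m n j f" "\<And>x. x \<in> domain m \<Longrightarrow> g x = f x"
  shows "leads m n j g"
proof -
  have "fin_rep m c f \<Longrightarrow> fin_rep m c g" for c
    using assms(2) by (simp add: fin_rep_def)
  then show ?thesis
    using assms(1) unfolding leads_def by blast
qed

lemma leads_B:
  assumes "1 \<le> n" "j \<in> {1..l}"
  shows "leads m n j (B m (n, j))"
proof -
  have "fin_rep m (\<lambda>u. if u = (n, j) then 1 else 0) (B m (n, j))"
    by (rule fin_repI[of "{(n, j)}"]) (use assms idx_finite in auto)
  then show ?thesis
    unfolding leads_def by (intro exI[of _ "\<lambda>u. if u = (n, j) then 1 else 0"]) auto
qed

text \<open>\<open>U\<close> is triangular for the pole order, so the new leading coefficient is the
  old one times a diagonal entry, nonzero at a pole other than 0 and infinity.\<close>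

lemma leads_avg:
  assumes "leads m n j g" "3 \<le> j"
  shows "leads (Suc m) n j (avg g)"
proof -
  obtain c where c: "fin_rep m c g" "c (n, j) \<noteq> 0" "\<And>i k. c (i, k) \<noteq> 0 \<Longrightarrow> k = j \<and> i \<le> n"
    using assms(1) unfolding leads_def by blast
  define good where "good u e \<longleftrightarrow> fin_rep (Suc m) e (avg (B m u)) \<and>
      (\<forall>i k. e (i, k) \<noteq> 0 \<longrightarrow> k = snd u \<and> i \<le> fst u) \<and> (3 \<le> snd u \<longrightarrow> e u \<noteq> 0)" for u e
  have "\<exists>e. c u \<noteq> 0 \<longrightarrow> good u e" for u
  proof (cases "c u = 0")
    case False
    then have u: "u \<in> idx"
      using fin_repD(2)[OF c(1)] by blast
    obtain i k where ik: "u = (i, k)"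
      by (cases u)
    show ?thesis
      using avg_B_fin_rep[of i k m] u unfolding ik good_def fst_conv snd_conv by metis
  qed simp
  then obtain e where e: "\<And>u. c u \<noteq> 0 \<Longrightarrow> good u (e u)"
    by metis
  define b where "b w = (\<Sum>u | c u \<noteq> 0. c u * e u w)" for w
  have "fin_rep (Suc m) b (\<lambda>x. \<Sum>u | c u \<noteq> 0. c u * avg (B m u) x)"
    unfolding b_def by (rule fin_rep_linear[OF c(1)]) (use e good_def in blast)
  then have "fin_rep (Suc m) b (avg g)"
    using avg_fin_rep[OF c(1)] by (simp add: fin_rep_def)
  moreover have "b (n, j) \<noteq> 0"
  proof -
    have "b (n, j) = (\<Sum>u\<in>{(n, j)}. c u * e u (n, j))"
      unfolding b_def
    proof (rule sum.mono_neutral_right)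
      show "finite {u. c u \<noteq> 0}"
        by (rule fin_repD(1)[OF c(1)])
      show "\<forall>u\<in>{u. c u \<noteq> 0} - {(n, j)}. c u * e u (n, j) = 0"
      proof
        fix u assume u: "u \<in> {u. c u \<noteq> 0} - {(n, j)}"
        then have "snd u = j" "fst u \<le> n" "u \<noteq> (n, j)"
          using c(3)[of "fst u" "snd u"] by auto
        then have "\<not> n \<le> fst u"
          by (metis antisym prod.collapse)
        then have "e u (n, j) = 0"
          using e[of u] u unfolding good_def by auto
        then show "c u * e u (n, j) = 0"
          by simp
      qed
    qed (use c(2) in auto)
    then show ?thesis
      using c(2) e[OF c(2)] assms(2) by (simp add: good_def)
  qed
  moreover have "k = j \<and> i \<le> n" if ne: "b (i, k) \<noteq> 0" for i k
  proof -
    obtain u where u: "c u \<noteq> 0" "e u (i, k) \<noteq> 0"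
      using ne unfolding b_def by (metis (mono_tags, lifting) mem_Collect_eq mult_zero_right sum.neutral)
    have "k = snd u" "i \<le> fst u"
      using e[OF u(1)] u(2) unfolding good_def by blast+
    then show ?thesis
      using c(3)[of "fst u" "snd u"] u(1) by auto
  qed
  ultimately show ?thesis
    unfolding leads_def by blast
qed

lemma fps_nth_F_0: "fps_nth (F x) 0 = 1"
proof -
  have "fps_nth (\<Prod>i\<in>I. f i) 0 = (\<Prod>i\<in>I. fps_nth (f i) 0)" for I :: "nat set" and f :: "nat \<Rightarrow> 'k fps"
    by (induction I rule: infinite_finite_induct) auto
  then show ?thesis
    by (simp add: F_def artin_hasse_0)
qed

text \<open>The constant term of \<open>F\<close> is the function 1, whose single coefficient
  \<open>\<tau>\<close> fixes. As \<open>frob\<close> acts through \<open>coeffs_of\<close>, this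
  coefficient has to be identified first.\<close>

lemma fps_nth_frob_pow_0:
  assumes "x \<in> domain m"
  shows "fps_nth (frob_pow m F x) 0 = 1"
  using assms
proof (induction m arbitrary: x)
  case 0
  then show ?case
    by (simp add: fps_nth_F_0)
next
  case (Suc m)
  let ?\<xi> = "frob_pow m F"
  let ?one = "\<lambda>u. if u = (0, 1) then 1 else 0 :: 'k"
  have rep: "fps_rep m (fps_level 1 0) ?\<xi>"
    by (rule fps_rep_frob_pow) simp
  obtain c where c: "\<forall>t. fin_rep m (c t) (\<lambda>x. fps_nth (?\<xi> x) t) \<and> (\<forall>u. c t u \<noteq> 0 \<longrightarrow> pabs (c t u) \<le> fps_level 1 0 t u)"
    using fps_rep_choose[OF rep] by blast
  have one: "fin_rep m ?one (\<lambda>x. fps_nth (?\<xi> x) 0)"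
    by (rule fin_repI[of "{(0, 1)}"]) (auto simp: Suc.IH B_0 idx_infinity)
  \<comment> \<open>Arbitrarily chosen expansions, replaced in degree 0 by the explicit one, still
    meet the hypothesis of \<open>coeffs_of_eq\<close>, which then returns the explicit
    coefficient.\<close>
  have "fin_rep m ((c(0 := ?one)) t) (\<lambda>x. fps_nth (?\<xi> x) t)" for t
    using c one by (cases "t = 0") auto
  from coeffs_of_eq[OF this] have "fps_nth (coeffs_of m ?\<xi> u) 0 = ?one u" for u
    by simp
  then have "fin_rep (Suc m) (\<lambda>u. \<tau> (?one u)) (\<lambda>x. fps_nth (frob m ?\<xi> x) 0)"
    using fps_rep_frob(1)[OF rep, of 0] by simp
  from fin_rep_sum_superset[OF this Suc.prems, of "{(0, 1)}"] show ?case
    by (simp add: B_0 split: if_splits)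
qed

lemma leads_chain:
  assumes "1 \<le> n" "j \<in> {3..l}"
  shows "leads m n j (\<lambda>x. fps_nth (chain (\<lambda>x. fps_const (B 0 (n, j) x)) m x) 0)"
proof (induction m)
  case 0
  then show ?case
    using leads_B[of n j 0] assms by simp
next
  case (Suc m)
  let ?\<xi> = "chain (\<lambda>x. fps_const (B 0 (n, j) x))"
  have "leads m n j (\<lambda>x. fps_nth (frob_pow m F x * ?\<xi> m x) 0)"
    using Suc by (rule leads_cong) (simp add: fps_nth_frob_pow_0)
  then have "leads (Suc m) n j (avg (\<lambda>x. fps_nth (frob_pow m F x * ?\<xi> m x) 0))"
    using assms by (intro leads_avg) auto
  then show ?case
    by (rule leads_cong) (simp add: fps_nth_U)
qed

lemma leads_coeffs_of:
  assumes "leads m n j (\<lambda>x. fps_nth (\<xi> x) 0)" "fps_rep m \<Phi> \<xi>"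
  shows "fps_nth (coeffs_of m \<xi> (n, j)) 0 \<noteq> 0"
proof -
  obtain c where c: "\<forall>t. fin_rep m (c t) (\<lambda>x. fps_nth (\<xi> x) t) \<and> (\<forall>u. c t u \<noteq> 0 \<longrightarrow> pabs (c t u) \<le> \<Phi> t u)"
    using fps_rep_choose[OF assms(2)] by blast
  obtain b where b: "fin_rep m b (\<lambda>x. fps_nth (\<xi> x) 0)" "b (n, j) \<noteq> 0"
    using assms(1) unfolding leads_def by blast
  have "fin_rep m ((c(0 := b)) t) (\<lambda>x. fps_nth (\<xi> x) t)" for t
    using c b by (cases "t = 0") auto
  from coeffs_of_eq[OF this] show ?thesis
    using b(2) by simp
qed

lemma C_alpha_a_diagonal:
  assumes "1 \<le> n" "j \<in> {3..l}"
  shows "fps_nth (C alpha_a (n, j) (n, j)) 0 \<noteq> 0"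
proof -
  let ?\<xi> = "\<lambda>x. fps_const (B 0 (n, j) x)"
  have idx: "(n, j) \<in> idx"
    using assms by (intro idx_finite) auto
  have rep: "fps_rep 0 (gained_level 1 (- (1 * weight (n, j)))) (alpha_a ?\<xi>)"
    by (intro fps_rep_alpha_a fps_rep_const_B idx) simp
  have "leads a n j (\<lambda>x. fps_nth (alpha_a ?\<xi> x) 0)"
    unfolding alpha_a_eq_chain by (rule leads_chain[OF assms])
  from leads_coeffs_of[OF this] have "fps_nth (coeffs_of a (alpha_a ?\<xi>) (n, j)) 0 \<noteq> 0"
    using rep fps_rep_a by blast
  \<comment> \<open>The chain ends on the twist \<open>a\<close>, whereas \<open>C\<close> refers to
    the twist 0; the poles agree because Teichmueller points satisfy c^q = c.\<close>
  moreover have "coeffs_of a (alpha_a ?\<xi>) = coeffs_of 0 (alpha_a ?\<xi>)"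
  proof -
    obtain c where c: "\<forall>t. fin_rep 0 (c t) (\<lambda>x. fps_nth (alpha_a ?\<xi> x) t) \<and>
        (\<forall>u. c t u \<noteq> 0 \<longrightarrow> pabs (c t u) \<le> gained_level 1 (- (1 * weight (n, j))) t u)"
      using fps_rep_choose[OF rep] by blast
    then have c0: "fin_rep 0 (c t) (\<lambda>x. fps_nth (alpha_a ?\<xi> x) t)" for t
      by blast
    have ca: "fin_rep a (c t) (\<lambda>x. fps_nth (alpha_a ?\<xi> x) t)" for t
      using c0[of t] by (simp add: fin_rep_a)
    show ?thesis
      by (simp only: coeffs_of_eq[OF c0] coeffs_of_eq[OF ca])
  qed
  ultimately show ?thesis
    by (simp add: C_def)
qed

lemma C_alpha_1_diagonal:
  assumes "1 \<le> n" "j \<in> {3..l}"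
  shows "fps_nth (C alpha_1 (n, j) (n, j)) 0 \<noteq> 0"
proof -
  let ?\<xi> = "\<lambda>x. fps_const (B 0 (n, j) x)"
  let ?\<eta> = "U (\<lambda>x. F x * ?\<xi> x)"
  have idx: "(n, j) \<in> idx"
    using assms by (intro idx_finite) auto
  have "fps_rep 0 (fps_level 1 (- (1 * weight (n, j)))) (\<lambda>x. F x * ?\<xi> x)"
    using fps_rep_mult[OF _ fps_rep_F fps_rep_const_B[OF idx], of 1] by simp
  then have rep: "fps_rep (Suc 0) (gained_level 1 (- (1 * weight (n, j)))) ?\<eta>"
    by (intro fps_rep_U) simp_all
  \<comment> \<open>The first stage of the chain is \<open>U\<close> after multiplication by
    \<open>F\<close>. Only the inverse Frobenius remains, which sends no nonzero element of
    \<open>Qq\<close> to 0.\<close>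
  have "leads (Suc 0) n j (\<lambda>x. fps_nth (?\<eta> x) 0)"
    using leads_chain[OF assms, of "Suc 0"] by simp
  then have ne: "fps_nth (coeffs_of (Suc 0) ?\<eta> (n, j)) 0 \<noteq> 0"
    using rep by (rule leads_coeffs_of)
  have "coeffs_of 0 (alpha_1 ?\<xi>) = (\<lambda>u. Abs_fps (\<lambda>t. inv_into Qq \<tau> (fps_nth (coeffs_of (Suc 0) ?\<eta> u) t)))"
    unfolding alpha_1_def by (rule coeffs_of_eq[OF fps_rep_inv_frob(1)[OF rep]])
  then have "fps_nth (C alpha_1 (n, j) (n, j)) 0 = inv_into Qq \<tau> (fps_nth (coeffs_of (Suc 0) ?\<eta> (n, j)) 0)"
    by (simp add: C_def)
  moreover have "fps_nth (coeffs_of (Suc 0) ?\<eta> (n, j)) 0 \<in> Qq"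
    using fin_repD(3)[OF fps_rep_fin_rep[OF rep]] by (simp add: Zq_iff)
  ultimately show ?thesis
    using ne frob_inv_frob frob_0 by metis
qed

text \<open>
  A nonzero constant term on the diagonal for every order at a third pole keeps the infimum
  at most \<open>0\<close> along an infinite set.
\<close>

lemma not_completely_continuous_if_diagonal:
  assumes "3 \<le> l" and \<alpha>: "\<And>n. 1 \<le> n \<Longrightarrow> fps_nth (C \<alpha> (n, 3) (n, 3)) 0 \<noteq> 0"
  shows "\<not> completely_continuous ord_pi \<alpha>"
proof
  assume "completely_continuous ord_pi \<alpha>"
  then have fin: "finite {w. \<not> (w \<in> idx \<longrightarrow> ereal 0 < (INF u\<in>idx. ord_pi (D \<alpha> u w)))}"
    unfolding completely_continuous_def tendsto_PInfty eventually_inf_principal eventually_cofinite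
    by blast
  have "(n, 3) \<in> {w. \<not> (w \<in> idx \<longrightarrow> ereal 0 < (INF u\<in>idx. ord_pi (D \<alpha> u w)))}" if n: "1 \<le> n" for n
  proof -
    have idx: "(n, 3) \<in> idx"
      using assms(1) n by (intro idx_finite) auto
    have "D \<alpha> (n, 3) (n, 3) 0 \<noteq> 0"
      using \<alpha>[OF n] by (simp add: D_def pi_shift_def)
    then have "ord_pi (D \<alpha> (n, 3) (n, 3)) \<le> ereal 0"
      unfolding ord_pi_def by (intro INF_lower) simp
    then have "(INF u\<in>idx. ord_pi (D \<alpha> u (n, 3))) \<le> ereal 0"
      using idx by (intro INF_lower2)
    then show ?thesis
      using idx by auto
  qed
  then have "(\<lambda>n. (n, 3)) ` {1..} \<subseteq> {w. \<not> (w \<in> idx \<longrightarrow> ereal 0 < (INF u\<in>idx. ord_pi (D \<alpha> u w)))}"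
    by auto
  then have "finite ((\<lambda>n::nat. (n, 3::nat)) ` {1..})"
    using fin finite_subset by blast
  then have "finite {1::nat..}"
    by (rule finite_imageD) (auto simp: inj_on_def)
  then show False
    using infinite_Ici by blast
qed

end

theorem corollary6p10:
  fixes p a l :: nat
    and Qq :: "'k::{alg_closed_field,field_char_0,complete_space} set"
    and \<tau> :: "'k \<Rightarrow> 'k"
    and P :: "nat \<Rightarrow> 'k set option"
    and d :: "nat \<Rightarrow> nat"
    and A :: "nat \<Rightarrow> nat \<Rightarrow> 'k"
  assumes "exponential_sum p a Qq \<tau> l P d A"
  defines "\<alpha>\<^sub>1 \<equiv> exponential_sum.alpha_1 p a Qq \<tau> l P d A"
    and "\<alpha>\<^sub>a \<equiv> exponential_sum.alpha_a p a Qq \<tau> l P d A"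
    and "cc \<equiv> exponential_sum.completely_continuous p a Qq l P d"
  shows "(3 \<le> l \<longrightarrow> \<not> cc ord_pi \<alpha>\<^sub>1 \<and> \<not> cc ord_pi \<alpha>\<^sub>a) \<and>
    (\<forall>c>0. cc (ord_pi_p p c) \<alpha>\<^sub>1 \<and> cc (ord_pi_p p c) \<alpha>\<^sub>a)"
proof -
  interpret exponential_sum p a Qq \<tau> l P d A
    by (rule assms)
  show ?thesis
    unfolding \<alpha>\<^sub>1_def \<alpha>\<^sub>a_def cc_def
  proof (intro conjI impI allI)
    assume "3 \<le> l"
    then show "\<not> completely_continuous ord_pi alpha_1"
      by (intro not_completely_continuous_if_diagonal C_alpha_1_diagonal) auto
    show "\<not> completely_continuous ord_pi alpha_a"
      using \<open>3 \<le> l\<close> by (intro not_completely_continuous_if_diagonal C_alpha_a_diagonal) auto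
  next
    fix c :: real assume "0 < c"
    then show "completely_continuous (ord_pi_p p c) alpha_1"
      by (intro completely_continuous_if_gain fps_rep_alpha_1)
    show "completely_continuous (ord_pi_p p c) alpha_a"
      using \<open>0 < c\<close> by (intro completely_continuous_if_gain fps_rep_alpha_a)
  qed
qed

end
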